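(* Let $(M,\omega)$ be a symplectic manifold admitting a metaplectic structure $(\pi_P,\Lambda)$, with a chosen compatible positive almost complex structure, and let $J:\mathcal{H}\to M\times H$ be a (normalized) Kuiper map with induced Kuiper connection $\Phi$. The exterior covariant derivatives $d^\Phi_k$ induced by $\Phi$ form a cochain complex in the category of right modules over the ring $CH$ of compact operators, i.e., $$d^\Phi_k(s\cdot a)=(d^\Phi_ks)\cdot a\qquad\text{and}\qquad d^\Phi_{k+1}\circ d^\Phi_k=0$$ for any $k$, any $a\in CH$ and any $s\in\Gamma(\mathcal{H}^k_R)$.
   Context: **Algebra.** $(V,\omega_0)$ is a real symplectic vector space of dimension $2n=\dim M$, $n\ge 1$; $G=Sp(V,\omega_0)$; $\lambda:\widetilde G\to G$ is its connected double cover. $J_0$ is a linear complex structure on $V$ such that $g_0(u,v)=\omega_0(J_0u,v)$ is an inner product; $K=O(V,g_0)\cap G$, $\widetilde K=\lambda^{-1}(K)$. $L\subset V$ is a Lagrangian subspace, $\check H=L^2(L)$ (complex valued); scalar products are anti-linear in the left variable. $\check\sigma:\widetilde G\to U(\check H)$ is a fixed Segal--Shale--Weil representation: the strongly continuous unitary representation with $\check\sigma(g)r(v,t)\check\sigma(g)^{-1}=r(\lambda(g)v,t)$, where $r$ is the Schrödinger representation of the Heisenberg group $V\times\mathbb{R}$ on $L^2(L)$. $H$ is the continuous dual of $\check H$; for $f\in H$, $f^\sharp\in\check H$ is defined by $f(v)=(f^\sharp,v)_{\check H}$; $v^\flat=(v,\cdot)_{\check H}$; $(f,g)_H=(g^\sharp,f^\sharp)_{\check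 H}$. $\sigma(g)f=f\circ\check\sigma(g)^{-1}$. For $u\in\check H$, $v\in H$, $u\otimes v$ is the operator $w\mapsto v(w)u$. $CH$ is the algebra of compact operators on $\check H$ and $\rho(g)a=\check\sigma(g)\circ a\circ\check\sigma(g)^{-1}$. $H^k=\bigwedge^kV^*\otimes_{\mathbb{R}}H$, $\sigma^k(g)(\alpha\otimes f)=\lambda^{*\wedge k}(g)\alpha\otimes\sigma(g)f$ ($\lambda^{*\wedge k}$: $k$-th exterior power of the dual of $\lambda$), and $(\alpha\otimes u)\cdot a=\alpha\otimes(u\circ a)$ for $a\in CH$. **Geometry.** $\mathcal{Q}\to M$ is the principal $G$-bundle of symplectic frames $A:V\to T_mM$ ($\omega_m(Au,Av)=\omega_0(u,v)$; right action $A\mapsto A\circ g$). A metaplectic structure is a pair $(\pi_P,\Lambda)$ of a principal $\widetilde G$-bundle $\pi_P:\mathcal{P}\to M$ and a smooth $\Lambda:\mathcal{P}\to\mathcal{Q}$ over $\mathrm{Id}_M$ with $\Lambda(rg)=\Lambda(r)\lambda(g)$. Associated bundles are quotients by $(r,v)\sim(rg^{-1},\kappa(g)v)$: $\mathcal{H}^k=\mathcal{P}\times_{\sigma^k}H^k\cong\bigwedge^kT^*M\otimes\mathcal{H}$, $\mathcal{H}=\mathcal{H}^0$, $\check{\mathcal{H}}=\mathcal{P}\times_{\check\sigma}\check H$, $\mathcal{CH}=\mathcal{P}\times_\rho CH$. $\mathcal{H}$ has the fiberwise scalar product $([(r,v)],[(r,w)])_S=(v,w)_H$. A compatible positive almost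 complex structure $J_M$ is one for which $\omega(J_M\cdot,\cdot)$ is a Riemannian metric. $\mathcal{P}_R$ is the $\Lambda$-preimage of frames with $AJ_0=J_MA$ (a principal $\widetilde K$-bundle) and $\mathcal{H}^k_R$ is the bundle associated to $\mathcal{P}_R$ via $\sigma^k|_{\widetilde K}$; it coincides with $\mathcal{H}^k$ as a topological space. **Kuiper structure and action.** A Kuiper map is a homeomorphism $J:\mathcal{H}\to M\times H$ over $\mathrm{Id}_M$ that is linear and unitary on each fiber. $\check J(\tilde v)=(J(\tilde v^\flat))^\sharp$ (fiberwise). $J_{CH}:\mathcal{CH}\to M\times CH$ is the fiberwise linear, operator-norm continuous extension of $J_{CH}([(r,v\otimes f)])=(\pi_P(r),\mathrm{pr}_2\check J([(r,v)])\otimes\mathrm{pr}_2J([(r,f)]))$. For $h\in(\mathcal{H}^k_R)_m$ and $a\in CH$: $h\cdot a=h\cdot_{\mathcal{H}}J_{CH}^{-1}(m,a)$, where $[(q,f)]\cdot_{\mathcal{H}}[(q,b)]=[(q,f\cdot b)]$; on sections, $(s\cdot a)_m=s_m\cdot a$. The smooth structure on $\mathcal{H}$ is the one making $J$ a global smooth chart; on $\mathcal{H}^k_R\cong\bigwedge^kT^*M\otimes\mathcal{H}$ it is the tensor product one. $\Gamma$ denotes smooth sections. **Connection.** $\Phi^H(t_m,v_h)=(0_m,v_h)$ on $T(M\times H)=TM\times TH$, and $\Phi=TJ^{-1}\circ\Phi^H\circ TJ$ is the Kuiper connection. With vertical lift $vl(x,y)=\frac{d}{dt}|_{t=0}(x+ty)$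 and connector $\kappa=\mathrm{pr}_2\circ vl^{-1}\circ\Phi$, put $\nabla_Xs=\kappa\circ Ts\circ X$. Then $d^\Phi_k:\Gamma(\mathcal{H}^k_R)\to\Gamma(\mathcal{H}^{k+1}_R)$ is the linear extension of $d^\Phi_k(\alpha\otimes s)=d\alpha\otimes s+\sum_{i=1}^{2n}\epsilon^i\wedge\alpha\otimes\nabla_{e_i}s$, for dual local frames $(e_i)$, $(\epsilon^i)$ of $TM$, $T^*M$. Objects with index outside $\{0,\dots,2n\}$ are zero. *)

theory Defs
  imports "HOL-Analysis.Analysis" "HOL-Library.Function_Algebras"
begin

section \<open>Pointwise vector space structure on functions\<close>

instantiation "fun" :: (type, real_vector) real_vector
begin

definition scaleR_fun :: "real \<Rightarrow> ('a \<Rightarrow> 'b) \<Rightarrow> 'a \<Rightarrow> 'b"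
  where "scaleR_fun r f = (\<lambda>x. r *\<^sub>R f x)"

instance
  by standard (auto simp: scaleR_fun_def fun_eq_iff algebra_simps)

end


section \<open>Complex vector spaces\<close>

class complex_vect = real_vector +
  fixes scaleC :: "complex \<Rightarrow> 'a \<Rightarrow> 'a"  (infixr \<open>*\<^sub>C\<close> 75)
  assumes scaleC_add_right: "c *\<^sub>C (x + y) = c *\<^sub>C x + c *\<^sub>C y"
    and scaleC_add_left: "(c + d) *\<^sub>C x = c *\<^sub>C x + d *\<^sub>C x"
    and scaleC_scaleC: "c *\<^sub>C d *\<^sub>C x = (c * d) *\<^sub>C x"
    and scaleR_scaleC: "r *\<^sub>R x = complex_of_real r *\<^sub>C x"

instantiation complex :: complex_vect
begin

definition scaleC_complex :: "complex \<Rightarrow> complex \<Rightarrow> complex"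
  where "scaleC_complex c x = c * x"

instance
  by standard (auto simp: scaleC_complex_def algebra_simps scaleR_conv_of_real)

end

definition complex_linear :: "('a::complex_vect \<Rightarrow> 'b::complex_vect) \<Rightarrow> bool"
  where "complex_linear f \<longleftrightarrow>
    (\<forall>x y. f (x + y) = f x + f y) \<and> (\<forall>c x. f (c *\<^sub>C x) = c *\<^sub>C f x)"


section \<open>The Hilbert space of square integrable functions\<close>

definition square_integrable :: "('l::euclidean_space \<Rightarrow> complex) \<Rightarrow> bool"
  where "square_integrable f \<longleftrightarrow>
    f \<in> borel_measurable borel \<and> integrable lborel (\<lambda>x. (cmod (f x))\<^sup>2)"

lemma square_integrable_0: "square_integrable (\<lambda>_. 0)"
  by (simp add: square_integrable_def)

lemma square_integrable_mult:
  assumes "square_integrable f" and "square_integrable g"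
  shows "integrable lborel (\<lambda>x. cnj (f x) * g x)"
proof (rule Bochner_Integration.integrable_bound)
  show "integrable lborel (\<lambda>x. (cmod (f x))\<^sup>2 + (cmod (g x))\<^sup>2)"
    using assms by (auto simp: square_integrable_def)
  have [measurable]: "f \<in> borel_measurable borel" "g \<in> borel_measurable borel"
    using assms by (auto simp: square_integrable_def)
  have "cnj \<in> borel_measurable borel"
    by (intro borel_measurable_continuous_onI continuous_intros)
  then have [measurable]: "(\<lambda>x. cnj (f x)) \<in> borel_measurable borel"
    using measurable_compose[of f borel borel cnj borel] by measurable
  show "(\<lambda>x. cnj (f x) * g x) \<in> borel_measurable lborel"
    by measurable
  have "cmod (f x) * cmod (g x) \<le> (cmod (f x))\<^sup>2 + (cmod (g x))\<^sup>2" for x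
  proof -
    have "0 \<le> (cmod (f x) - cmod (g x))\<^sup>2" "0 \<le> cmod (f x) * cmod (g x)" by auto
    then show ?thesis unfolding power2_diff by linarith
  qed
  then show "AE x in lborel. norm (cnj (f x) * g x) \<le> norm ((cmod (f x))\<^sup>2 + (cmod (g x))\<^sup>2)"
    by (simp add: norm_mult)
qed

lemma square_integrable_scale:
  assumes "square_integrable f"
  shows "square_integrable (\<lambda>x. c * f x)"
  using assms by (auto simp: square_integrable_def norm_mult power_mult_distrib)

lemma square_integrable_add:
  assumes "square_integrable f" and "square_integrable g"
  shows "square_integrable (\<lambda>x. f x + g x)"
  unfolding square_integrable_def
proof
  have [measurable]: "f \<in> borel_measurable borel" "g \<in> borel_measurable borel"
    using assms by (auto simp: square_integrable_def)
  show "(\<lambda>x. f x + g x) \<in> borel_measurable borel" by measurable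
  show "integrable lborel (\<lambda>x. (cmod (f x + g x))\<^sup>2)"
  proof (rule Bochner_Integration.integrable_bound)
    show "integrable lborel (\<lambda>x. 2 * (cmod (f x))\<^sup>2 + 2 * (cmod (g x))\<^sup>2)"
      using assms by (auto simp: square_integrable_def)
    show "(\<lambda>x. (cmod (f x + g x))\<^sup>2) \<in> borel_measurable lborel" by measurable
    have "(cmod (f x + g x))\<^sup>2 \<le> 2 * (cmod (f x))\<^sup>2 + 2 * (cmod (g x))\<^sup>2" for x
    proof -
      have "(cmod (f x + g x))\<^sup>2 \<le> (cmod (f x) + cmod (g x))\<^sup>2"
        by (simp add: norm_triangle_ineq power_mono)
      moreover have "0 \<le> (cmod (f x) - cmod (g x))\<^sup>2" by simp
      ultimately show ?thesis unfolding power2_diff power2_sum by linarith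
    qed
    then show "AE x in lborel. norm ((cmod (f x + g x))\<^sup>2)
        \<le> norm (2 * (cmod (f x))\<^sup>2 + 2 * (cmod (g x))\<^sup>2)"
      by simp
  qed
qed

quotient_type (overloaded) 'l L2 = "'l::euclidean_space \<Rightarrow> complex" / partial:
  "\<lambda>f g. square_integrable f \<and> square_integrable g \<and> (AE x in lborel. f x = g x)"
  morphisms rep_L2 abs_L2
proof (rule part_equivpI)
  show "\<exists>f::'l \<Rightarrow> complex. square_integrable f \<and> square_integrable f \<and> (AE x in lborel. f x = f x)"
    using square_integrable_0 by auto
  show "symp (\<lambda>f g :: 'l \<Rightarrow> complex.
      square_integrable f \<and> square_integrable g \<and> (AE x in lborel. f x = g x))"
    by (auto simp: symp_def elim: eventually_mono)
  show "transp (\<lambda>f g :: 'l \<Rightarrow> complex.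
      square_integrable f \<and> square_integrable g \<and> (AE x in lborel. f x = g x))"
    by (auto simp: transp_def elim: eventually_elim2)
qed

lift_definition L2_inner :: "'l::euclidean_space L2 \<Rightarrow> 'l L2 \<Rightarrow> complex"
  is "\<lambda>f g. \<integral>x. cnj (f x) * g x \<partial>lborel"
proof -
  fix f f' g g' :: "'l \<Rightarrow> complex"
  assume a: "square_integrable f \<and> square_integrable f' \<and> (AE x in lborel. f x = f' x)"
    "square_integrable g \<and> square_integrable g' \<and> (AE x in lborel. g x = g' x)"
  show "(\<integral>x. cnj (f x) * g x \<partial>lborel) = (\<integral>x. cnj (f' x) * g' x \<partial>lborel)"
  proof (rule integral_cong_AE)
    show "AE x in lborel. cnj (f x) * g x = cnj (f' x) * g' x"
      using a by (auto elim: eventually_elim2)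
  qed (use a square_integrable_mult in \<open>blast intro: borel_measurable_integrable\<close>)+
qed

instantiation L2 :: (euclidean_space) real_vector
begin

lift_definition zero_L2 :: "'a L2" is "\<lambda>_. 0"
  by (simp add: square_integrable_0)

lift_definition plus_L2 :: "'a L2 \<Rightarrow> 'a L2 \<Rightarrow> 'a L2" is "\<lambda>f g x. f x + g x"
  by (auto intro: square_integrable_add elim: eventually_elim2)

lift_definition scaleR_L2 :: "real \<Rightarrow> 'a L2 \<Rightarrow> 'a L2" is "\<lambda>r f x. complex_of_real r * f x"
  by (auto intro: square_integrable_scale elim: eventually_mono)

lift_definition uminus_L2 :: "'a L2 \<Rightarrow> 'a L2" is "\<lambda>f x. - f x"
  using square_integrable_scale[of _ "- 1"] by (auto elim: eventually_mono)

lift_definition minus_L2 :: "'a L2 \<Rightarrow> 'a L2 \<Rightarrow> 'a L2" is "\<lambda>f g x. f x - g x"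
  using square_integrable_add square_integrable_scale[of _ "- 1"]
  by (fastforce elim: eventually_elim2)

instance
proof
  fix x y z :: "'a L2" and a b :: real
  show "x + y + z = x + (y + z)"
    by transfer (auto simp: algebra_simps intro: square_integrable_add)
  show "x + y = y + x"
    by transfer (auto simp: algebra_simps intro: square_integrable_add)
  show "0 + x = x"
    by transfer (auto intro: square_integrable_add)
  show "- x + x = 0"
    by transfer (auto intro: square_integrable_0)
  show "x - y = x + - y"
  proof transfer
    fix f g :: "'a \<Rightarrow> complex"
    assume "square_integrable f \<and> square_integrable f \<and> (AE x in lborel. f x = f x)"
      "square_integrable g \<and> square_integrable g \<and> (AE x in lborel. g x = g x)"
    then have "square_integrable (\<lambda>x. f x - g x)"
      using square_integrable_add[of f "\<lambda>x. - 1 * g x"] square_integrable_scale[of g "- 1"] by simp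
    then show "square_integrable (\<lambda>x. f x - g x) \<and> square_integrable (\<lambda>x. f x + - g x) \<and>
        (AE x in lborel. f x - g x = f x + - g x)"
      by simp
  qed
  show "a *\<^sub>R (x + y) = a *\<^sub>R x + a *\<^sub>R y"
    by transfer (auto simp: distrib_left intro!: square_integrable_add square_integrable_scale)
  show "(a + b) *\<^sub>R x = a *\<^sub>R x + b *\<^sub>R x"
    by transfer (auto simp: distrib_right intro!: square_integrable_add square_integrable_scale)
  show "a *\<^sub>R b *\<^sub>R x = (a * b) *\<^sub>R x"
    by transfer (auto simp: mult.assoc simp flip: of_real_mult intro!: square_integrable_scale)
  show "1 *\<^sub>R x = x"
    by transfer auto
qed

end

instantiation L2 :: (euclidean_space) real_inner
begin

definition inner_L2 :: "'a L2 \<Rightarrow> 'a L2 \<Rightarrow> real" where "inner_L2 f g = Re (L2_inner f g)"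

definition norm_L2 :: "'a L2 \<Rightarrow> real" where "norm_L2 f = sqrt (inner f f)"

definition sgn_L2 :: "'a L2 \<Rightarrow> 'a L2" where "sgn_L2 f = f /\<^sub>R norm f"

definition dist_L2 :: "'a L2 \<Rightarrow> 'a L2 \<Rightarrow> real" where "dist_L2 f g = norm (f - g)"

definition uniformity_L2 :: "('a L2 \<times> 'a L2) filter"
  where "uniformity_L2 = (INF e\<in>{0 <..}. principal {(x, y). dist x y < e})"

definition open_L2 :: "'a L2 set \<Rightarrow> bool"
  where "open_L2 U = (\<forall>x\<in>U. eventually (\<lambda>(x', y). x' = x \<longrightarrow> y \<in> U) uniformity)"

instance
proof
  fix x y z :: "'a L2" and r :: real
  show "dist x y = norm (x - y)" by (simp add: dist_L2_def)
  show "sgn x = x /\<^sub>R norm x" by (simp add: sgn_L2_def)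
  show "(uniformity :: ('a L2 \<times> 'a L2) filter) = (INF e\<in>{0 <..}. principal {(x, y). dist x y < e})"
    by (rule uniformity_L2_def)
  show "open U = (\<forall>x\<in>U. eventually (\<lambda>(x', y). x' = x \<longrightarrow> y \<in> U) uniformity)" for U :: "'a L2 set"
    by (rule open_L2_def)
  show "norm x = sqrt (inner x x)" by (rule norm_L2_def)
  have "L2_inner x y = cnj (L2_inner y x)"
  proof transfer
    fix f g :: "'a \<Rightarrow> complex"
    show "(\<integral>x. cnj (f x) * g x \<partial>lborel) = cnj (\<integral>x. cnj (g x) * f x \<partial>lborel)"
      by (subst Bochner_Integration.integral_cnj[symmetric]) (simp add: mult.commute)
  qed
  then show "inner x y = inner y x" by (simp add: inner_L2_def)
  have "L2_inner (x + y) z = L2_inner x z + L2_inner y z"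
    by transfer (simp add: distrib_right square_integrable_mult)
  then show "inner (x + y) z = inner x z + inner y z" by (simp add: inner_L2_def)
  have "L2_inner (r *\<^sub>R x) y = complex_of_real r * L2_inner x y"
    by transfer (simp add: mult.assoc)
  then show "inner (r *\<^sub>R x) y = r * inner x y" by (simp add: inner_L2_def)
  have sq: "cnj (f u) * f u = complex_of_real ((cmod (f u))\<^sup>2)" for f :: "'a \<Rightarrow> complex" and u
    by (metis complex_norm_square mult.commute)
  have self: "inner x x = (\<integral>u. (cmod (rep_L2 x u))\<^sup>2 \<partial>lborel)"
    unfolding inner_L2_def L2_inner.rep_eq sq by (simp del: of_real_power)
  show "0 \<le> inner x x" unfolding self by simp
  have "Re (L2_inner x x) = 0 \<longleftrightarrow> x = 0"
  proof transfer
    fix f :: "'a \<Rightarrow> complex"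
    assume f: "square_integrable f \<and> square_integrable f \<and> (AE x in lborel. f x = f x)"
    have "(\<integral>u. (cmod (f u))\<^sup>2 \<partial>lborel) = 0 \<longleftrightarrow> (AE u in lborel. (cmod (f u))\<^sup>2 = 0)"
      using f by (intro integral_nonneg_eq_0_iff_AE) (auto simp: square_integrable_def)
    then show "Re (\<integral>x. cnj (f x) * f x \<partial>lborel) = 0 \<longleftrightarrow>
        square_integrable f \<and> square_integrable (\<lambda>_::'a. 0) \<and> (AE x in lborel. f x = 0)"
      using f unfolding sq by (simp del: of_real_power add: square_integrable_0)
  qed
  then show "inner x x = 0 \<longleftrightarrow> x = 0" by (simp add: inner_L2_def)
qed

end

instantiation L2 :: (euclidean_space) complex_vect
begin

lift_definition scaleC_L2 :: "complex \<Rightarrow> 'a L2 \<Rightarrow> 'a L2" is "\<lambda>c f x. c * f x"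
  by (auto intro: square_integrable_scale elim: eventually_mono)

instance
proof
  fix x y :: "'a L2" and c d :: complex and r :: real
  show "c *\<^sub>C (x + y) = c *\<^sub>C x + c *\<^sub>C y"
    by transfer (auto simp: distrib_left intro!: square_integrable_add square_integrable_scale)
  show "(c + d) *\<^sub>C x = c *\<^sub>C x + d *\<^sub>C x"
    by transfer (auto simp: distrib_right intro!: square_integrable_add square_integrable_scale)
  show "c *\<^sub>C d *\<^sub>C x = (c * d) *\<^sub>C x"
    by transfer (auto simp: mult.assoc intro!: square_integrable_scale)
  show "r *\<^sub>R x = complex_of_real r *\<^sub>C x"
    by transfer (auto intro!: square_integrable_scale)
qed

end

text \<open>Complex linear operators on \<^typ>\<open>'l L2\<close> are real bounded operators that commute with
  complex scalars.\<close>

definition unitary_op :: "('l::euclidean_space L2 \<Rightarrow>\<^sub>L 'l L2) \<Rightarrow> bool"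
  where "unitary_op T \<longleftrightarrow> complex_linear (blinfun_apply T) \<and> surj (blinfun_apply T) \<and>
    (\<forall>u v. L2_inner (T u) (T v) = L2_inner u v)"

definition op_scaleC :: "complex \<Rightarrow> ('l::euclidean_space L2 \<Rightarrow>\<^sub>L 'l L2) \<Rightarrow> 'l L2 \<Rightarrow>\<^sub>L 'l L2"
  where "op_scaleC c T = Blinfun (\<lambda>u. c *\<^sub>C blinfun_apply T u)"

definition compact_ops :: "('l::euclidean_space L2 \<Rightarrow>\<^sub>L 'l L2) set"
  where "compact_ops = {T. complex_linear (blinfun_apply T) \<and>
    compact (closure (blinfun_apply T ` cball 0 1))}"


section \<open>The continuous dual\<close>

typedef (overloaded) 'l L2_dual =
  "{f :: 'l::euclidean_space L2 \<Rightarrow>\<^sub>L complex. complex_linear (blinfun_apply f)}"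
  morphisms functional Functional
  by (rule exI[of _ 0]) (simp add: complex_linear_def scaleC_complex_def zero_blinfun.rep_eq)

setup_lifting type_definition_L2_dual

instantiation L2_dual :: (euclidean_space) real_vector
begin

lift_definition zero_L2_dual :: "'a L2_dual" is 0
  by (simp add: complex_linear_def scaleC_complex_def)

lift_definition plus_L2_dual :: "'a L2_dual \<Rightarrow> 'a L2_dual \<Rightarrow> 'a L2_dual" is "(+)"
  by (simp add: complex_linear_def scaleC_complex_def blinfun.add_left algebra_simps)

lift_definition minus_L2_dual :: "'a L2_dual \<Rightarrow> 'a L2_dual \<Rightarrow> 'a L2_dual" is "(-)"
  by (simp add: complex_linear_def scaleC_complex_def blinfun.diff_left algebra_simps)

lift_definition uminus_L2_dual :: "'a L2_dual \<Rightarrow> 'a L2_dual" is uminus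
  by (simp add: complex_linear_def scaleC_complex_def blinfun.minus_left algebra_simps)

lift_definition scaleR_L2_dual :: "real \<Rightarrow> 'a L2_dual \<Rightarrow> 'a L2_dual" is scaleR
  by (simp add: complex_linear_def scaleC_complex_def blinfun.scaleR_left algebra_simps)

instance
proof
  fix x y z :: "'a L2_dual" and a b :: real
  show "x + y + z = x + (y + z)" by transfer simp
  show "x + y = y + x" by transfer simp
  show "0 + x = x" by transfer simp
  show "- x + x = 0" by transfer simp
  show "x - y = x + - y" by transfer simp
  show "a *\<^sub>R (x + y) = a *\<^sub>R x + a *\<^sub>R y" by transfer (simp add: algebra_simps)
  show "(a + b) *\<^sub>R x = a *\<^sub>R x + b *\<^sub>R x" by transfer (simp add: algebra_simps)
  show "a *\<^sub>R b *\<^sub>R x = (a * b) *\<^sub>R x" by transfer simp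
  show "1 *\<^sub>R x = x" by transfer simp
qed

end

instantiation L2_dual :: (euclidean_space) real_normed_vector
begin

lift_definition norm_L2_dual :: "'a L2_dual \<Rightarrow> real" is norm .

definition sgn_L2_dual :: "'a L2_dual \<Rightarrow> 'a L2_dual" where "sgn_L2_dual f = f /\<^sub>R norm f"

definition dist_L2_dual :: "'a L2_dual \<Rightarrow> 'a L2_dual \<Rightarrow> real"
  where "dist_L2_dual f g = norm (f - g)"

definition uniformity_L2_dual :: "('a L2_dual \<times> 'a L2_dual) filter"
  where "uniformity_L2_dual = (INF e\<in>{0 <..}. principal {(x, y). dist x y < e})"

definition open_L2_dual :: "'a L2_dual set \<Rightarrow> bool"
  where "open_L2_dual U = (\<forall>x\<in>U. eventually (\<lambda>(x', y). x' = x \<longrightarrow> y \<in> U) uniformity)"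

instance
proof
  fix x y :: "'a L2_dual" and a :: real
  show "dist x y = norm (x - y)" by (simp add: dist_L2_dual_def)
  show "sgn x = x /\<^sub>R norm x" by (simp add: sgn_L2_dual_def)
  show "(uniformity :: ('a L2_dual \<times> 'a L2_dual) filter)
      = (INF e\<in>{0 <..}. principal {(x, y). dist x y < e})"
    by (rule uniformity_L2_dual_def)
  show "open U = (\<forall>x\<in>U. eventually (\<lambda>(x', y). x' = x \<longrightarrow> y \<in> U) uniformity)" for U :: "'a L2_dual set"
    by (rule open_L2_dual_def)
  show "norm x = 0 \<longleftrightarrow> x = 0" by transfer simp
  show "norm (x + y) \<le> norm x + norm y" by transfer (rule norm_triangle_ineq)
  show "norm (a *\<^sub>R x) = \<bar>a\<bar> * norm x" by transfer simp
qed

end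

definition mult_functional :: "complex \<Rightarrow> ('l::euclidean_space L2 \<Rightarrow>\<^sub>L complex) \<Rightarrow> 'l L2 \<Rightarrow>\<^sub>L complex"
  where "mult_functional c f = blinfun_mult_right c o\<^sub>L f"

instantiation L2_dual :: (euclidean_space) complex_vect
begin

lift_definition scaleC_L2_dual :: "complex \<Rightarrow> 'a L2_dual \<Rightarrow> 'a L2_dual" is mult_functional
  by (simp add: complex_linear_def scaleC_complex_def mult_functional_def algebra_simps)

instance
proof
  fix x y :: "'a L2_dual" and c d :: complex and r :: real
  show "c *\<^sub>C (x + y) = c *\<^sub>C x + c *\<^sub>C y"
    by transfer (auto simp: mult_functional_def blinfun.add_left algebra_simps intro!: blinfun_eqI)
  show "(c + d) *\<^sub>C x = c *\<^sub>C x + d *\<^sub>C x"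
    by transfer (auto simp: mult_functional_def blinfun.add_left algebra_simps intro!: blinfun_eqI)
  show "c *\<^sub>C d *\<^sub>C x = (c * d) *\<^sub>C x"
    by transfer (auto simp: mult_functional_def algebra_simps intro!: blinfun_eqI)
  show "r *\<^sub>R x = complex_of_real r *\<^sub>C x"
    by transfer (auto simp: mult_functional_def blinfun.scaleR_left scaleR_conv_of_real intro!: blinfun_eqI)
qed

end

definition flat :: "'l::euclidean_space L2 \<Rightarrow> 'l L2_dual"
  where "flat v = Functional (Blinfun (\<lambda>w. L2_inner v w))"

definition sharp :: "'l::euclidean_space L2_dual \<Rightarrow> 'l L2"
  where "sharp f = (THE u. \<forall>v. functional f v = L2_inner u v)"

definition dual_inner :: "'l::euclidean_space L2_dual \<Rightarrow> 'l L2_dual \<Rightarrow> complex"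
  where "dual_inner f g = L2_inner (sharp g) (sharp f)"

definition dual_comp :: "'l::euclidean_space L2_dual \<Rightarrow> ('l L2 \<Rightarrow>\<^sub>L 'l L2) \<Rightarrow> 'l L2_dual"
  where "dual_comp f T = Functional (functional f o\<^sub>L T)"

definition rank_one :: "'l::euclidean_space L2 \<Rightarrow> 'l L2_dual \<Rightarrow> 'l L2 \<Rightarrow>\<^sub>L 'l L2"
  where "rank_one u f = Blinfun (\<lambda>w. functional f w *\<^sub>C u)"


section \<open>Smooth maps, charts and tangent vectors\<close>

text \<open>For maps defined on open subsets of a Euclidean space, class \<open>C\<^sup>k\<^sup>+\<^sup>1\<close> means Frechet
  differentiable with all directional derivatives of class \<open>C\<^sup>k\<close>.\<close>

primrec Ck_on :: "nat \<Rightarrow> 'a::euclidean_space set \<Rightarrow> ('a \<Rightarrow> 'b::real_normed_vector) \<Rightarrow> bool"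
  where
    "Ck_on 0 = (\<lambda>S f. continuous_on S f)"
  | "Ck_on (Suc k) = (\<lambda>S f. (\<forall>x\<in>S. f differentiable (at x)) \<and>
      (\<forall>v. Ck_on k S (\<lambda>x. frechet_derivative f (at x) v)))"

definition smooth_on :: "'a::euclidean_space set \<Rightarrow> ('a \<Rightarrow> 'b::real_normed_vector) \<Rightarrow> bool"
  where "smooth_on S f \<longleftrightarrow> (\<forall>k. Ck_on k S f)"

type_synonym ('x, 'e) chart = "'x set \<times> ('x \<Rightarrow> 'e)"

type_synonym ('x, 'e) atlas = "('x, 'e) chart set"

definition chart_inv :: "('x, 'e) chart \<Rightarrow> 'e \<Rightarrow> 'x"
  where "chart_inv c = inv_into (fst c) (snd c)"

definition smooth_manifold ::
    "('x::{t2_space, second_countable_topology}, 'e::euclidean_space) atlas \<Rightarrow> bool"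
  where "smooth_manifold A \<longleftrightarrow> \<Union> (fst ` A) = UNIV \<and>
    (\<forall>c\<in>A. open (fst c) \<and> open (snd c ` fst c) \<and>
      homeomorphism (fst c) (snd c ` fst c) (snd c) (chart_inv c)) \<and>
    (\<forall>c\<in>A. \<forall>d\<in>A. smooth_on (snd c ` (fst c \<inter> fst d)) (snd d \<circ> chart_inv c))"

definition space_atlas :: "('e, 'e) atlas"
  where "space_atlas = {(UNIV, id)}"

definition prod_atlas :: "('x, 'e) atlas \<Rightarrow> ('y, 'f) atlas \<Rightarrow> ('x \<times> 'y, 'e \<times> 'f) atlas"
  where "prod_atlas A B =
    (\<lambda>(c, d). (fst c \<times> fst d, map_prod (snd c) (snd d))) ` (A \<times> B)"

definition smooth_map_on :: "('x, 'e::euclidean_space) atlas \<Rightarrow>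
    ('y, 'f::real_normed_vector) atlas \<Rightarrow> 'x set \<Rightarrow> ('x \<Rightarrow> 'y) \<Rightarrow> bool"
  where "smooth_map_on A B W f \<longleftrightarrow> f ` W \<subseteq> \<Union> (fst ` B) \<and>
    (\<forall>c\<in>A. \<forall>d\<in>B. open (snd c ` (fst c \<inter> W \<inter> f -` fst d)) \<and>
      smooth_on (snd c ` (fst c \<inter> W \<inter> f -` fst d)) (snd d \<circ> f \<circ> chart_inv c))"

text \<open>A tangent vector at a point is the family of its components in all charts around that point,
  subject to the usual transformation law.\<close>

type_synonym ('x, 'e) tangent = "('x, 'e) chart \<Rightarrow> 'e"

definition charts_at :: "('x, 'e) atlas \<Rightarrow> 'x \<Rightarrow> ('x, 'e) chart set"
  where "charts_at A x = {c \<in> A. x \<in> fst c}"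

definition chart_change :: "('x, 'e::real_normed_vector) chart \<Rightarrow> ('x, 'e) chart \<Rightarrow> 'x \<Rightarrow> 'e \<Rightarrow> 'e"
  where "chart_change c d x = frechet_derivative (snd d \<circ> chart_inv c) (at (snd c x))"

definition tspace :: "('x, 'e::real_normed_vector) atlas \<Rightarrow> 'x \<Rightarrow> ('x, 'e) tangent set"
  where "tspace A x = {t. (\<forall>c. c \<notin> charts_at A x \<longrightarrow> t c = 0) \<and>
    (\<forall>c\<in>charts_at A x. \<forall>d\<in>charts_at A x. t d = chart_change c d x (t c))}"

definition coord_vec ::
    "('x, 'e::real_normed_vector) atlas \<Rightarrow> ('x, 'e) chart \<Rightarrow> 'x \<Rightarrow> 'e \<Rightarrow> ('x, 'e) tangent"
  where "coord_vec A c x v = (\<lambda>d. if d \<in> charts_at A x then chart_change c d x v else 0)"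

definition tangent_map :: "('x, 'e::real_normed_vector) atlas \<Rightarrow>
    ('y, 'f::real_normed_vector) atlas \<Rightarrow> ('x \<Rightarrow> 'y) \<Rightarrow>
    'x \<times> ('x, 'e) tangent \<Rightarrow> 'y \<times> ('y, 'f) tangent"
  where "tangent_map A B f = (\<lambda>(x, t). (f x, \<lambda>d. if d \<in> charts_at B (f x)
    then (let c = (SOME c. c \<in> charts_at A x)
      in frechet_derivative (snd d \<circ> f \<circ> chart_inv c) (at (snd c x)) (t c))
    else 0))"

definition smooth_field_on ::
    "('x, 'e::euclidean_space) atlas \<Rightarrow> 'x set \<Rightarrow> ('x \<Rightarrow> ('x, 'e) tangent) \<Rightarrow> bool"
  where "smooth_field_on A W X \<longleftrightarrow> (\<forall>x\<in>W. X x \<in> tspace A x) \<and>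
    (\<forall>c\<in>A. smooth_on (snd c ` (fst c \<inter> W)) (\<lambda>y. X (chart_inv c y) c))"


section \<open>Alternating forms\<close>

text \<open>Forms of degree k are functions of lists of vectors; they vanish on all lists that are
  not lists of k vectors of the space in question.\<close>

definition alternating_form ::
    "'a::real_vector set \<Rightarrow> nat \<Rightarrow> ('a list \<Rightarrow> 'b::real_vector) \<Rightarrow> bool"
  where "alternating_form S k \<alpha> \<longleftrightarrow>
    (\<forall>xs i x y a b. length xs = k \<and> set xs \<subseteq> S \<and> i < k \<and> x \<in> S \<and> y \<in> S \<longrightarrow>
      \<alpha> (xs[i := a *\<^sub>R x + b *\<^sub>R y]) = a *\<^sub>R \<alpha> (xs[i := x]) + b *\<^sub>R \<alpha> (xs[i := y])) \<and>
    (\<forall>xs i j. length xs = k \<and> set xs \<subseteq> S \<and> i < j \<and> j < k \<and> xs ! i = xs ! j \<longrightarrow> \<alpha> xs = 0) \<and>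
    (\<forall>xs. length xs \<noteq> k \<or> \<not> set xs \<subseteq> S \<longrightarrow> \<alpha> xs = 0)"

definition delete_nth :: "nat \<Rightarrow> 'a list \<Rightarrow> 'a list"
  where "delete_nth j xs = take j xs @ drop (Suc j) xs"

text \<open>Exterior product of a one-form with a form, and exterior derivative; both in the
  normalisation without factorials.\<close>

definition wedge1 :: "('a list \<Rightarrow> real) \<Rightarrow> ('a list \<Rightarrow> real) \<Rightarrow> 'a list \<Rightarrow> real"
  where "wedge1 \<epsilon> \<alpha> xs = (\<Sum>j<length xs. (- 1) ^ j * \<epsilon> [xs ! j] * \<alpha> (delete_nth j xs))"

type_synonym ('x, 'e) form = "'x \<Rightarrow> ('x, 'e) tangent list \<Rightarrow> real"

definition smooth_form_on ::
    "('x, 'e::euclidean_space) atlas \<Rightarrow> 'x set \<Rightarrow> nat \<Rightarrow> ('x, 'e) form \<Rightarrow> bool"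
  where "smooth_form_on A W k \<alpha> \<longleftrightarrow> (\<forall>x\<in>W. alternating_form (tspace A x) k (\<alpha> x)) \<and>
    (\<forall>c\<in>A. \<forall>vs. smooth_on (snd c ` (fst c \<inter> W))
      (\<lambda>y. \<alpha> (chart_inv c y) (map (coord_vec A c (chart_inv c y)) vs)))"

definition ext_deriv :: "('x, 'e::euclidean_space) atlas \<Rightarrow> ('x, 'e) form \<Rightarrow> ('x, 'e) form"
  where "ext_deriv A \<alpha> x ts = (if set ts \<subseteq> tspace A x
    then (let c = (SOME c. c \<in> charts_at A x) in
      \<Sum>j<length ts. (- 1) ^ j * frechet_derivative
        (\<lambda>y. \<alpha> (chart_inv c y)
          (map (\<lambda>t. coord_vec A c (chart_inv c y) (t c)) (delete_nth j ts)))
        (at (snd c x)) ((ts ! j) c))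
    else 0)"

definition dual_frames_on :: "('x, 'e::euclidean_space) atlas \<Rightarrow> 'x set \<Rightarrow>
    ('e \<Rightarrow> 'x \<Rightarrow> ('x, 'e) tangent) \<Rightarrow> ('e \<Rightarrow> ('x, 'e) form) \<Rightarrow> bool"
  where "dual_frames_on A W e \<epsilon> \<longleftrightarrow>
    (\<forall>i\<in>Basis. smooth_field_on A W (e i) \<and> smooth_form_on A W 1 (\<epsilon> i)) \<and>
    (\<forall>x\<in>W. \<forall>i\<in>Basis. \<forall>j\<in>Basis. \<epsilon> i x [e j x] = (if i = j then 1 else 0))"


section \<open>Symplectic linear algebra, the metaplectic group and its representation\<close>

text \<open>The type class structure of \<^typ>\<open>'v\<close> serves only as the model for the topology and
  smooth structure of V; its inner product plays no role. The Lagrangian subspace L is given as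
  the range of a linear injection \<open>iota\<close> of \<^typ>\<open>'l\<close>, which also fixes the normalisation of
  Lebesgue measure on L. The (non-commutative) group \<^typ>\<open>'g\<close> is written additively.\<close>

record (overloaded) ('v, 'l, 'm, 'g, 'k, 'p) metaplectic_data =
  om0 :: "'v::euclidean_space \<Rightarrow> 'v \<Rightarrow> real"
  J0 :: "'v \<Rightarrow> 'v"
  iota :: "'l::euclidean_space \<Rightarrow> 'v"
  lam :: "'g::{topological_group_add, t2_space, second_countable_topology} \<Rightarrow> 'v \<Rightarrow>\<^sub>L 'v"
  atlasG :: "('g, 'k::euclidean_space) atlas"
  ssw :: "'g \<Rightarrow> 'l L2 \<Rightarrow>\<^sub>L 'l L2"
  atlasM :: "('m::{t2_space, second_countable_topology}, 'v) atlas"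
  om :: "('m, 'v) form"
  JM :: "'m \<Rightarrow> ('m, 'v) tangent \<Rightarrow> ('m, 'v) tangent"
  atlasP :: "('p::{t2_space, second_countable_topology}, 'v \<times> 'k) atlas"
  projP :: "'p \<Rightarrow> 'm"
  actP :: "'p \<Rightarrow> 'g \<Rightarrow> 'p"
  Lam :: "'p \<Rightarrow> 'm \<times> ('v \<Rightarrow> ('m, 'v) tangent)"

definition symplectic_vector_space :: "('v::euclidean_space \<Rightarrow> 'v \<Rightarrow> real) \<Rightarrow> bool"
  where "symplectic_vector_space w \<longleftrightarrow> bilinear w \<and> (\<forall>u. w u u = 0) \<and>
    (\<forall>u. u \<noteq> 0 \<longrightarrow> (\<exists>v. w u v \<noteq> 0))"

definition compatible_complex_structure ::
    "('v::euclidean_space \<Rightarrow> 'v \<Rightarrow> real) \<Rightarrow> ('v \<Rightarrow> 'v) \<Rightarrow> bool"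
  where "compatible_complex_structure w j \<longleftrightarrow> linear j \<and> (\<forall>u. j (j u) = - u) \<and>
    (\<forall>u v. w (j u) v = w (j v) u) \<and> (\<forall>u. u \<noteq> 0 \<longrightarrow> w (j u) u > 0)"

definition lagrangian_embedding ::
    "('v::euclidean_space \<Rightarrow> 'v \<Rightarrow> real) \<Rightarrow> ('l::euclidean_space \<Rightarrow> 'v) \<Rightarrow> bool"
  where "lagrangian_embedding w i \<longleftrightarrow> linear i \<and> inj i \<and> (\<forall>x y. w (i x) (i y) = 0) \<and>
    DIM('v) = 2 * DIM('l)"

definition symplectic_group :: "('v::euclidean_space \<Rightarrow> 'v \<Rightarrow> real) \<Rightarrow> ('v \<Rightarrow>\<^sub>L 'v) set"
  where "symplectic_group w = {A. \<forall>u v. w (blinfun_apply A u) (blinfun_apply A v) = w u v}"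

text \<open>The group operations and the covering map are smooth, and the covering map is an immersion,
  that is, the smooth structure of the cover is the one lifted from the symplectic group.\<close>

definition connected_double_cover :: "('v::euclidean_space \<Rightarrow> 'v \<Rightarrow> real) \<Rightarrow>
    ('g::{topological_group_add, t2_space, second_countable_topology}, 'k::euclidean_space) atlas \<Rightarrow>
    ('g \<Rightarrow> 'v \<Rightarrow>\<^sub>L 'v) \<Rightarrow> bool"
  where "connected_double_cover w A l \<longleftrightarrow>
    smooth_manifold A \<and>
    smooth_map_on (prod_atlas A A) A UNIV (\<lambda>(g, h). g + h) \<and>
    smooth_map_on A A UNIV uminus \<and>
    connected (UNIV :: 'g set) \<and>
    (\<forall>g h. l (g + h) = l g o\<^sub>L l h) \<and>
    covering_space UNIV l (symplectic_group w) \<and>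
    (\<forall>B\<in>symplectic_group w. card {g. l g = B} = 2) \<and>
    smooth_map_on A space_atlas UNIV l \<and>
    (\<forall>g. inj_on (\<lambda>t. tangent_map A space_atlas l (g, t)) (tspace A g))"

text \<open>Schroedinger representation for the Heisenberg group law
  \<open>(v, s) (w, t) = (v + w, s + t + \<omega>\<^sub>0(v, w) / 2)\<close>: with \<open>v = x + J\<^sub>0 y\<close> for x, y in L,
  \<open>(r(v, t) f)(q) = exp (i (t + \<omega>\<^sub>0(J\<^sub>0 y, q - x / 2))) f(q - x)\<close>.\<close>

definition schroedinger :: "('v::euclidean_space \<Rightarrow> 'v \<Rightarrow> real) \<Rightarrow> ('v \<Rightarrow> 'v) \<Rightarrow>
    ('l::euclidean_space \<Rightarrow> 'v) \<Rightarrow> 'v \<Rightarrow> real \<Rightarrow> 'l L2 \<Rightarrow> 'l L2"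
  where "schroedinger w j i v t f = (case (THE (x, y). v = i x + j (i y)) of (x, y) \<Rightarrow>
    abs_L2 (\<lambda>q. cis (t + w (j (i y)) (i (q - x /\<^sub>R 2))) * rep_L2 f (q - x)))"

definition segal_shale_weil :: "('v::euclidean_space \<Rightarrow> 'v \<Rightarrow> real) \<Rightarrow> ('v \<Rightarrow> 'v) \<Rightarrow>
    ('l::euclidean_space \<Rightarrow> 'v) \<Rightarrow> ('g::topological_group_add \<Rightarrow> 'v \<Rightarrow>\<^sub>L 'v) \<Rightarrow>
    ('g \<Rightarrow> 'l L2 \<Rightarrow>\<^sub>L 'l L2) \<Rightarrow> bool"
  where "segal_shale_weil w j i l \<rho> \<longleftrightarrow>
    (\<forall>g. unitary_op (\<rho> g)) \<and>
    (\<forall>g h. \<rho> (g + h) = \<rho> g o\<^sub>L \<rho> h) \<and>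
    (\<forall>u. continuous_on UNIV (\<lambda>g. \<rho> g u)) \<and>
    (\<forall>g v t u. \<rho> g (schroedinger w j i v t (inv (blinfun_apply (\<rho> g)) u))
      = schroedinger w j i (l g v) t u)"


section \<open>Symplectic manifolds and metaplectic structures\<close>

definition symplectic_manifold ::
    "('m::{t2_space, second_countable_topology}, 'v::euclidean_space) atlas \<Rightarrow> ('m, 'v) form \<Rightarrow> bool"
  where "symplectic_manifold A w \<longleftrightarrow> smooth_manifold A \<and> smooth_form_on A UNIV 2 w \<and>
    (\<forall>m ts. ext_deriv A w m ts = 0) \<and>
    (\<forall>m. \<forall>t\<in>tspace A m. t \<noteq> 0 \<longrightarrow> (\<exists>u\<in>tspace A m. w m [t, u] \<noteq> 0))"

definition compatible_positive_acs :: "('m, 'v::euclidean_space) atlas \<Rightarrow> ('m, 'v) form \<Rightarrow>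
    ('m \<Rightarrow> ('m, 'v) tangent \<Rightarrow> ('m, 'v) tangent) \<Rightarrow> bool"
  where "compatible_positive_acs A w j \<longleftrightarrow>
    (\<forall>m. \<forall>t\<in>tspace A m. j m t \<in> tspace A m \<and> j m (j m t) = - t) \<and>
    (\<forall>m. \<forall>t\<in>tspace A m. \<forall>u\<in>tspace A m. \<forall>a b. j m (a *\<^sub>R t + b *\<^sub>R u) = a *\<^sub>R j m t + b *\<^sub>R j m u) \<and>
    (\<forall>c\<in>A. \<forall>v. smooth_on (snd c ` fst c)
      (\<lambda>y. j (chart_inv c y) (coord_vec A c (chart_inv c y) v) c)) \<and>
    (\<forall>m. \<forall>t\<in>tspace A m. \<forall>u\<in>tspace A m. w m [j m t, u] = w m [j m u, t]) \<and>
    (\<forall>m. \<forall>t\<in>tspace A m. t \<noteq> 0 \<longrightarrow> w m [j m t, t] > 0)"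

definition symplectic_frames :: "('v::euclidean_space \<Rightarrow> 'v \<Rightarrow> real) \<Rightarrow>
    ('m, 'v) atlas \<Rightarrow> ('m, 'v) form \<Rightarrow> ('m \<times> ('v \<Rightarrow> ('m, 'v) tangent)) set"
  where "symplectic_frames w0 A w = {(m, F). linear F \<and> range F \<subseteq> tspace A m \<and>
    (\<forall>u v. w m [F u, F v] = w0 u v)}"

text \<open>The frame bundle carries the smooth structure of a submanifold of \<open>Hom(V, TM)\<close>, for which
  the following are the bundle charts.\<close>

definition hom_atlas :: "('m, 'v::euclidean_space) atlas \<Rightarrow>
    ('m \<times> ('v \<Rightarrow> ('m, 'v) tangent), 'v \<times> ('v \<Rightarrow>\<^sub>L 'v)) atlas"
  where "hom_atlas A =
    (\<lambda>c. ({(m, F). m \<in> fst c \<and> linear F \<and> range F \<subseteq> tspace A m},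
      \<lambda>(m, F). (snd c m, Blinfun (\<lambda>v. F v c)))) ` A"

definition principal_bundle ::
    "('g::{topological_group_add, t2_space, second_countable_topology}, 'k::euclidean_space) atlas \<Rightarrow>
    ('m::{t2_space, second_countable_topology}, 'v::euclidean_space) atlas \<Rightarrow>
    ('p::{t2_space, second_countable_topology}, 'v \<times> 'k) atlas \<Rightarrow>
    ('p \<Rightarrow> 'm) \<Rightarrow> ('p \<Rightarrow> 'g \<Rightarrow> 'p) \<Rightarrow> bool"
  where "principal_bundle AG AM AP \<pi> act \<longleftrightarrow>
    smooth_manifold AP \<and>
    smooth_map_on AP AM UNIV \<pi> \<and>
    smooth_map_on (prod_atlas AP AG) AP UNIV (\<lambda>(p, g). act p g) \<and>
    (\<forall>p. act p 0 = p) \<and> (\<forall>p g h. act (act p g) h = act p (g + h)) \<and>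
    (\<forall>m. \<exists>W \<psi>. open W \<and> m \<in> W \<and> bij_betw \<psi> (W \<times> UNIV) (\<pi> -` W) \<and>
      smooth_map_on (prod_atlas AM AG) AP (W \<times> UNIV) \<psi> \<and>
      smooth_map_on AP (prod_atlas AM AG) (\<pi> -` W) (inv_into (W \<times> UNIV) \<psi>) \<and>
      (\<forall>x\<in>W. \<forall>g h. \<pi> (\<psi> (x, g)) = x \<and> act (\<psi> (x, g)) h = \<psi> (x, g + h)))"

definition metaplectic_structure ::
    "('v::euclidean_space, 'l::euclidean_space, 'm::{t2_space, second_countable_topology},
      'g::{topological_group_add, t2_space, second_countable_topology}, 'k::euclidean_space,
      'p::{t2_space, second_countable_topology}) metaplectic_data \<Rightarrow> bool"
  where "metaplectic_structure D \<longleftrightarrow>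
    principal_bundle (atlasG D) (atlasM D) (atlasP D) (projP D) (actP D) \<and>
    range (Lam D) \<subseteq> symplectic_frames (om0 D) (atlasM D) (om D) \<and>
    smooth_map_on (atlasP D) (hom_atlas (atlasM D)) UNIV (Lam D) \<and>
    (\<forall>r. fst (Lam D r) = projP D r) \<and>
    (\<forall>r g. snd (Lam D (actP D r g)) = snd (Lam D r) \<circ> blinfun_apply (lam D g))"


section \<open>Associated bundles\<close>

text \<open>The class of \<open>(p, f)\<close> under \<open>(p, f) \<sim> (p g\<inverse>, \<kappa>(g) f)\<close>, for g in the subgroup N.\<close>

definition assoc_class ::
    "'g::group_add set \<Rightarrow> ('p \<Rightarrow> 'g \<Rightarrow> 'p) \<Rightarrow> ('g \<Rightarrow> 'f \<Rightarrow> 'f) \<Rightarrow> 'p \<Rightarrow> 'f \<Rightarrow> ('p \<times> 'f) set"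
  where "assoc_class N act \<kappa> p f = {(act p (- g), \<kappa> g f) | g. g \<in> N}"

text \<open>\<open>\<Lambda>\<^sup>k V\<^sup>* \<otimes> H\<close> is realised as the space of alternating k-linear maps from V to H, the tensor
  product of \<open>\<alpha>\<close> and f being \<open>\<lambda>vs. \<alpha> vs *\<^sub>R f\<close>.\<close>

definition Hk :: "nat \<Rightarrow> ('v::euclidean_space list \<Rightarrow> 'l::euclidean_space L2_dual) set"
  where "Hk k = {F. alternating_form UNIV k F}"

text \<open>Fibrewise vector space operations: \<open>cl\<close> is one of the class maps above.\<close>

definition fibre_add :: "('p \<Rightarrow> 'f::plus \<Rightarrow> ('p \<times> 'f) set) \<Rightarrow>
    ('p \<times> 'f) set \<Rightarrow> ('p \<times> 'f) set \<Rightarrow> ('p \<times> 'f) set"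
  where "fibre_add cl x y = (THE z. \<exists>p f g. x = cl p f \<and> y = cl p g \<and> z = cl p (f + g))"

definition fibre_scale :: "('p \<Rightarrow> 'f::scaleR \<Rightarrow> ('p \<times> 'f) set) \<Rightarrow>
    real \<Rightarrow> ('p \<times> 'f) set \<Rightarrow> ('p \<times> 'f) set"
  where "fibre_scale cl a x = (THE z. \<exists>p f. x = cl p f \<and> z = cl p (a *\<^sub>R f))"

text \<open>\<open>\<Phi>\<^sup>H(t\<^sub>m, v\<^sub>h) = (0\<^sub>m, v\<^sub>h)\<close>, where \<open>T(M \<times> H) = TM \<times> TH\<close> by the tangent maps of the
  projections.\<close>

definition trivial_connection :: "('m, 'v::euclidean_space) atlas \<Rightarrow>
    ('m \<times> 'h::real_normed_vector) \<times> ('m \<times> 'h, 'v \<times> 'h) tangent \<Rightarrow>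
    ('m \<times> 'h) \<times> ('m \<times> 'h, 'v \<times> 'h) tangent"
  where "trivial_connection A \<tau> = (let B = prod_atlas A space_atlas in
    THE \<tau>'. fst \<tau>' = fst \<tau> \<and> snd \<tau>' \<in> tspace B (fst \<tau>) \<and>
      tangent_map B A fst \<tau>' = (fst (fst \<tau>), 0) \<and>
      tangent_map B space_atlas snd \<tau>' = tangent_map B space_atlas snd \<tau>)"

context
  fixes D :: "('v::euclidean_space, 'l::euclidean_space, 'm::{t2_space, second_countable_topology},
    'g::{topological_group_add, t2_space, second_countable_topology}, 'k::euclidean_space,
    'p::{t2_space, second_countable_topology}) metaplectic_data"
begin

definition sigma :: "'g \<Rightarrow> 'l L2_dual \<Rightarrow> 'l L2_dual"
  where "sigma g f = dual_comp f (ssw D (- g))"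

definition rho :: "'g \<Rightarrow> ('l L2 \<Rightarrow>\<^sub>L 'l L2) \<Rightarrow> ('l L2 \<Rightarrow>\<^sub>L 'l L2)"
  where "rho g a = ssw D g o\<^sub>L a o\<^sub>L ssw D (- g)"

definition sigma_k :: "'g \<Rightarrow> ('v list \<Rightarrow> 'l L2_dual) \<Rightarrow> ('v list \<Rightarrow> 'l L2_dual)"
  where "sigma_k g F = (\<lambda>vs. sigma g (F (map (blinfun_apply (lam D (- g))) vs)))"

definition Ktilde :: "'g set"
  where "Ktilde = {g. lam D g \<in> symplectic_group (om0 D) \<and>
    (\<forall>u v. om0 D (J0 D (lam D g u)) (lam D g v) = om0 D (J0 D u) v)}"

definition PR :: "'m \<Rightarrow> 'p set"
  where "PR m = {q. projP D q = m \<and>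
    (\<forall>v. snd (Lam D q) (J0 D v) = JM D m (snd (Lam D q) v))}"

definition clsH :: "'p \<Rightarrow> 'l L2_dual \<Rightarrow> ('p \<times> 'l L2_dual) set"
  where "clsH = assoc_class UNIV (actP D) sigma"

definition clsHcheck :: "'p \<Rightarrow> 'l L2 \<Rightarrow> ('p \<times> 'l L2) set"
  where "clsHcheck = assoc_class UNIV (actP D) (\<lambda>g. blinfun_apply (ssw D g))"

definition clsCH :: "'p \<Rightarrow> ('l L2 \<Rightarrow>\<^sub>L 'l L2) \<Rightarrow> ('p \<times> ('l L2 \<Rightarrow>\<^sub>L 'l L2)) set"
  where "clsCH = assoc_class UNIV (actP D) rho"

definition clsHkR :: "'p \<Rightarrow> ('v list \<Rightarrow> 'l L2_dual) \<Rightarrow> ('p \<times> ('v list \<Rightarrow> 'l L2_dual)) set"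
  where "clsHkR = assoc_class Ktilde (actP D) sigma_k"

definition H_fibre :: "'m \<Rightarrow> ('p \<times> 'l L2_dual) set set"
  where "H_fibre m = {clsH p f | p f. projP D p = m}"

definition H_bundle :: "('p \<times> 'l L2_dual) set set"
  where "H_bundle = (\<Union>m. H_fibre m)"

definition H_topology :: "('p \<times> 'l L2_dual) set topology"
  where "H_topology =
    topology (\<lambda>U. U \<subseteq> H_bundle \<and> open {(p, f). clsH p f \<in> U})"

definition CH_bundle :: "('p \<times> ('l L2 \<Rightarrow>\<^sub>L 'l L2)) set set"
  where "CH_bundle = {clsCH p a | p a. a \<in> compact_ops}"

definition HkR_fibre :: "nat \<Rightarrow> 'm \<Rightarrow>
      ('p \<times> ('v list \<Rightarrow> 'l L2_dual)) set set"
  where "HkR_fibre k m = {clsHkR q F | q F. q \<in> PR m \<and> F \<in> Hk k}"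

definition H_coord :: "'p \<Rightarrow> ('p \<times> 'l L2_dual) set \<Rightarrow> 'l L2_dual"
  where "H_coord q x = (THE f. x = clsH q f)"

text \<open>The isomorphism of \<open>\<Lambda>\<^sup>k T\<^sup>*M \<otimes> \<H>\<close> with the bundle associated to the unitary frames:
  \<open>tensor_sum\<close> is the image of \<open>\<Sum>i\<in>I. \<alpha>\<^sub>i \<otimes> x\<^sub>i\<close> at the point m, and
  \<open>HkR_eval\<close> reads off the corresponding \<open>\<H>\<close>-valued form.\<close>

definition tensor_sum :: "'m \<Rightarrow> 'i set \<Rightarrow>
      ('i \<Rightarrow> ('m, 'v) tangent list \<Rightarrow> real) \<Rightarrow> ('i \<Rightarrow> ('p \<times> 'l L2_dual) set) \<Rightarrow>
      ('p \<times> ('v list \<Rightarrow> 'l L2_dual)) set"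
  where "tensor_sum m I \<alpha> x = (let q = (SOME q. q \<in> PR m) in
    clsHkR q (\<lambda>vs. \<Sum>i\<in>I. \<alpha> i (map (snd (Lam D q)) vs) *\<^sub>R H_coord q (x i)))"

definition HkR_eval :: "('p \<times> ('v list \<Rightarrow> 'l L2_dual)) set \<Rightarrow> ('m, 'v) tangent list \<Rightarrow> ('p \<times> 'l L2_dual) set"
  where "HkR_eval h ts = (THE x. \<exists>q F. q \<in> PR (projP D q) \<and> h = clsHkR q F \<and>
    x = clsH q (F (map (inv (snd (Lam D q))) ts)))"

definition zero_section :: "'m \<Rightarrow> ('p \<times> ('v list \<Rightarrow> 'l L2_dual)) set"
  where "zero_section m = clsHkR (SOME q. q \<in> PR m) 0"


section \<open>Kuiper maps and the action of compact operators\<close>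

definition kuiper_map :: "(('p \<times> 'l L2_dual) set \<Rightarrow> 'm \<times> 'l L2_dual) \<Rightarrow> bool"
  where "kuiper_map J \<longleftrightarrow> homeomorphic_map H_topology euclidean J \<and>
    (\<forall>r f. fst (J (clsH r f)) = projP D r) \<and>
    (\<forall>r. complex_linear (\<lambda>f. snd (J (clsH r f)))) \<and>
    (\<forall>r f g. dual_inner (snd (J (clsH r f))) (snd (J (clsH r g))) = dual_inner f g)"

definition fibre_mult :: "('p \<times> ('v list \<Rightarrow> 'l L2_dual)) set \<Rightarrow> ('p \<times> ('l L2 \<Rightarrow>\<^sub>L 'l L2)) set \<Rightarrow>
      ('p \<times> ('v list \<Rightarrow> 'l L2_dual)) set"
  where "fibre_mult h x = (THE h'. \<exists>q F b. q \<in> PR (projP D q) \<and>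
    h = clsHkR q F \<and> x = clsCH q b \<and> h' = clsHkR q (\<lambda>vs. dual_comp (F vs) b))"

context
  fixes J :: "('p \<times> 'l L2_dual) set \<Rightarrow> 'm \<times> 'l L2_dual"
begin

definition kuiper_check :: "('p \<times> 'l L2) set \<Rightarrow> 'm \<times> 'l L2"
  where "kuiper_check x = (THE y. \<exists>r v. x = clsHcheck r v \<and>
    y = (projP D r, sharp (snd (J (clsH r (flat v))))))"

definition extends_to_CH :: "(('p \<times> ('l L2 \<Rightarrow>\<^sub>L 'l L2)) set \<Rightarrow> 'm \<times> ('l L2 \<Rightarrow>\<^sub>L 'l L2)) \<Rightarrow> bool"
  where "extends_to_CH j \<longleftrightarrow> (\<forall>r.
    (\<forall>b\<in>compact_ops. fst (j (clsCH r b)) = projP D r \<and> snd (j (clsCH r b)) \<in> compact_ops) \<and>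
    (\<forall>b\<in>compact_ops. \<forall>b'\<in>compact_ops. snd (j (clsCH r (b + b'))) =
      snd (j (clsCH r b)) + snd (j (clsCH r b'))) \<and>
    (\<forall>b\<in>compact_ops. \<forall>c. snd (j (clsCH r (op_scaleC c b))) = op_scaleC c (snd (j (clsCH r b)))) \<and>
    continuous_on compact_ops (\<lambda>b. snd (j (clsCH r b))) \<and>
    (\<forall>v f. j (clsCH r (rank_one v f)) = (projP D r,
      rank_one (snd (kuiper_check (clsHcheck r v))) (snd (J (clsH r f))))))"

text \<open>On \<open>CH_bundle\<close> the extension is unique, since operators of finite rank are dense.\<close>

definition kuiper_CH :: "('p \<times> ('l L2 \<Rightarrow>\<^sub>L 'l L2)) set \<Rightarrow> 'm \<times> ('l L2 \<Rightarrow>\<^sub>L 'l L2)"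
  where "kuiper_CH = (SOME j. extends_to_CH j)"

definition section_mult :: "('m \<Rightarrow> ('p \<times> ('v list \<Rightarrow> 'l L2_dual)) set) \<Rightarrow> ('l L2 \<Rightarrow>\<^sub>L 'l L2) \<Rightarrow>
      'm \<Rightarrow> ('p \<times> ('v list \<Rightarrow> 'l L2_dual)) set"
  where "section_mult s a =
    (\<lambda>m. fibre_mult (s m) (inv_into CH_bundle kuiper_CH (m, a)))"


section \<open>Smooth sections, the Kuiper connection and its exterior covariant derivatives\<close>

text \<open>The charts of the bundle obtained from those of M via the global chart J.\<close>

definition H_atlas :: "(('p \<times> 'l L2_dual) set, 'v \<times> 'l L2_dual) atlas"
  where "H_atlas = (\<lambda>c. (H_bundle \<inter> J -` fst c, snd c \<circ> J)) ` prod_atlas (atlasM D) space_atlas"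

definition H_section_on :: "'m set \<Rightarrow> ('m \<Rightarrow> ('p \<times> 'l L2_dual) set) \<Rightarrow> bool"
  where "H_section_on W s \<longleftrightarrow>
    (\<forall>m\<in>W. s m \<in> H_fibre m) \<and> smooth_map_on (atlasM D) H_atlas W s"

text \<open>Smoothness with respect to the tensor product structure: all components in the
  trivialisation given by a chart of M and by J are smooth.\<close>

definition HkR_sections :: "nat \<Rightarrow>
      ('m \<Rightarrow> ('p \<times> ('v list \<Rightarrow> 'l L2_dual)) set) set"
  where "HkR_sections k = {s. (\<forall>m. s m \<in> HkR_fibre k m) \<and>
    (\<forall>c\<in>atlasM D. \<forall>vs. length vs = k \<longrightarrow> smooth_on (snd c ` fst c)
      (\<lambda>y. snd (J (HkR_eval (s (chart_inv c y))
        (map (coord_vec (atlasM D) c (chart_inv c y)) vs)))))}"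

definition kuiper_connection :: "('p \<times> 'l L2_dual) set \<times> (('p \<times> 'l L2_dual) set, 'v \<times> 'l L2_dual) tangent \<Rightarrow>
      ('p \<times> 'l L2_dual) set \<times> (('p \<times> 'l L2_dual) set, 'v \<times> 'l L2_dual) tangent"
  where "kuiper_connection =
    tangent_map (prod_atlas (atlasM D) space_atlas) H_atlas (inv_into H_bundle J) \<circ>
    trivial_connection (atlasM D) \<circ>
    tangent_map H_atlas (prod_atlas (atlasM D) space_atlas) J"

definition vertical_lift :: "('p \<times> 'l L2_dual) set \<times> ('p \<times> 'l L2_dual) set \<Rightarrow>
      ('p \<times> 'l L2_dual) set \<times> (('p \<times> 'l L2_dual) set, 'v \<times> 'l L2_dual) tangent"
  where "vertical_lift = (\<lambda>(x, y). (x, \<lambda>d. if d \<in> charts_at H_atlas x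
    then vector_derivative
      (\<lambda>t. snd d (fibre_add clsH x (fibre_scale clsH t y))) (at 0)
    else 0))"

definition connector :: "('p \<times> 'l L2_dual) set \<times> (('p \<times> 'l L2_dual) set, 'v \<times> 'l L2_dual) tangent \<Rightarrow>
      ('p \<times> 'l L2_dual) set"
  where "connector \<tau> = snd (inv_into
    {(x, y). \<exists>m. x \<in> H_fibre m \<and> y \<in> H_fibre m} vertical_lift
    (kuiper_connection \<tau>))"

definition nabla :: "('m \<Rightarrow> ('m, 'v) tangent) \<Rightarrow> ('m \<Rightarrow> ('p \<times> 'l L2_dual) set) \<Rightarrow> 'm \<Rightarrow> ('p \<times> 'l L2_dual) set"
  where "nabla X s m =
    connector (tangent_map (atlasM D) H_atlas s (m, X m))"

text \<open>The linear extension of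
  \<open>d(\<alpha> \<otimes> s) = d\<alpha> \<otimes> s + (\<Sum>i. \<epsilon>\<^sup>i \<and> \<alpha> \<otimes> \<nabla>\<^bsub>e\<^sub>i\<^esub> s)\<close>: its value at m is computed from any
  presentation of the section near m as a finite sum of elementary tensors
  \<open>\<alpha>\<^sub>j \<otimes> s\<^sub>j\<close>, and any dual local frames, whose
  index set is the Basis of the model space.\<close>

definition ext_cov_deriv :: "nat \<Rightarrow>
      ('m \<Rightarrow> ('p \<times> ('v list \<Rightarrow> 'l L2_dual)) set) \<Rightarrow> 'm \<Rightarrow> ('p \<times> ('v list \<Rightarrow> 'l L2_dual)) set"
  where "ext_cov_deriv k S m = (THE h. \<exists>W (N::nat) \<alpha> s e \<epsilon>.
    open W \<and> m \<in> W \<and>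
    (\<forall>j<N. smooth_form_on (atlasM D) W k (\<alpha> j) \<and> H_section_on W (s j)) \<and>
    dual_frames_on (atlasM D) W e \<epsilon> \<and>
    (\<forall>x\<in>W. S x = tensor_sum x {..<N} (\<lambda>j. \<alpha> j x) (\<lambda>j. s j x)) \<and>
    h = fibre_add clsHkR
      (tensor_sum m {..<N} (\<lambda>j. ext_deriv (atlasM D) (\<alpha> j) m) (\<lambda>j. s j m))
      (tensor_sum m ({..<N} \<times> Basis)
        (\<lambda>(j, i). wedge1 (\<epsilon> i m) (\<alpha> j m)) (\<lambda>(j, i). nabla (e i) (s j) m)))"

end

end

end

theory Submission
  imports Defs
begin

text \<open>The global chart J turns a section of the bundle of k-forms into a k-form on M with values in the
  fixed Hilbert space H. In these terms the Kuiper connection is the flat one, so that the exterior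
  covariant derivative is the exterior derivative of H-valued forms: it is independent of charts and
  presentations by naturality, and its square vanishes by the symmetry of second derivatives. The map
  \<open>J\<^bsub>CH\<^esub>\<close> is fibrewise the conjugation with a unitary operator, since it is so on operators of rank one
  and operators of finite rank are dense in the compact ones; hence right multiplication by a compact
  operator a becomes the constant bounded linear map \<open>f \<mapsto> f \<circ> a\<close> on the values of forms, which commutes
  with the exterior derivative.\<close>

section \<open>Smooth maps\<close>

text \<open>Almost every object of the statement is a definite description or depends on a chosen
  chart or frame, so most of the work is to show that values are well defined before they can be
  computed. \<open>sharp\<close> requires the Riesz theorem, hence completeness of
  \<open>L2\<close>. Elements of the form bundles are classes over unitary frames, so every point
  must carry one; this is where conjugacy of compatible complex structures and surjectivity of
  \<open>lam\<close> enter. The value of \<open>ext_cov_deriv\<close> at a point ranges over all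
  presentations as sums of elementary tensors: one must exist, and any two must agree. The Leibniz
  rule gives agreement, because it rewrites the value as the exterior derivative of the local
  coefficient form, in which neither presentation nor frame occurs. That computation uses the chart
  selected at the point by a choice operator, and this chart may change from point to point.
  Smoothness of the result and the second application of the derivative need one chart on a whole
  neighbourhood; naturality of the exterior derivative under transition maps bridges the
  two.\<close>

lemma Ck_on_cong:
  assumes "open S" "\<And>x. x \<in> S \<Longrightarrow> f x = g x" "Ck_on k S f"
  shows "Ck_on k S g"
  using assms
proof (induction k arbitrary: f g)
  case 0
  then show ?case using continuous_on_cong[of S S f g] by simp
next
  case (Suc k)
  have d: "f differentiable (at x)" if "x \<in> S" for x
    using Suc.prems that by auto
  have "g differentiable (at x)" if "x \<in> S" for x
    using d[OF that] Suc.prems(1,2) that unfolding differentiable_def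
    by (meson has_derivative_transform_within_open)
  moreover have "frechet_derivative f (at x) = frechet_derivative g (at x)" if "x \<in> S" for x
    using frechet_derivative_transform_within_open[OF d[OF that] Suc.prems(1) that] Suc.prems(2)
    by auto
  then have "Ck_on k S (\<lambda>x. frechet_derivative g (at x) v)" for v
    using Suc.prems(1,3) by - (rule Suc.IH[of "\<lambda>x. frechet_derivative f (at x) v"], simp_all)
  ultimately show ?case by simp
qed

lemma Ck_on_subset: "Ck_on k S f \<Longrightarrow> T \<subseteq> S \<Longrightarrow> Ck_on k T f"
  by (induction k arbitrary: f) (auto intro: continuous_on_subset)

lemma Ck_on_Suc_imp: "Ck_on (Suc k) S f \<Longrightarrow> Ck_on k S f"
proof (induction k arbitrary: f)
  case 0
  then show ?case
    by (auto intro!: continuous_at_imp_continuous_on differentiable_imp_continuous_within)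
qed auto

text \<open>\<open>Ck_on\<close> speaks of \<open>frechet_derivative\<close>, which is a choice.
  This rule replaces it by any explicit derivative formula, so that each closure property below is
  an induction along the matching differentiation rule.\<close>

lemma Ck_on_derivI:
  assumes "open S" "\<And>x. x \<in> S \<Longrightarrow> (f has_derivative f' x) (at x)"
    "\<And>v. Ck_on k S (\<lambda>x. f' x v)"
  shows "Ck_on (Suc k) S f"
proof -
  have "frechet_derivative f (at x) = f' x" if "x \<in> S" for x
    using frechet_derivative_at[OF assms(2)[OF that]] by simp
  then have "Ck_on k S (\<lambda>x. frechet_derivative f (at x) v)" for v
    using Ck_on_cong[OF assms(1) _ assms(3)[of v]] by simp
  then show ?thesis using assms(2) by (auto simp: differentiable_def)
qed

lemma Ck_on_has_derivative:
  "Ck_on (Suc k) S f \<Longrightarrow> x \<in> S \<Longrightarrow> (f has_derivative frechet_derivative f (at x)) (at x)"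
  using frechet_derivative_works by auto

lemma Ck_on_const: "Ck_on k S (\<lambda>_. c)"
proof (induction k arbitrary: c)
  case (Suc k)
  then show ?case by (simp add: frechet_derivative_const)
qed simp

lemma Ck_on_bounded_linear:
  assumes L: "bounded_linear L" and "open S" "Ck_on k S f"
  shows "Ck_on k S (\<lambda>x. L (f x))"
  using assms(3)
proof (induction k arbitrary: f)
  case 0
  then show ?case using linear_continuous_on_compose bounded_linear.continuous_on[OF L] by auto
next
  case (Suc k)
  show ?case
    by (rule Ck_on_derivI[OF \<open>open S\<close> bounded_linear.has_derivative[OF L Ck_on_has_derivative[OF Suc.prems]]])
      (use Suc in auto)
qed

lemma Ck_on_add:
  assumes "open S" "Ck_on k S f" "Ck_on k S g"
  shows "Ck_on k S (\<lambda>x. f x + g x)"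
  using assms(2,3)
proof (induction k arbitrary: f g)
  case 0
  then show ?case by (auto intro: continuous_on_add)
next
  case (Suc k)
  show ?case
    by (rule Ck_on_derivI[OF \<open>open S\<close> has_derivative_add[OF Suc.prems[THEN Ck_on_has_derivative]]])
      (use Suc in auto)
qed

lemma Ck_on_sum:
  assumes "open S" "\<And>i. i \<in> I \<Longrightarrow> Ck_on k S (f i)"
  shows "Ck_on k S (\<lambda>x. \<Sum>i\<in>I. f i x)"
  using assms(2) by (induction I rule: infinite_finite_induct) (auto intro: Ck_on_const Ck_on_add assms)

text \<open>The product rule contains \<open>f\<close> and \<open>g\<close> undifferentiated as
  well; in the induction these enter with one degree less, by \<open>Ck_on_Suc_imp\<close>.\<close>

lemma Ck_on_bounded_bilinear:
  assumes B: "bounded_bilinear B" and "open S" "Ck_on k S f" "Ck_on k S g"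
  shows "Ck_on k S (\<lambda>x. B (f x) (g x))"
  using assms(3,4)
proof (induction k arbitrary: f g)
  case 0
  then show ?case using bounded_bilinear.continuous_on[OF B] by auto
next
  case (Suc k)
  note s = Ck_on_Suc_imp[OF Suc.prems(1)] Ck_on_Suc_imp[OF Suc.prems(2)]
  show ?case
    by (rule Ck_on_derivI[OF \<open>open S\<close> bounded_bilinear.FDERIV[OF B Suc.prems[THEN Ck_on_has_derivative]]])
      (use Suc s \<open>open S\<close> in \<open>auto intro!: Ck_on_add\<close>)
qed

lemma linear_expand:
  fixes L :: "'a::euclidean_space \<Rightarrow> 'b::real_vector"
  assumes "linear L"
  shows "L v = (\<Sum>b\<in>Basis. (v \<bullet> b) *\<^sub>R L b)"
proof -
  have "L v = L (\<Sum>b\<in>Basis. (v \<bullet> b) *\<^sub>R b)" by (simp add: euclidean_representation)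
  also have "\<dots> = (\<Sum>b\<in>Basis. (v \<bullet> b) *\<^sub>R L b)"
    using assms by (simp add: linear_sum linear_scale)
  finally show ?thesis .
qed

text \<open>The chain rule applies a moving linear map to a moving vector. Expanding the vector in
  the basis gives a finite sum of scalar functions times directional derivatives of \<open>g\<close>
  composed with \<open>f\<close>. The induction hypothesis covers these because \<open>g\<close> is
  kept arbitrary.\<close>

lemma Ck_on_compose:
  fixes f :: "'a::euclidean_space \<Rightarrow> 'b::euclidean_space"
  assumes "open S" "open T" "Ck_on k S f" "Ck_on k T g" "f ` S \<subseteq> T"
  shows "Ck_on k S (\<lambda>x. g (f x))"
  using assms(3,4)
proof (induction k arbitrary: g)
  case 0
  then show ?case using assms(5) by (auto intro: continuous_on_compose2)
next
  case (Suc k)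
  have dg: "(g has_derivative frechet_derivative g (at (f x))) (at (f x))" if "x \<in> S" for x
    using Suc.prems assms(5) that by (intro Ck_on_has_derivative) auto
  show ?case
  proof (rule Ck_on_derivI[where f' = "\<lambda>x v. frechet_derivative g (at (f x)) (frechet_derivative f (at x) v)"])
    show "open S" by fact
    show "((\<lambda>x. g (f x)) has_derivative
        (\<lambda>v. frechet_derivative g (at (f x)) (frechet_derivative f (at x) v))) (at x)" if "x \<in> S" for x
      using diff_chain_at[OF Ck_on_has_derivative[OF Suc.prems(1) that] dg[OF that]] by (simp add: o_def)
    fix v
    have "Ck_on k S (\<lambda>x. \<Sum>b\<in>Basis. (frechet_derivative f (at x) v \<bullet> b) *\<^sub>R frechet_derivative g (at (f x)) b)"
      using Suc Ck_on_Suc_imp[OF Suc.prems(1)] assms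
      by (intro Ck_on_sum Ck_on_bounded_bilinear[OF bounded_bilinear_scaleR] Suc.IH
          Ck_on_bounded_linear[OF bounded_linear_inner_left]) auto
    then show "Ck_on k S (\<lambda>x. frechet_derivative g (at (f x)) (frechet_derivative f (at x) v))"
      by (rule Ck_on_cong[OF \<open>open S\<close>, rotated])
        (rule linear_expand[OF has_derivative_linear[OF dg], symmetric])
  qed
qed

lemma smooth_on_cong: "open S \<Longrightarrow> (\<And>x. x \<in> S \<Longrightarrow> f x = g x) \<Longrightarrow> smooth_on S f \<Longrightarrow> smooth_on S g"
  by (simp add: smooth_on_def Ck_on_cong[of S f g])

lemma smooth_on_subset: "smooth_on S f \<Longrightarrow> T \<subseteq> S \<Longrightarrow> smooth_on T f"
  by (simp add: smooth_on_def Ck_on_subset[of _ S f T])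

lemma smooth_on_const: "smooth_on S (\<lambda>_. c)"
  by (simp add: smooth_on_def Ck_on_const)

lemma smooth_on_bounded_linear:
  "bounded_linear L \<Longrightarrow> open S \<Longrightarrow> smooth_on S f \<Longrightarrow> smooth_on S (\<lambda>x. L (f x))"
  by (simp add: smooth_on_def Ck_on_bounded_linear)

lemma smooth_on_add:
  "open S \<Longrightarrow> smooth_on S f \<Longrightarrow> smooth_on S g \<Longrightarrow> smooth_on S (\<lambda>x. f x + g x)"
  by (simp add: smooth_on_def Ck_on_add)

lemma smooth_on_sum:
  "open S \<Longrightarrow> (\<And>i. i \<in> I \<Longrightarrow> smooth_on S (f i)) \<Longrightarrow> smooth_on S (\<lambda>x. \<Sum>i\<in>I. f i x)"
  by (simp add: smooth_on_def Ck_on_sum)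

lemma smooth_on_bounded_bilinear:
  "bounded_bilinear B \<Longrightarrow> open S \<Longrightarrow> smooth_on S f \<Longrightarrow> smooth_on S g \<Longrightarrow>
    smooth_on S (\<lambda>x. B (f x) (g x))"
  by (simp add: smooth_on_def Ck_on_bounded_bilinear)

lemma smooth_on_mult:
  fixes f g :: "'a::euclidean_space \<Rightarrow> real"
  shows "open S \<Longrightarrow> smooth_on S f \<Longrightarrow> smooth_on S g \<Longrightarrow> smooth_on S (\<lambda>x. f x * g x)"
  by (rule smooth_on_bounded_bilinear[OF bounded_bilinear_mult])

lemma smooth_on_Pair:
  assumes "open S" "smooth_on S f" "smooth_on S g"
  shows "smooth_on S (\<lambda>x. (f x, g x))"
proof -
  have "smooth_on S (\<lambda>x. (f x, 0) + (0, g x))"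
    using assms by (intro smooth_on_add smooth_on_bounded_linear[of "\<lambda>y. (y, 0)"]
        smooth_on_bounded_linear[of "\<lambda>y. (0, y)"] bounded_linear_Pair bounded_linear_ident bounded_linear_zero)
  then show ?thesis by simp
qed

lemma smooth_on_compose:
  fixes f :: "'a::euclidean_space \<Rightarrow> 'b::euclidean_space"
  assumes "open S" "open T" "smooth_on S f" "smooth_on T g" "f ` S \<subseteq> T"
  shows "smooth_on S (\<lambda>x. g (f x))"
  using assms Ck_on_compose[of S T _ f g] by (auto simp: smooth_on_def)

lemma smooth_on_differentiable: "smooth_on S f \<Longrightarrow> x \<in> S \<Longrightarrow> f differentiable (at x)"
  unfolding smooth_on_def by (drule spec[of _ "Suc 0"]) simp

lemma smooth_on_has_derivative:
  "smooth_on S f \<Longrightarrow> x \<in> S \<Longrightarrow> (f has_derivative frechet_derivative f (at x)) (at x)"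
  using smooth_on_differentiable frechet_derivative_works by blast

lemma smooth_on_frechet_derivative:
  assumes "smooth_on S f"
  shows "smooth_on S (\<lambda>x. frechet_derivative f (at x) v)"
proof -
  have "Ck_on (Suc k) S f" for k using assms by (simp only: smooth_on_def)
  then show ?thesis by (simp add: smooth_on_def)
qed

lemma linear_frechet_derivative: "f differentiable (at x) \<Longrightarrow> linear (frechet_derivative f (at x))"
  using frechet_derivative_works has_derivative_linear by blast

lemma smooth_on_continuous_on: "smooth_on S f \<Longrightarrow> continuous_on S f"
  unfolding smooth_on_def by (drule spec[of _ 0]) simp


subsection \<open>Symmetry of second derivatives\<close>

lemma real_increment_bound:
  fixes \<psi> :: "real \<Rightarrow> 'b::real_normed_vector"
  assumes "0 \<le> h" "\<And>t. t \<in> {0..h} \<Longrightarrow> (\<psi> has_derivative (\<lambda>s. s *\<^sub>R \<psi>' t)) (at t)"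
    "\<And>t. t \<in> {0..h} \<Longrightarrow> norm (\<psi>' t) \<le> B"
  shows "norm (\<psi> h - \<psi> 0) \<le> B * h"
proof -
  have "norm (\<psi> h - \<psi> 0) \<le> B * norm (h - 0)"
  proof (rule differentiable_bound[where S = "{0..h}" and f' = "\<lambda>t s. s *\<^sub>R \<psi>' t"])
    show "(\<psi> has_derivative (\<lambda>s. s *\<^sub>R \<psi>' t)) (at t within {0..h})" if "t \<in> {0..h}" for t
      using assms(2)[OF that] by (rule has_derivative_at_withinI)
    show "onorm (\<lambda>s. s *\<^sub>R \<psi>' t) \<le> B" if "t \<in> {0..h}" for t
      using assms(3)[OF that] onorm_scaleR_left_lemma[of "\<lambda>s. s" "\<psi>' t"]
      by (simp add: onorm_scaleR_left onorm_id)
  qed (use assms(1) in auto)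
  then show ?thesis using assms(1) by simp
qed

lemma has_derivative_along_line:
  assumes "(f has_derivative f') (at (x + t *\<^sub>R w))"
  shows "((\<lambda>s. f (x + s *\<^sub>R w)) has_derivative (\<lambda>s. s *\<^sub>R f' w)) (at t)"
proof -
  have "((\<lambda>s. x + s *\<^sub>R w) has_derivative (\<lambda>s. s *\<^sub>R w)) (at t)"
    by (auto intro!: derivative_eq_intros)
  from diff_chain_at[OF this assms] show ?thesis
    using has_derivative_linear[OF assms] by (simp add: o_def linear_scale)
qed

text \<open>The mean value inequality is used twice: in direction \<open>w\<close> for the
  derivative of \<open>f\<close> along \<open>v\<close>, and then in direction \<open>v\<close> for
  the difference of two translates of \<open>f\<close>. Subtracting the linear terms with
  \<open>c\<close> makes the bound one on the deviation from \<open>c\<close>.\<close>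

lemma second_difference_bound:
  fixes f :: "'a::euclidean_space \<Rightarrow> 'b::real_normed_vector"
  assumes h: "0 \<le> h"
    and f: "\<And>s t. s \<in> {0..h} \<Longrightarrow> t \<in> {0..h} \<Longrightarrow> f differentiable (at (x + s *\<^sub>R v + t *\<^sub>R w))"
    and g: "\<And>s t. s \<in> {0..h} \<Longrightarrow> t \<in> {0..h} \<Longrightarrow>
      (\<lambda>y. frechet_derivative f (at y) v) differentiable (at (x + s *\<^sub>R v + t *\<^sub>R w))"
    and b: "\<And>s t. s \<in> {0..h} \<Longrightarrow> t \<in> {0..h} \<Longrightarrow>
      norm (frechet_derivative (\<lambda>y. frechet_derivative f (at y) v) (at (x + s *\<^sub>R v + t *\<^sub>R w)) w - c) \<le> e"
  shows "norm (f (x + h *\<^sub>R v + h *\<^sub>R w) - f (x + h *\<^sub>R v) - f (x + h *\<^sub>R w) + f x - (h * h) *\<^sub>R c) \<le> e * h * h"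
proof -
  define g where "g = (\<lambda>y. frechet_derivative f (at y) v)"
  have inner: "norm (g (x + s *\<^sub>R v + h *\<^sub>R w) - g (x + s *\<^sub>R v) - h *\<^sub>R c) \<le> e * h" if s: "s \<in> {0..h}" for s
  proof -
    let ?\<psi> = "\<lambda>t. g (x + s *\<^sub>R v + t *\<^sub>R w) - t *\<^sub>R c"
    have "norm (?\<psi> h - ?\<psi> 0) \<le> e * h"
    proof (rule real_increment_bound[where \<psi>' = "\<lambda>t. frechet_derivative g (at (x + s *\<^sub>R v + t *\<^sub>R w)) w - c"])
      fix t assume t: "t \<in> {0..h}"
      have "(g has_derivative frechet_derivative g (at (x + s *\<^sub>R v + t *\<^sub>R w))) (at (x + s *\<^sub>R v + t *\<^sub>R w))"
        using assms(3)[OF s t] frechet_derivative_works unfolding g_def by blast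
      from has_derivative_along_line[OF this]
      show "(?\<psi> has_derivative (\<lambda>r. r *\<^sub>R (frechet_derivative g (at (x + s *\<^sub>R v + t *\<^sub>R w)) w - c))) (at t)"
        by (auto intro!: derivative_eq_intros simp: algebra_simps)
      show "norm (frechet_derivative g (at (x + s *\<^sub>R v + t *\<^sub>R w)) w - c) \<le> e"
        using b[OF s t] unfolding g_def .
    qed (rule h)
    then show ?thesis by (simp add: algebra_simps)
  qed
  let ?\<psi> = "\<lambda>s. f (x + h *\<^sub>R w + s *\<^sub>R v) - f (x + s *\<^sub>R v) - s *\<^sub>R (h *\<^sub>R c)"
  have "norm (?\<psi> h - ?\<psi> 0) \<le> e * h * h"
  proof (rule real_increment_bound[where \<psi>' = "\<lambda>s. g (x + h *\<^sub>R w + s *\<^sub>R v) - g (x + s *\<^sub>R v) - h *\<^sub>R c"])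
    fix s assume s: "s \<in> {0..h}"
    have "(f has_derivative frechet_derivative f (at (x + h *\<^sub>R w + s *\<^sub>R v))) (at (x + h *\<^sub>R w + s *\<^sub>R v))"
      "(f has_derivative frechet_derivative f (at (x + s *\<^sub>R v))) (at (x + s *\<^sub>R v))"
      using f[OF s, of h] f[OF s, of 0] h frechet_derivative_works
      by (auto simp: add.commute add.left_commute)
    from this[THEN has_derivative_along_line]
    show "(?\<psi> has_derivative (\<lambda>r. r *\<^sub>R (g (x + h *\<^sub>R w + s *\<^sub>R v) - g (x + s *\<^sub>R v) - h *\<^sub>R c))) (at s)"
      unfolding g_def by (auto intro!: derivative_eq_intros simp: algebra_simps)
    show "norm (g (x + h *\<^sub>R w + s *\<^sub>R v) - g (x + s *\<^sub>R v) - h *\<^sub>R c) \<le> e * h"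
      using inner[OF s] by (simp add: add.commute add.left_commute)
  qed (rule h)
  then show ?thesis by (simp add: algebra_simps)
qed

text \<open>The second difference over a parallelogram is symmetric in \<open>v\<close> and
  \<open>w\<close>, and divided by the square of its scale it approximates both mixed derivatives.
  Their distance is therefore at most any positive \<open>e\<close>.\<close>

lemma second_derivative_symmetric:
  fixes f :: "'a::euclidean_space \<Rightarrow> 'b::real_normed_vector"
  assumes S: "open S" "x \<in> S" and f: "smooth_on S f"
  shows "frechet_derivative (\<lambda>y. frechet_derivative f (at y) v) (at x) w =
    frechet_derivative (\<lambda>y. frechet_derivative f (at y) w) (at x) v"
proof -
  define F where "F = (\<lambda>v w y. frechet_derivative (\<lambda>y. frechet_derivative f (at y) v) (at y) w)"
  have cont: "continuous_on S (F v w)" for v w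
    unfolding F_def
    by (intro smooth_on_continuous_on smooth_on_frechet_derivative f)
  have "dist (F v w x) (F w v x) \<le> e" if e: "e > 0" for e
  proof -
    have "isCont (F v w) x" for v w
      using cont[of v w] S by (simp add: continuous_on_eq_continuous_at)
    then have "\<exists>d>0. \<forall>y. dist y x < d \<longrightarrow> dist (F v w y) (F v w x) < e/2" for v w
      using e unfolding continuous_at_eps_delta by (meson half_gt_zero)
    then obtain d1 d2 where d: "d1 > 0" "d2 > 0"
      "\<And>y. dist y x < d1 \<Longrightarrow> dist (F v w y) (F v w x) < e/2"
      "\<And>y. dist y x < d2 \<Longrightarrow> dist (F w v y) (F w v x) < e/2" by metis
    obtain d0 where d0: "d0 > 0" "ball x d0 \<subseteq> S" using S open_contains_ball by blast
    define d where "d = min d0 (min d1 d2)"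
    \<comment> \<open>The \<open>+ 1\<close> keeps \<open>N\<close> positive when both directions
      vanish. With \<open>h = d / (2 * N)\<close> the whole parallelogram stays within
      \<open>d / 2\<close> of \<open>x\<close>.\<close>
    obtain N where N: "N = norm v + norm w + 1" "N > 0" by (simp add: add_nonneg_pos)
    define h where "h = d / (2 * N)"
    have dp: "d > 0" using d d0 by (simp add: d_def)
    have h: "h > 0" using dp N(2) by (simp add: h_def)
    have near: "dist (x + s *\<^sub>R a + t *\<^sub>R b) x < d"
      if "s \<in> {0..h}" "t \<in> {0..h}" "norm a + norm b = norm v + norm w" for s t a b
    proof -
      have "dist (x + s *\<^sub>R a + t *\<^sub>R b) x = norm (s *\<^sub>R a + t *\<^sub>R b)" by (simp add: dist_norm)
      also have "\<dots> \<le> s * norm a + t * norm b"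
        using that norm_triangle_ineq[of "s *\<^sub>R a" "t *\<^sub>R b"] by simp
      also have "\<dots> \<le> h * norm a + h * norm b"
        using that by (intro add_mono mult_right_mono) auto
      also have "\<dots> = h * (norm v + norm w)" using that(3) by (metis distrib_left)
      also have "\<dots> \<le> h * N" using h N(1) by (intro mult_left_mono) auto
      also have "\<dots> = d / 2" using N(2) by (simp add: h_def)
      also have "\<dots> < d" using dp by simp
      finally show ?thesis .
    qed
    have sm: "f differentiable (at y)" "(\<lambda>y. frechet_derivative f (at y) u) differentiable (at y)"
      if "dist y x < d" for y u
    proof -
      have "y \<in> S" using that d0 by (auto simp: d_def dist_commute)
      then show "f differentiable (at y)" "(\<lambda>y. frechet_derivative f (at y) u) differentiable (at y)"
        using f smooth_on_frechet_derivative smooth_on_differentiable by blast+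
    qed
    let ?\<Delta> = "f (x + h *\<^sub>R v + h *\<^sub>R w) - f (x + h *\<^sub>R v) - f (x + h *\<^sub>R w) + f x"
    have c: "norm (frechet_derivative (\<lambda>y. frechet_derivative f (at y) v) (at y) w - F v w x) \<le> e/2"
      "norm (frechet_derivative (\<lambda>y. frechet_derivative f (at y) w) (at y) v - F w v x) \<le> e/2"
      if "dist y x < d" for y
      using d(3)[of y] d(4)[of y] that by (auto simp: F_def dist_norm d_def)
    have near': "dist (x + s *\<^sub>R v + t *\<^sub>R w) x < d" "dist (x + s *\<^sub>R w + t *\<^sub>R v) x < d"
      if "s \<in> {0..h}" "t \<in> {0..h}" for s t
      using near that by auto
    have 1: "norm (?\<Delta> - (h * h) *\<^sub>R F v w x) \<le> e/2 * h * h"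
      using h by (intro second_difference_bound sm c near') auto
    have "norm (f (x + h *\<^sub>R w + h *\<^sub>R v) - f (x + h *\<^sub>R w) - f (x + h *\<^sub>R v) + f x
        - (h * h) *\<^sub>R F w v x) \<le> e/2 * h * h"
      using h by (intro second_difference_bound sm c near') auto
    then have 2: "norm (?\<Delta> - (h * h) *\<^sub>R F w v x) \<le> e/2 * h * h"
      by (simp add: algebra_simps)
    have "norm ((h * h) *\<^sub>R (F v w x - F w v x)) =
        norm ((?\<Delta> - (h * h) *\<^sub>R F w v x) - (?\<Delta> - (h * h) *\<^sub>R F v w x))"
      by (simp add: algebra_simps)
    also have "\<dots> \<le> e/2 * h * h + e/2 * h * h"
      using 1 2 norm_triangle_ineq4 by (meson add_mono order_trans)
    finally have "(h * h) * norm (F v w x - F w v x) \<le> (h * h) * e"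
      unfolding norm_scaleR by (simp add: mult.commute mult.left_commute)
    then show ?thesis using h by (simp add: dist_norm)
  qed
  then have "dist (F v w x) (F w v x) \<le> 0" by (rule field_le_epsilon) simp
  then show ?thesis by (simp add: F_def)
qed

section \<open>Alternating forms\<close>

lemma length_delete_nth: "j < length xs \<Longrightarrow> length (delete_nth j xs) = length xs - 1"
  by (auto simp: delete_nth_def)

lemma nth_delete_nth:
  "j < length xs \<Longrightarrow> i < length xs - 1 \<Longrightarrow> delete_nth j xs ! i = (if i < j then xs ! i else xs ! Suc i)"
  by (auto simp: delete_nth_def nth_append)

lemma map_delete_nth: "map f (delete_nth j xs) = delete_nth j (map f xs)"
  by (simp add: delete_nth_def take_map drop_map)

lemma set_delete_nth: "set (delete_nth j xs) \<subseteq> set xs"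
  by (auto simp: delete_nth_def dest: in_set_takeD in_set_dropD)

text \<open>The simplicial identity for face maps.\<close>

lemma delete_nth_delete_nth:
  assumes "j \<le> i" "Suc i < length xs"
  shows "delete_nth i (delete_nth j xs) = delete_nth j (delete_nth (Suc i) xs)"
  using assms by (intro nth_equalityI) (auto simp: length_delete_nth nth_delete_nth)

lemma delete_nth_list_update:
  assumes "i < length xs" "j < length xs"
  shows "delete_nth j (xs[i := x]) = (if i = j then delete_nth j xs
    else (delete_nth j xs)[(if i < j then i else i - 1) := x])"
  using assms by (intro nth_equalityI) (auto simp: length_delete_nth nth_delete_nth nth_list_update)

text \<open>Deleting j and then i is the same as deleting them in the other order, with indices shifted so that
  the sign changes; this involution of the index pairs underlies both \<open>d \<circ> d = 0\<close> and the Leibniz rule.\<close>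

lemma double_delete_sum:
  fixes G :: "'a \<Rightarrow> 'a \<Rightarrow> 'a list \<Rightarrow> 'b::real_vector"
  defines "E \<equiv> \<lambda>G xs. \<Sum>j<length xs. \<Sum>i<length xs - 1.
    (- 1) ^ (i + j) *\<^sub>R G (xs ! j) (delete_nth j xs ! i) (delete_nth i (delete_nth j xs))"
  shows "E G xs = - E (\<lambda>a b. G b a) xs"
proof -
  let ?n = "length xs"
  \<comment> \<open>An index \<open>i < j\<close> keeps its place in the shortened list, and the
    other entry then sits at \<open>j - 1\<close>; an index \<open>i \<ge> j\<close> comes from
    position \<open>Suc i\<close>. In both cases the index sum changes by one, which is the change
    of sign.\<close>
  let ?f = "\<lambda>(j, i). if i < j then (i, j - 1) else (Suc i, j)"
  let ?g = "\<lambda>G (j, i). (- 1) ^ (i + j) *\<^sub>R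
    G (xs ! j) (delete_nth j xs ! i) (delete_nth i (delete_nth j xs))"
  have "(\<Sum>p\<in>{..<?n} \<times> {..<?n - 1}. ?g G p) = (\<Sum>p\<in>{..<?n} \<times> {..<?n - 1}. - ?g (\<lambda>a b. G b a) p)"
  proof (rule sum.reindex_bij_witness[where i = ?f and j = ?f])
    fix p assume p: "p \<in> {..<?n} \<times> {..<?n - 1}"
    obtain j i where ji: "p = (j, i)" "j < ?n" "i < ?n - 1" using p by auto
    show "?f (?f p) = p" "?f p \<in> {..<?n} \<times> {..<?n - 1}" using ji by auto
    show "- ?g (\<lambda>a b. G b a) (?f p) = ?g G p"
    proof (cases "i < j")
      case True
      then obtain l where l: "j = Suc l" by (cases j) auto
      then have "delete_nth i (delete_nth j xs) = delete_nth l (delete_nth i xs)"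
        using delete_nth_delete_nth[of i l xs] ji True by simp
      then show ?thesis using True ji l by (simp add: nth_delete_nth add.commute)
    next
      case False
      then have "delete_nth i (delete_nth j xs) = delete_nth j (delete_nth (Suc i) xs)"
        using delete_nth_delete_nth[of j i xs] ji by simp
      then show ?thesis using False ji by (simp add: nth_delete_nth add.commute)
    qed
    then show "?f (?f p) = p" "?f p \<in> {..<?n} \<times> {..<?n - 1}" using ji by auto
  qed
  then show ?thesis by (simp add: E_def sum.cartesian_product sum_negf split_def)
qed

lemma double_delete_sum_symmetric:
  fixes G :: "'a \<Rightarrow> 'a \<Rightarrow> 'a list \<Rightarrow> 'b::real_vector"
  assumes "\<And>a b ws. G a b ws = G b a ws"
  shows "(\<Sum>j<length xs. \<Sum>i<length xs - 1.
    (- 1) ^ (i + j) *\<^sub>R G (xs ! j) (delete_nth j xs ! i) (delete_nth i (delete_nth j xs))) = 0"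
    (is "?E = 0")
proof -
  have "?E = - (\<Sum>j<length xs. \<Sum>i<length xs - 1.
    (- 1) ^ (i + j) *\<^sub>R G (delete_nth j xs ! i) (xs ! j) (delete_nth i (delete_nth j xs)))"
    by (rule double_delete_sum)
  also have "\<dots> = - ?E"
    by (intro arg_cong[where f = uminus] sum.cong refl arg_cong2[where f = scaleR] assms)
  finally have "?E + ?E = 0" by (simp only: eq_neg_iff_add_eq_0)
  then show ?thesis by (simp only: scaleR_2[symmetric] real_vector.scale_eq_0_iff) simp
qed

section \<open>Permuting the arguments of an alternating form\<close>

lemma alternating_form_linear:
  "alternating_form UNIV k F \<Longrightarrow> length xs = k \<Longrightarrow> i < k \<Longrightarrow>
    F (xs[i := a *\<^sub>R x + b *\<^sub>R y]) = a *\<^sub>R F (xs[i := x]) + b *\<^sub>R F (xs[i := y])"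
  by (simp add: alternating_form_def)

lemma alternating_form_repeated:
  assumes "alternating_form UNIV k F" "length xs = k" "i < j" "j < k" "xs ! i = xs ! j"
  shows "F xs = 0"
proof -
  have "\<forall>xs i j. length xs = k \<and> set xs \<subseteq> UNIV \<and> i < j \<and> j < k \<and> xs ! i = xs ! j \<longrightarrow> F xs = 0"
    using assms(1) unfolding alternating_form_def by (elim conjE)
  then show ?thesis using assms(2-) by (metis subset_UNIV)
qed

lemma alternating_form_length: "alternating_form UNIV k F \<Longrightarrow> length xs \<noteq> k \<Longrightarrow> F xs = 0"
  by (simp add: alternating_form_def)

lemmas alternating_formD = alternating_form_linear alternating_form_repeated alternating_form_length

text \<open>On lists of the wrong length both sides are zero, so the versions with split lists carry
  no length condition.\<close>

lemma alternating_form_add: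
  assumes F: "alternating_form UNIV k F"
  shows "F (p @ (x + y) # r) = F (p @ x # r) + F (p @ y # r)"
proof (cases "length (p @ x # r) = k")
  case True
  then show ?thesis
    using alternating_formD(1)[OF F True, of "length p" 1 x 1 y] by simp
next
  case False
  then show ?thesis using alternating_formD(3)[OF F] by simp
qed

lemma alternating_form_scale:
  assumes F: "alternating_form UNIV k F"
  shows "F (p @ (a *\<^sub>R x) # r) = a *\<^sub>R F (p @ x # r)"
proof (cases "length (p @ x # r) = k")
  case True
  then show ?thesis
    using alternating_formD(1)[OF F True, of "length p" a x 0 x] by simp
next
  case False
  then show ?thesis using alternating_formD(3)[OF F] by simp
qed

lemma alternating_form_same:
  assumes F: "alternating_form UNIV k F"
  shows "F (p @ x # x # r) = 0"
proof (cases "length (p @ x # x # r) = k")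
  case True
  then show ?thesis
    using alternating_formD(2)[OF F True, of "length p" "Suc (length p)"] by (simp add: nth_append)
next
  case False
  then show ?thesis using alternating_formD(3)[OF F] by simp
qed

text \<open>Polarisation at the repeated vector \<open>x + y\<close>.\<close>

lemma alternating_form_swap:
  assumes F: "alternating_form UNIV k F"
  shows "F (p @ x # y # r) = - F (p @ y # x # r)"
proof -
  have "0 = F (p @ (x + y) # (x + y) # r)" by (simp add: alternating_form_same[OF F])
  also have "\<dots> = F (p @ x # (x + y) # r) + F (p @ y # (x + y) # r)"
    by (rule alternating_form_add[OF F])
  also have "\<dots> = F (p @ x # x # r) + F (p @ x # y # r) + (F (p @ y # x # r) + F (p @ y # y # r))"
    using alternating_form_add[OF F, of "p @ [x]"] alternating_form_add[OF F, of "p @ [y]"] by simp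
  finally show ?thesis by (simp add: alternating_form_same[OF F] eq_neg_iff_add_eq_0)
qed

lemma alternating_form_move:
  assumes F: "alternating_form UNIV k F"
  shows "F (p @ x # r) = (- 1) ^ length p *\<^sub>R F (x # p @ r)"
proof (induction p arbitrary: r rule: rev_induct)
  case (snoc y p)
  have "F ((p @ [y]) @ x # r) = - F (p @ x # y # r)"
    using alternating_form_swap[OF F, of p y x r] by simp
  then show ?case using snoc[of "y # r"] by simp
qed simp

lemma alternating_form_move_nth:
  assumes "alternating_form UNIV k F" "i < length xs"
  shows "F xs = (- 1) ^ i *\<^sub>R F (xs ! i # delete_nth i xs)"
proof -
  have "xs = take i xs @ xs ! i # drop (Suc i) xs" using assms(2) by (rule id_take_nth_drop)
  then have "F xs = F (take i xs @ xs ! i # drop (Suc i) xs)" by simp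
  also have "\<dots> = (- 1) ^ i *\<^sub>R F (xs ! i # delete_nth i xs)"
    using alternating_form_move[OF assms(1)] assms(2) by (simp add: delete_nth_def)
  finally show ?thesis .
qed

lemma alternating_form_Cons:
  fixes F :: "'a::real_vector list \<Rightarrow> 'b::real_vector"
  assumes F: "alternating_form UNIV (Suc k) F"
  shows "alternating_form UNIV k (\<lambda>xs. F (x # xs))"
  unfolding alternating_form_def
proof (intro conjI allI impI)
  fix xs :: "'a list" and i and x' y :: 'a and a b
  assume "length xs = k \<and> set xs \<subseteq> UNIV \<and> i < k \<and> x' \<in> UNIV \<and> y \<in> UNIV"
  then show "F (x # xs[i := a *\<^sub>R x' + b *\<^sub>R y]) = a *\<^sub>R F (x # xs[i := x']) + b *\<^sub>R F (x # xs[i := y])"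
    using alternating_formD(1)[OF F, of "x # xs" "Suc i" a x' b y] by simp
next
  fix xs :: "'a list" and i j
  assume "length xs = k \<and> set xs \<subseteq> UNIV \<and> i < j \<and> j < k \<and> xs ! i = xs ! j"
  then show "F (x # xs) = 0"
    using alternating_formD(2)[OF F, of "x # xs" "Suc i" "Suc j"] by simp
qed (use alternating_formD(3)[OF F] in auto)

lemma linear_alternating_form_Cons:
  assumes F: "alternating_form UNIV k F"
  shows "linear (\<lambda>x. F (x # xs))"
  using alternating_form_add[OF F, of "[]"] alternating_form_scale[OF F, of "[]"]
  by (intro linearI) auto

text \<open>Forms on \<open>S\<close> must vanish on lists that leave \<open>S\<close>, which forces
  the case distinction. Linearity is asked on \<open>S\<close> only, as needed when \<open>L\<close>
  takes a component of a tangent vector.\<close>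

lemma alternating_form_pullback:
  fixes F :: "'a::real_vector list \<Rightarrow> 'b::real_vector"
  assumes F: "alternating_form UNIV k F" and S: "subspace S"
    and L: "\<And>x y a b. x \<in> S \<Longrightarrow> y \<in> S \<Longrightarrow> L (a *\<^sub>R x + b *\<^sub>R y) = a *\<^sub>R L x + b *\<^sub>R L y"
  shows "alternating_form S k (\<lambda>xs. if set xs \<subseteq> S then F (map L xs) else 0)"
  unfolding alternating_form_def
proof (intro conjI allI impI)
  fix xs i x y a b
  assume *: "length xs = k \<and> set xs \<subseteq> S \<and> i < k \<and> x \<in> S \<and> y \<in> S"
  then have "set (xs[i := z]) \<subseteq> S" if "z \<in> S" for z using that set_update_subset_insert[of xs i z] by auto
  moreover have "a *\<^sub>R x + b *\<^sub>R y \<in> S" using * S by (simp add: subspace_add subspace_scale)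
  ultimately show "(if set (xs[i := a *\<^sub>R x + b *\<^sub>R y]) \<subseteq> S then F (map L (xs[i := a *\<^sub>R x + b *\<^sub>R y])) else 0) =
    a *\<^sub>R (if set (xs[i := x]) \<subseteq> S then F (map L (xs[i := x])) else 0) +
    b *\<^sub>R (if set (xs[i := y]) \<subseteq> S then F (map L (xs[i := y])) else 0)"
    using * alternating_formD(1)[OF F, of "map L xs" i a "L x" b "L y"] L by (simp add: map_update)
next
  fix xs i j
  assume "length xs = k \<and> set xs \<subseteq> S \<and> i < j \<and> j < k \<and> xs ! i = xs ! j"
  then show "(if set xs \<subseteq> S then F (map L xs) else 0) = 0"
    using alternating_formD(2)[OF F, of "map L xs" i j] by simp
qed (use alternating_formD(3)[OF F] in auto)

lemma alternating_form_compose: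
  assumes F: "alternating_form UNIV k F" and L: "linear L"
  shows "alternating_form UNIV k (\<lambda>xs. F (map L xs))"
  using alternating_form_pullback[OF F subspace_UNIV, of L] L
  by (simp add: linear_add linear_scale)

lemma alternating_form_apply:
  fixes F :: "'a::real_vector list \<Rightarrow> 'b::real_vector"
  assumes F: "alternating_form S k F" and L: "linear L"
  shows "alternating_form S k (\<lambda>xs. L (F xs))"
  using F L unfolding alternating_form_def by (simp add: linear_add linear_scale linear_0)

lemma alternating_form_0: "alternating_form S k (\<lambda>_. 0)"
  by (simp add: alternating_form_def)

text \<open>Antisymmetrisation over the first slot. With \<open>B v\<close> a derivative in
  direction \<open>v\<close> it yields the exterior derivative, with \<open>B v\<close> a linear
  form at \<open>v\<close> times a form it yields the exterior product.\<close>

lemma alternating_sum_alternating: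
  fixes B :: "'a::real_vector \<Rightarrow> 'a list \<Rightarrow> 'b::real_vector"
  assumes B: "\<And>v. alternating_form UNIV k (B v)" and lin: "\<And>ws. linear (\<lambda>v. B v ws)"
  shows "alternating_form UNIV (Suc k) (\<lambda>xs. \<Sum>j<length xs. (- 1) ^ j *\<^sub>R B (xs ! j) (delete_nth j xs))"
  unfolding alternating_form_def
proof (intro conjI allI impI)
  fix xs :: "'a list" and i and x y :: 'a and a b
  assume "length xs = Suc k \<and> set xs \<subseteq> UNIV \<and> i < Suc k \<and> x \<in> UNIV \<and> y \<in> UNIV"
  then have xs: "length xs = Suc k" "i < Suc k" by auto
  have "B (xs[i := a *\<^sub>R x + b *\<^sub>R y] ! j) (delete_nth j (xs[i := a *\<^sub>R x + b *\<^sub>R y])) =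
    a *\<^sub>R B (xs[i := x] ! j) (delete_nth j (xs[i := x])) +
    b *\<^sub>R B (xs[i := y] ! j) (delete_nth j (xs[i := y]))" if "j < Suc k" for j
  proof (cases "i = j")
    case True
    then show ?thesis using xs
      by (simp add: delete_nth_list_update linear_add[OF lin] linear_scale[OF lin])
  next
    case False
    then show ?thesis using xs that
      by (simp add: delete_nth_list_update) (auto intro!: alternating_formD(1)[OF B] simp: length_delete_nth)
  qed
  then show "(\<Sum>j<length (xs[i := a *\<^sub>R x + b *\<^sub>R y]). (- 1) ^ j *\<^sub>R
        B (xs[i := a *\<^sub>R x + b *\<^sub>R y] ! j) (delete_nth j (xs[i := a *\<^sub>R x + b *\<^sub>R y]))) =
      a *\<^sub>R (\<Sum>j<length (xs[i := x]). (- 1) ^ j *\<^sub>R B (xs[i := x] ! j) (delete_nth j (xs[i := x]))) +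
      b *\<^sub>R (\<Sum>j<length (xs[i := y]). (- 1) ^ j *\<^sub>R B (xs[i := y] ! j) (delete_nth j (xs[i := y])))"
    using xs by (simp add: scaleR_sum_right sum.distrib[symmetric] algebra_simps del: sum.lessThan_Suc)
next
  fix xs :: "'a list" and i j
  assume "length xs = Suc k \<and> set xs \<subseteq> UNIV \<and> i < j \<and> j < Suc k \<and> xs ! i = xs ! j"
  then have xs: "length xs = Suc k" "i < j" "j < Suc k" "xs ! i = xs ! j" by auto
  \<comment> \<open>Once entry \<open>i\<close> is removed, the second copy of the repeated vector
    sits at \<open>m = j - 1\<close>. Moving the remaining copy to the front in the terms
    \<open>i\<close> and \<open>j\<close> gives signs with exponents \<open>i + m\<close> and
    \<open>Suc (i + m)\<close> and the same remaining list, so these terms cancel. All other terms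
    still contain the repetition.\<close>
  obtain m where m: "j = Suc m" using xs(2) by (cases j) auto
  let ?t = "\<lambda>l. (- 1) ^ l *\<^sub>R B (xs ! l) (delete_nth l xs)"
  have z: "?t l = 0" if "l < Suc k" "l \<noteq> i" "l \<noteq> j" for l
  proof -
    let ?s = "\<lambda>m. if m < l then m else m - 1"
    have "delete_nth l xs ! ?s i = delete_nth l xs ! ?s j"
      using that xs by (auto simp: nth_delete_nth)
    then have "B (xs ! l) (delete_nth l xs) = 0"
      using that xs by (intro alternating_formD(2)[OF B, of _ "?s i" "?s j"]) (auto simp: length_delete_nth)
    then show ?thesis by simp
  qed
  have "(\<Sum>l<Suc k. ?t l) = (\<Sum>l\<in>{i, j}. ?t l)"
    using xs z by (intro sum.mono_neutral_right) auto
  also have "\<dots> = ?t i + ?t j" using xs by simp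
  also have "?t i = (- 1) ^ (i + m) *\<^sub>R B (xs ! i) (xs ! j # delete_nth m (delete_nth i xs))"
    using alternating_form_move_nth[OF B, of m "delete_nth i xs"] xs m
    by (simp add: length_delete_nth nth_delete_nth power_add)
  also have "?t j = (- 1) ^ (j + i) *\<^sub>R B (xs ! j) (xs ! i # delete_nth i (delete_nth j xs))"
    using alternating_form_move_nth[OF B, of i "delete_nth j xs"] xs
    by (simp add: length_delete_nth nth_delete_nth power_add)
  also have "delete_nth i (delete_nth j xs) = delete_nth m (delete_nth i xs)"
    using delete_nth_delete_nth[of i m xs] xs m by simp
  also have "j + i = Suc (i + m)" using m by simp
  finally show "(\<Sum>l<length xs. ?t l) = 0" using xs by simp
next
  fix xs :: "'a list"
  assume "length xs \<noteq> Suc k \<or> \<not> set xs \<subseteq> UNIV"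
  then have "B (xs ! j) (delete_nth j xs) = 0" if "j < length xs" for j
    using that by (intro alternating_formD(3)[OF B]) (simp add: length_delete_nth)
  then show "(\<Sum>j<length xs. (- 1) ^ j *\<^sub>R B (xs ! j) (delete_nth j xs)) = 0" by simp
qed

text \<open>The form \<open>dx\<^sup>i\<^sup>1 \<and> \<dots> \<and> dx\<^sup>i\<^sup>k\<close>, so that every alternating form is \<open>1 / k!\<close> times the sum of
  \<open>F I\<close> times \<open>basis_form I\<close> over all (not necessarily increasing) multi-indices I.\<close>

primrec basis_form :: "'a::real_inner list \<Rightarrow> 'a list \<Rightarrow> real"
  where
    "basis_form [] = (\<lambda>vs. if vs = [] then 1 else 0)"
  | "basis_form (i # I) = (\<lambda>vs. \<Sum>j<length vs. (- 1) ^ j *\<^sub>R ((vs ! j \<bullet> i) * basis_form I (delete_nth j vs)))"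

lemma alternating_form_basis_form: "alternating_form UNIV (length I) (basis_form I)"
proof (induction I)
  case Nil
  then show ?case by (auto simp: alternating_form_def)
next
  case (Cons i I)
  have "alternating_form UNIV (length I) (\<lambda>ws. (v \<bullet> i) * basis_form I ws)" for v
    using alternating_form_apply[OF Cons, of "\<lambda>r. (v \<bullet> i) * r"] by (simp add: linear_times)
  moreover have "linear (\<lambda>v. (v \<bullet> i) * basis_form I ws)" for ws
    by (intro linearI) (auto simp: inner_add_left algebra_simps)
  ultimately show ?case
    using alternating_sum_alternating[of "length I" "\<lambda>v ws. (v \<bullet> i) * basis_form I ws"] by simp
qed

text \<open>The first index is peeled off: summing over it puts \<open>vs ! j\<close> in front, and
  moving this vector back to place \<open>j\<close> cancels the sign. Each of the
  \<open>Suc k\<close> summands then equals \<open>F vs\<close>, which is how the factorial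
  grows.\<close>

lemma alternating_form_expand:
  fixes F :: "'a::euclidean_space list \<Rightarrow> 'b::real_vector"
  assumes "alternating_form UNIV k F"
  shows "(\<Sum>I | set I \<subseteq> Basis \<and> length I = k. basis_form I vs *\<^sub>R F I) = fact k *\<^sub>R F vs"
  using assms
proof (induction k arbitrary: F vs)
  case 0
  have "{I. set I \<subseteq> Basis \<and> length I = 0} = {[] :: 'a list}" by auto
  then show ?case using alternating_formD(3)[OF 0, of vs] by simp
next
  case (Suc k)
  let ?A = "{I :: 'a list. set I \<subseteq> Basis \<and> length I = k}"
  have fin: "finite ?A" by (rule finite_lists_length_eq) simp
  show ?case
  proof (cases "length vs = Suc k")
    case len: True
    have "(\<Sum>I | set I \<subseteq> Basis \<and> length I = Suc k. basis_form I vs *\<^sub>R F I) =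
        (\<Sum>(I, i)\<in>?A \<times> Basis. basis_form (i # I) vs *\<^sub>R F (i # I))"
      unfolding lists_length_Suc_eq by (subst sum.reindex) (auto simp: inj_on_def o_def split_def)
    also have "\<dots> = (\<Sum>i\<in>Basis. \<Sum>I\<in>?A. \<Sum>j<Suc k.
        ((- 1) ^ j * (vs ! j \<bullet> i) * basis_form I (delete_nth j vs)) *\<^sub>R F (i # I))"
      using len by (subst sum.swap, subst sum.cartesian_product)
        (simp add: scaleR_sum_left mult.assoc del: sum.lessThan_Suc)
    also have "\<dots> = (\<Sum>i\<in>Basis. \<Sum>j<Suc k. \<Sum>I\<in>?A.
        ((- 1) ^ j * (vs ! j \<bullet> i) * basis_form I (delete_nth j vs)) *\<^sub>R F (i # I))"
      by (intro sum.cong refl sum.swap)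
    also have "\<dots> = (\<Sum>i\<in>Basis. \<Sum>j<Suc k. ((- 1) ^ j * (vs ! j \<bullet> i)) *\<^sub>R
        (\<Sum>I\<in>?A. basis_form I (delete_nth j vs) *\<^sub>R F (i # I)))"
      by (simp add: scaleR_sum_right del: sum.lessThan_Suc)
    also have "\<dots> = (\<Sum>i\<in>Basis. \<Sum>j<Suc k. ((- 1) ^ j * (vs ! j \<bullet> i)) *\<^sub>R
        (fact k *\<^sub>R F (i # delete_nth j vs)))"
      using Suc.IH[OF alternating_form_Cons[OF Suc.prems]] by simp
    also have "\<dots> = fact k *\<^sub>R (\<Sum>j<Suc k. (- 1) ^ j *\<^sub>R
        (\<Sum>i\<in>Basis. (vs ! j \<bullet> i) *\<^sub>R F (i # delete_nth j vs)))"
      by (subst sum.swap) (simp add: scaleR_sum_right mult.commute mult.left_commute del: sum.lessThan_Suc)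
    also have "\<dots> = fact k *\<^sub>R (\<Sum>j<Suc k. (- 1) ^ j *\<^sub>R F (vs ! j # delete_nth j vs))"
      using linear_expand[OF linear_alternating_form_Cons[OF Suc.prems]] by metis
    also have "(\<Sum>j<Suc k. (- 1) ^ j *\<^sub>R F (vs ! j # delete_nth j vs)) = (\<Sum>j<Suc k. F vs)"
      using len by (intro sum.cong refl, subst alternating_form_move_nth[OF Suc.prems, of _ vs]) auto
    also have "fact k *\<^sub>R \<dots> = fact (Suc k) *\<^sub>R F vs"
      by (simp add: sum_constant_scaleR algebra_simps del: sum.lessThan_Suc)
    finally show ?thesis .
  next
    case False
    then show ?thesis
      using alternating_formD(3)[OF Suc.prems, of vs] alternating_formD(3)[OF alternating_form_basis_form, of vs]
      by (auto intro!: sum.neutral)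
  qed
qed

section \<open>The exterior derivative of vector-valued forms\<close>

text \<open>\<open>frechet_derivative\<close> is a choice among the derivatives at \<open>x\<close>,
  and both functions have the same ones; so the equality holds even at points where there is
  none.\<close>

lemma frechet_derivative_cong_open:
  assumes "open S" "x \<in> S" "\<And>z. z \<in> S \<Longrightarrow> f z = g z"
  shows "frechet_derivative f (at x) = frechet_derivative g (at x)"
proof -
  have "(f has_derivative f') (at x) \<longleftrightarrow> (g has_derivative f') (at x)" for f'
    using has_derivative_transform_within_open[OF _ assms(1,2), of f f' UNIV g]
      has_derivative_transform_within_open[OF _ assms(1,2), of g f' UNIV f] assms(3) by auto
  then show ?thesis by (simp add: frechet_derivative_def)
qed

lemma frechet_derivative_eq:
  "(f has_derivative f') (at x) \<Longrightarrow> frechet_derivative f (at x) v = f' v"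
  using frechet_derivative_at by metis

lemma frechet_derivative_sum_scaleR:
  assumes "\<And>i. i \<in> I \<Longrightarrow> f i differentiable (at y)"
  shows "frechet_derivative (\<lambda>z. \<Sum>i\<in>I. c i *\<^sub>R f i z) (at y) v =
    (\<Sum>i\<in>I. c i *\<^sub>R frechet_derivative (f i) (at y) v)"
  using assms
  by (intro frechet_derivative_eq has_derivative_sum has_derivative_scaleR_right
      iffD1[OF frechet_derivative_works])

lemma frechet_derivative_scaleR:
  assumes "f differentiable (at y)" "g differentiable (at y)"
  shows "frechet_derivative (\<lambda>z. f z *\<^sub>R g z) (at y) v =
    f y *\<^sub>R frechet_derivative g (at y) v + frechet_derivative f (at y) v *\<^sub>R g y"
  using assms
  by (intro frechet_derivative_eq has_derivative_scaleR iffD1[OF frechet_derivative_works])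

lemma frechet_derivative_bounded_linear:
  assumes "bounded_linear L" "f differentiable (at y)"
  shows "frechet_derivative (\<lambda>z. L (f z)) (at y) v = L (frechet_derivative f (at y) v)"
  by (rule frechet_derivative_eq[OF bounded_linear.has_derivative[OF assms(1)
      iffD1[OF frechet_derivative_works assms(2)]]])

lemma frechet_derivative_compose:
  assumes "f differentiable (at y)" "g differentiable (at (f y))"
  shows "frechet_derivative (\<lambda>z. g (f z)) (at y) v =
    frechet_derivative g (at (f y)) (frechet_derivative f (at y) v)"
proof -
  have "(g \<circ> f has_derivative frechet_derivative g (at (f y)) \<circ> frechet_derivative f (at y)) (at y)"
    using assms by (intro diff_chain_at iffD1[OF frechet_derivative_works])
  from frechet_derivative_eq[OF this] show ?thesis by (simp add: o_def)
qed

text \<open>The alternating identities hold at all points near \<open>y\<close> and are linear in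
  the values, so they survive differentiation.\<close>

lemma alternating_form_frechet_derivative:
  fixes \<Phi> :: "'z::euclidean_space \<Rightarrow> 'a::real_vector list \<Rightarrow> 'b::real_normed_vector"
  assumes S: "open S" "y \<in> S"
    and alt: "\<And>z. z \<in> S \<Longrightarrow> alternating_form UNIV k (\<Phi> z)"
    and sm: "\<And>ws. smooth_on S (\<lambda>z. \<Phi> z ws)"
  shows "alternating_form UNIV k (\<lambda>ws. frechet_derivative (\<lambda>z. \<Phi> z ws) (at y) v)"
proof -
  have d: "((\<lambda>z. \<Phi> z ws) has_derivative frechet_derivative (\<lambda>z. \<Phi> z ws) (at y)) (at y)" for ws
    using smooth_on_has_derivative[OF sm S(2)] .
  have z: "frechet_derivative (\<lambda>z. \<Phi> z ws) (at y) v = 0" if "\<And>z. z \<in> S \<Longrightarrow> \<Phi> z ws = 0" for ws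
    using frechet_derivative_cong_open[OF S that] by simp
  show ?thesis
    unfolding alternating_form_def
  proof (intro conjI allI impI)
    fix xs :: "'a list" and i and x x' :: 'a and a b
    assume *: "length xs = k \<and> set xs \<subseteq> UNIV \<and> i < k \<and> x \<in> UNIV \<and> x' \<in> UNIV"
    have "frechet_derivative (\<lambda>z. \<Phi> z (xs[i := a *\<^sub>R x + b *\<^sub>R x'])) (at y) v =
        frechet_derivative (\<lambda>z. a *\<^sub>R \<Phi> z (xs[i := x]) + b *\<^sub>R \<Phi> z (xs[i := x'])) (at y) v"
      using * alternating_form_linear[OF alt]
      by (subst frechet_derivative_cong_open[OF S]) auto
    also have "\<dots> = a *\<^sub>R frechet_derivative (\<lambda>z. \<Phi> z (xs[i := x])) (at y) v +
        b *\<^sub>R frechet_derivative (\<lambda>z. \<Phi> z (xs[i := x'])) (at y) v"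
      by (intro frechet_derivative_eq has_derivative_add has_derivative_scaleR_right d)
    finally show "frechet_derivative (\<lambda>z. \<Phi> z (xs[i := a *\<^sub>R x + b *\<^sub>R x'])) (at y) v =
        a *\<^sub>R frechet_derivative (\<lambda>z. \<Phi> z (xs[i := x])) (at y) v +
        b *\<^sub>R frechet_derivative (\<lambda>z. \<Phi> z (xs[i := x'])) (at y) v" .
  next
    fix xs :: "'a list" and i j
    assume "length xs = k \<and> set xs \<subseteq> UNIV \<and> i < j \<and> j < k \<and> xs ! i = xs ! j"
    then show "frechet_derivative (\<lambda>z. \<Phi> z xs) (at y) v = 0"
      using alternating_form_repeated[OF alt, of _ xs i j] by (intro z) simp
  next
    fix xs :: "'a list"
    assume "length xs \<noteq> k \<or> \<not> set xs \<subseteq> UNIV"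
    then show "frechet_derivative (\<lambda>z. \<Phi> z xs) (at y) v = 0"
      using alternating_form_length[OF alt, of _ xs] by (intro z) simp
  qed
qed

text \<open>The invariant formula for the exterior derivative on constant vector fields, whose Lie
  brackets vanish.\<close>

definition extd :: "('a::euclidean_space \<Rightarrow> 'a list \<Rightarrow> 'b::real_normed_vector) \<Rightarrow> 'a \<Rightarrow> 'a list \<Rightarrow> 'b"
  where "extd \<Phi> y vs = (\<Sum>j<length vs. (- 1) ^ j *\<^sub>R
    frechet_derivative (\<lambda>z. \<Phi> z (delete_nth j vs)) (at y) (vs ! j))"

lemma extd_cong:
  assumes "open S" "y \<in> S" "\<And>z ws. z \<in> S \<Longrightarrow> \<Phi> z ws = \<Psi> z ws"
  shows "extd \<Phi> y vs = extd \<Psi> y vs"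
  unfolding extd_def
  by (intro sum.cong refl arg_cong2[where f = scaleR] fun_cong[OF frechet_derivative_cong_open[OF assms(1,2)]]
      assms(3))

lemma smooth_on_extd:
  assumes "open S" "\<And>ws. smooth_on S (\<lambda>z. \<Phi> z ws)"
  shows "smooth_on S (\<lambda>z. extd \<Phi> z vs)"
  unfolding extd_def using assms
  by (intro smooth_on_sum smooth_on_bounded_linear[OF bounded_linear_scaleR_right] smooth_on_frechet_derivative)

lemma alternating_form_extd:
  assumes "open S" "y \<in> S" "\<And>z. z \<in> S \<Longrightarrow> alternating_form UNIV k (\<Phi> z)"
    "\<And>ws. smooth_on S (\<lambda>z. \<Phi> z ws)"
  shows "alternating_form UNIV (Suc k) (extd \<Phi> y)"
  unfolding extd_def[abs_def]
  by (rule alternating_sum_alternating[OF alternating_form_frechet_derivative[OF assms]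
      linear_frechet_derivative[OF smooth_on_differentiable[OF assms(4) assms(2)]]])

lemma extd_bounded_linear:
  assumes L: "bounded_linear L" and "\<And>ws. (\<lambda>z. \<Phi> z ws) differentiable (at y)"
  shows "extd (\<lambda>z ws. L (\<Phi> z ws)) y vs = L (extd \<Phi> y vs)"
  by (simp add: extd_def frechet_derivative_bounded_linear[OF assms] linear_sum[OF bounded_linear.linear[OF L]]
      linear_scale[OF bounded_linear.linear[OF L]])

lemma extd_extd:
  assumes S: "open S" "y \<in> S" and sm: "\<And>ws. smooth_on S (\<lambda>z. \<Phi> z ws)"
  shows "extd (extd \<Phi>) y vs = 0"
proof -
  define G where "G = (\<lambda>a b ws. frechet_derivative (\<lambda>z. frechet_derivative (\<lambda>u. \<Phi> u ws) (at z) b) (at y) a)"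
  have G: "G a b ws = G b a ws" for a b ws
    unfolding G_def by (rule second_derivative_symmetric[OF S sm])
  have "frechet_derivative (\<lambda>z. extd \<Phi> z ws) (at y) v =
      (\<Sum>i<length ws. (- 1) ^ i *\<^sub>R G v (ws ! i) (delete_nth i ws))" for ws v
    unfolding extd_def G_def
    by (intro frechet_derivative_sum_scaleR smooth_on_differentiable[OF smooth_on_frechet_derivative[OF sm] S(2)])
  then have "extd (extd \<Phi>) y vs = (\<Sum>j<length vs. \<Sum>i<length vs - 1.
      (- 1) ^ (i + j) *\<^sub>R G (vs ! j) (delete_nth j vs ! i) (delete_nth i (delete_nth j vs)))"
    unfolding extd_def[of "extd \<Phi>"]
    by (simp add: length_delete_nth scaleR_sum_right power_add mult.commute)
  also have "\<dots> = 0" by (rule double_delete_sum_symmetric[where G = G, OF G])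
  finally show ?thesis .
qed

text \<open>The rule d(du \<and> \<alpha>) = - du \<and> d\<alpha>. The product rule gives two
  double sums: second derivatives of \<open>u\<close> are symmetric, so \<open>H\<close> drops out,
  while in \<open>G\<close> exchanging the two removed vectors produces the minus sign.\<close>

lemma extd_wedge:
  assumes S: "open S" "y \<in> S" and u: "smooth_on S u" and sm: "\<And>ws. smooth_on S (\<lambda>z. \<alpha> z ws)"
  shows "extd (\<lambda>z ws. \<Sum>i<length ws. (- 1) ^ i *\<^sub>R
      (frechet_derivative u (at z) (ws ! i) *\<^sub>R \<alpha> z (delete_nth i ws))) y vs =
    - (\<Sum>i<length vs. (- 1) ^ i *\<^sub>R (frechet_derivative u (at y) (vs ! i) *\<^sub>R extd \<alpha> y (delete_nth i vs)))"
proof -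
  define G where "G = (\<lambda>a b ws. frechet_derivative u (at y) b *\<^sub>R frechet_derivative (\<lambda>z. \<alpha> z ws) (at y) a)"
  define H where "H = (\<lambda>a b ws. frechet_derivative (\<lambda>z. frechet_derivative u (at z) b) (at y) a *\<^sub>R \<alpha> y ws)"
  have H: "H a b ws = H b a ws" for a b ws
    unfolding H_def using second_derivative_symmetric[OF S u] by simp
  define W where "W = (\<lambda>z ws. \<Sum>i<length ws. (- 1) ^ i *\<^sub>R
      (frechet_derivative u (at z) (ws ! i) *\<^sub>R \<alpha> z (delete_nth i ws)))"
  have du: "(\<lambda>z. frechet_derivative u (at z) b) differentiable (at y)" for b
    using smooth_on_differentiable[OF smooth_on_frechet_derivative[OF u] S(2)] .
  have da: "(\<lambda>z. \<alpha> z ws) differentiable (at y)" for ws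
    using smooth_on_differentiable[OF sm S(2)] .
  have "frechet_derivative (\<lambda>z. W z ws) (at y) v =
      (\<Sum>i<length ws. (- 1) ^ i *\<^sub>R (G v (ws ! i) (delete_nth i ws) + H v (ws ! i) (delete_nth i ws)))" for ws v
    unfolding G_def H_def W_def
    by (subst frechet_derivative_sum_scaleR)
      (auto intro!: differentiable_scaleR du da simp: frechet_derivative_scaleR[OF du da])
  then have "extd W y vs = (\<Sum>j<length vs. \<Sum>i<length vs - 1.
      (- 1) ^ (i + j) *\<^sub>R G (vs ! j) (delete_nth j vs ! i) (delete_nth i (delete_nth j vs))) +
    (\<Sum>j<length vs. \<Sum>i<length vs - 1.
      (- 1) ^ (i + j) *\<^sub>R H (vs ! j) (delete_nth j vs ! i) (delete_nth i (delete_nth j vs)))"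
    unfolding extd_def
    by (simp add: length_delete_nth scaleR_sum_right scaleR_add_right power_add mult.commute sum.distrib)
  also have "\<dots> = - (\<Sum>j<length vs. \<Sum>i<length vs - 1.
      (- 1) ^ (i + j) *\<^sub>R G (delete_nth j vs ! i) (vs ! j) (delete_nth i (delete_nth j vs)))"
    unfolding double_delete_sum_symmetric[where G = H, OF H] by (subst double_delete_sum) simp
  also have "\<dots> = - (\<Sum>j<length vs. (- 1) ^ j *\<^sub>R
      (frechet_derivative u (at y) (vs ! j) *\<^sub>R extd \<alpha> y (delete_nth j vs)))"
    unfolding extd_def G_def
    by (simp add: length_delete_nth scaleR_sum_right power_add mult.commute mult.left_commute)
  finally show ?thesis unfolding W_def .
qed

lemma smooth_on_basis_form_pullback:
  fixes \<phi> :: "'a::euclidean_space \<Rightarrow> 'b::euclidean_space"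
  assumes "open S" "smooth_on S \<phi>"
  shows "smooth_on S (\<lambda>z. basis_form I (map (frechet_derivative \<phi> (at z)) vs))"
proof (induction I arbitrary: vs)
  case Nil
  then show ?case by (simp add: smooth_on_const)
next
  case (Cons i I)
  have "smooth_on S (\<lambda>z. \<Sum>j<length vs. (- 1) ^ j *\<^sub>R ((frechet_derivative \<phi> (at z) (vs ! j) \<bullet> i) *
      basis_form I (map (frechet_derivative \<phi> (at z)) (delete_nth j vs))))"
    using assms Cons
    by (intro smooth_on_sum smooth_on_bounded_linear[OF bounded_linear_scaleR_right] smooth_on_mult
        smooth_on_bounded_linear[OF bounded_linear_inner_left] smooth_on_frechet_derivative)
  then show ?case by (simp add: map_delete_nth)
qed

text \<open>The pulled back form is the exterior product of the differentials of components of
  \<open>\<phi>\<close>. Closedness passes from \<open>I\<close> to \<open>i # I\<close> by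
  \<open>extd_wedge\<close> with \<open>u\<close> the component along \<open>i\<close>.\<close>

lemma extd_basis_form_pullback:
  fixes \<phi> :: "'a::euclidean_space \<Rightarrow> 'b::euclidean_space"
  assumes S: "open S" "y \<in> S" and \<phi>: "smooth_on S \<phi>"
  shows "extd (\<lambda>z ws. basis_form I (map (frechet_derivative \<phi> (at z)) ws)) y vs = 0"
proof (induction I arbitrary: vs)
  case Nil
  then show ?case by (simp add: extd_def)
next
  case (Cons i I)
  let ?u = "\<lambda>z. \<phi> z \<bullet> i"
  have u: "smooth_on S ?u" by (intro smooth_on_bounded_linear[OF bounded_linear_inner_left] S \<phi>)
  have "frechet_derivative ?u (at z) v = frechet_derivative \<phi> (at z) v \<bullet> i" if "z \<in> S" for z v
    using frechet_derivative_bounded_linear[OF bounded_linear_inner_left smooth_on_differentiable[OF \<phi> that]] .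
  then have "extd (\<lambda>z ws. basis_form (i # I) (map (frechet_derivative \<phi> (at z)) ws)) y vs =
    extd (\<lambda>z ws. \<Sum>j<length ws. (- 1) ^ j *\<^sub>R (frechet_derivative ?u (at z) (ws ! j) *\<^sub>R
      basis_form I (map (frechet_derivative \<phi> (at z)) (delete_nth j ws)))) y vs"
    by (intro extd_cong[OF S]) (simp add: map_delete_nth)
  also have "\<dots> = 0"
    by (subst extd_wedge[OF S u smooth_on_basis_form_pullback[OF S(1) \<phi>]]) (simp add: Cons)
  finally show ?case .
qed

text \<open>The expansion in basis forms reduces naturality to the case of functions.\<close>

lemma extd_pullback:
  fixes \<phi> :: "'a::euclidean_space \<Rightarrow> 'b::euclidean_space"
  assumes S: "open S" "y \<in> S" and T: "open T" "\<phi> ` S \<subseteq> T" and \<phi>: "smooth_on S \<phi>"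
    and alt: "\<And>z. z \<in> T \<Longrightarrow> alternating_form UNIV k (\<Phi> z)"
    and sm: "\<And>ws. smooth_on T (\<lambda>z. \<Phi> z ws)"
  shows "extd (\<lambda>z ws. \<Phi> (\<phi> z) (map (frechet_derivative \<phi> (at z)) ws)) y vs =
    extd \<Phi> (\<phi> y) (map (frechet_derivative \<phi> (at y)) vs)"
proof -
  let ?A = "{I :: 'b list. set I \<subseteq> Basis \<and> length I = k}"
  define c :: real where "c = 1 / fact k"
  define P where "P = (\<lambda>I z ws. basis_form I (map (frechet_derivative \<phi> (at z)) ws))"
  define B where "B = (\<lambda>v ws. frechet_derivative (\<lambda>z. \<Phi> z ws) (at (\<phi> y)) v)"
  let ?d = "frechet_derivative \<phi> (at y)"
  have fy: "\<phi> y \<in> T" using S T by auto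
  have expand: "F ws = (\<Sum>I\<in>?A. c *\<^sub>R (basis_form I ws *\<^sub>R F I))"
    if "alternating_form UNIV k F" for F :: "'b list \<Rightarrow> 'c" and ws
  proof -
    have "F ws = c *\<^sub>R (fact k *\<^sub>R F ws)" by (simp add: c_def)
    also have "\<dots> = c *\<^sub>R (\<Sum>I\<in>?A. basis_form I ws *\<^sub>R F I)"
      by (simp only: alternating_form_expand[OF that])
    finally show ?thesis by (simp only: scaleR_sum_right)
  qed
  have altB: "alternating_form UNIV k (B v)" for v
    unfolding B_def by (rule alternating_form_frechet_derivative[OF T(1) fy alt sm])
  have dP: "(\<lambda>z. P I z ws) differentiable (at y)" for I ws
    unfolding P_def by (rule smooth_on_differentiable[OF smooth_on_basis_form_pullback[OF S(1) \<phi>] S(2)])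
  have dphi: "\<phi> differentiable (at y)" by (rule smooth_on_differentiable[OF \<phi> S(2)])
  have dPhi: "(\<lambda>z. \<Phi> z ws) differentiable (at (\<phi> y))" for ws
    by (rule smooth_on_differentiable[OF sm fy])
  have dg: "(\<lambda>z. \<Phi> (\<phi> z) I) differentiable (at y)" for I
    using differentiable_chain_at[OF dphi dPhi[of I]] by (simp add: o_def)
  have "extd (\<lambda>z ws. \<Phi> (\<phi> z) (map (frechet_derivative \<phi> (at z)) ws)) y vs =
      extd (\<lambda>z ws. \<Sum>I\<in>?A. c *\<^sub>R (P I z ws *\<^sub>R \<Phi> (\<phi> z) I)) y vs"
    unfolding P_def using T by (intro extd_cong[OF S] expand alt) auto
  also have "\<dots> = (\<Sum>j<length vs. (- 1) ^ j *\<^sub>R (\<Sum>I\<in>?A. c *\<^sub>R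
      (P I y (delete_nth j vs) *\<^sub>R B (?d (vs ! j)) I +
       frechet_derivative (\<lambda>z. P I z (delete_nth j vs)) (at y) (vs ! j) *\<^sub>R \<Phi> (\<phi> y) I)))"
    unfolding extd_def B_def
    by (subst frechet_derivative_sum_scaleR)
      (auto intro!: differentiable_scaleR dP dg
        simp: frechet_derivative_scaleR[OF dP dg] frechet_derivative_compose[OF dphi dPhi])
  \<comment> \<open>The product rule separates the terms that differentiate the coefficients of
    \<open>\<Phi>\<close> from those that differentiate the pulled back basis forms. The latter
    assemble into exterior derivatives of closed forms and disappear.\<close>
  also have "\<dots> = (\<Sum>j<length vs. (- 1) ^ j *\<^sub>R (\<Sum>I\<in>?A. c *\<^sub>R (P I y (delete_nth j vs) *\<^sub>R B (?d (vs ! j)) I))) +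
      (\<Sum>j<length vs. \<Sum>I\<in>?A. c *\<^sub>R ((- 1) ^ j *\<^sub>R frechet_derivative (\<lambda>z. P I z (delete_nth j vs)) (at y) (vs ! j))
        *\<^sub>R \<Phi> (\<phi> y) I)"
    by (simp add: scaleR_add_right sum.distrib scaleR_sum_right mult.commute mult.left_commute)
  also have "(\<Sum>j<length vs. \<Sum>I\<in>?A. c *\<^sub>R ((- 1) ^ j *\<^sub>R frechet_derivative (\<lambda>z. P I z (delete_nth j vs)) (at y) (vs ! j))
        *\<^sub>R \<Phi> (\<phi> y) I) = (\<Sum>I\<in>?A. c *\<^sub>R (extd (P I) y vs *\<^sub>R \<Phi> (\<phi> y) I))"
    by (subst sum.swap) (simp only: extd_def scaleR_sum_left scaleR_sum_right)
  also have "\<dots> = 0"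
    unfolding P_def by (simp add: extd_basis_form_pullback[OF S \<phi>])
  also have "(\<Sum>j<length vs. (- 1) ^ j *\<^sub>R (\<Sum>I\<in>?A. c *\<^sub>R (P I y (delete_nth j vs) *\<^sub>R B (?d (vs ! j)) I))) + 0 =
      (\<Sum>j<length vs. (- 1) ^ j *\<^sub>R B (?d (vs ! j)) (map ?d (delete_nth j vs)))"
    unfolding P_def expand[OF altB, symmetric] by simp
  also have "\<dots> = extd \<Phi> (\<phi> y) (map ?d vs)"
    by (simp add: extd_def B_def map_delete_nth)
  finally show ?thesis .
qed

section \<open>The Hilbert space of square integrable functions\<close>

lemma square_integrable_rep: "square_integrable (rep_L2 X)"
  using Quotient_rep_reflp[OF Quotient_L2, of X] by simp

lemma abs_rep_L2: "abs_L2 (rep_L2 X) = X"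
  by (rule Quotient_abs_rep[OF Quotient_L2])

lemma norm_abs_L2: "square_integrable f \<Longrightarrow> (norm (abs_L2 f))\<^sup>2 = (\<integral>x. (cmod (f x))\<^sup>2 \<partial>lborel)"
proof -
  assume f: "square_integrable f"
  have sq: "cnj (f u) * f u = complex_of_real ((cmod (f u))\<^sup>2)" for u
    by (metis complex_norm_square mult.commute)
  have "(norm (abs_L2 f))\<^sup>2 = inner (abs_L2 f) (abs_L2 f)" by (rule power2_norm_eq_inner)
  also have "\<dots> = Re (\<integral>x. cnj (f x) * f x \<partial>lborel)"
    unfolding inner_L2_def using f by (subst L2_inner.abs_eq) auto
  also have "\<dots> = (\<integral>x. (cmod (f x))\<^sup>2 \<partial>lborel)"
    unfolding sq by (simp del: of_real_power)
  finally show ?thesis .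
qed

lemma square_integrable_diff:
  "square_integrable f \<Longrightarrow> square_integrable g \<Longrightarrow> square_integrable (\<lambda>x. f x - g x)"
  using square_integrable_add[of f "\<lambda>x. - 1 * g x"] square_integrable_scale[of g "- 1"] by simp

text \<open>Stated with the nonnegative integral, so that the interchange with series and Fatou's
  lemma apply directly to these norms.\<close>

lemma norm_abs_L2_diff:
  assumes "square_integrable f" "square_integrable g"
  shows "ennreal ((norm (abs_L2 f - abs_L2 g))\<^sup>2) = (\<integral>\<^sup>+x. ennreal ((cmod (f x - g x))\<^sup>2) \<partial>lborel)"
proof -
  have d: "square_integrable (\<lambda>x. f x - g x)" by (rule square_integrable_diff[OF assms])
  have "abs_L2 f - abs_L2 g = abs_L2 (\<lambda>x. f x - g x)"
    using assms by (subst minus_L2.abs_eq) auto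
  moreover have "(\<integral>\<^sup>+x. ennreal ((cmod (f x - g x))\<^sup>2) \<partial>lborel) = ennreal (\<integral>x. (cmod (f x - g x))\<^sup>2 \<partial>lborel)"
    using d by (intro nn_integral_eq_integral) (auto simp: square_integrable_def)
  ultimately show ?thesis using norm_abs_L2[OF d] by simp
qed

text \<open>The Riesz-Fischer argument: a rapidly Cauchy subsequence converges almost everywhere,
  and Fatou's lemma carries the Cauchy bounds over to the pointwise limit, hence to the distance of
  the full sequence from it.\<close>

lemma L2_Cauchy_convergent:
  fixes X :: "nat \<Rightarrow> 'l::euclidean_space L2"
  assumes "Cauchy X"
  shows "convergent X"
proof -
  define f where "f n = rep_L2 (X n)" for n
  have f: "square_integrable (f n)" and X: "X n = abs_L2 (f n)" for n
    by (simp_all add: f_def square_integrable_rep abs_rep_L2)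
  have fm [measurable]: "f n \<in> borel_measurable borel" for n
    using f by (auto simp: square_integrable_def)
  have N: "\<exists>N. \<forall>m\<ge>N. \<forall>n\<ge>N. (norm (X m - X n))\<^sup>2 \<le> e" if "e > 0" for e
  proof -
    have "sqrt e > 0" using that by simp
    then obtain N where "\<forall>m\<ge>N. \<forall>n\<ge>N. norm (X m - X n) < sqrt e"
      using assms unfolding Cauchy_iff by blast
    then have "\<forall>m\<ge>N. \<forall>n\<ge>N. (norm (X m - X n))\<^sup>2 \<le> (sqrt e)\<^sup>2"
      by (meson less_imp_le norm_ge_zero power_mono)
    then show ?thesis using that by auto
  qed
  \<comment> \<open>The rate 1/8 leaves the summable factor (1/2)^k after multiplication by the
    squared weight 4^k.\<close>
  have "\<exists>N. \<forall>k. \<forall>m\<ge>N k. \<forall>n\<ge>N k. (norm (X m - X n))\<^sup>2 \<le> (1/8) ^ k"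
    by (intro choice allI N) simp
  then obtain R where R: "\<And>k m n. m \<ge> R k \<Longrightarrow> n \<ge> R k \<Longrightarrow> (norm (X m - X n))\<^sup>2 \<le> (1/8) ^ k" by blast
  \<comment> \<open>Adding up the thresholds makes \<open>r l\<close> exceed \<open>R k\<close> for
    every \<open>k \<le> l\<close>, and the extra \<open>k\<close> makes the indices tend to
    infinity.\<close>
  define r where "r k = (\<Sum>i\<le>k. R i) + k" for k
  have rR: "R k \<le> r l" if "k \<le> l" for k l
  proof -
    have "R k \<le> (\<Sum>i\<le>l. R i)" using that by (intro member_le_sum) auto
    then show ?thesis by (simp add: r_def)
  qed
  have rk: "k \<le> r k" for k by (simp add: r_def)
  \<comment> \<open>The weight \<open>2\<^sup>k\<close> turns boundedness of \<open>h k x\<close> into summability of the increments at x.\<close>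
  define h where "h k x = (2 ^ k * cmod (f (r (Suc k)) x - f (r k) x))\<^sup>2" for k x
  have hm [measurable]: "h k \<in> borel_measurable borel" for k unfolding h_def by measurable
  have hint: "(\<integral>\<^sup>+x. ennreal (h k x) \<partial>lborel) \<le> ennreal ((1/2) ^ k)" for k
  proof -
    have p4: "(2 ^ k)\<^sup>2 = (4 :: real) ^ k"
      by (simp add: power2_eq_square power_mult_distrib[symmetric])
    have "(\<integral>\<^sup>+x. ennreal (h k x) \<partial>lborel) =
        (\<integral>\<^sup>+x. ennreal (4 ^ k) * ennreal ((cmod (f (r (Suc k)) x - f (r k) x))\<^sup>2) \<partial>lborel)"
      by (intro nn_integral_cong)
        (simp only: h_def power_mult_distrib p4, simp add: ennreal_mult)
    also have "\<dots> = ennreal (4 ^ k) * ennreal ((norm (X (r (Suc k)) - X (r k)))\<^sup>2)"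
      unfolding X norm_abs_L2_diff[OF f f] by (intro nn_integral_cmult) measurable
    also have "\<dots> \<le> ennreal (4 ^ k) * ennreal ((1/8) ^ k)"
      by (intro mult_left_mono ennreal_leI R) (auto intro: rR)
    also have "\<dots> = ennreal (4 ^ k * (1/8) ^ k)" by (simp add: ennreal_mult)
    also have "4 ^ k * (1/8) ^ k = (1/2 :: real) ^ k"
      by (simp add: power_mult_distrib[symmetric])
    finally show ?thesis .
  qed
  have "AE x in lborel. (\<Sum>k. ennreal (h k x)) \<noteq> \<infinity>"
  proof (rule nn_integral_PInf_AE)
    have "(\<integral>\<^sup>+x. (\<Sum>k. ennreal (h k x)) \<partial>lborel) = (\<Sum>k. \<integral>\<^sup>+x. ennreal (h k x) \<partial>lborel)"
      by (intro nn_integral_suminf) measurable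
    also have "\<dots> \<le> (\<Sum>k. ennreal ((1/2) ^ k))" by (intro suminf_le hint) auto
    finally have "(\<integral>\<^sup>+x. (\<Sum>k. ennreal (h k x)) \<partial>lborel) \<le> (\<Sum>k. ennreal ((1/2) ^ k))" .
    moreover have "(\<Sum>k. ennreal ((1/2) ^ k)) \<noteq> top"
      by (rule ennreal_suminf_neq_top) (auto intro: summable_geometric)
    ultimately show "(\<integral>\<^sup>+x. (\<Sum>k. ennreal (h k x)) \<partial>lborel) \<noteq> \<infinity>"
      by (auto simp: top_unique)
  qed measurable
  then have conv: "AE x in lborel. (\<lambda>k. f (r k) x) \<longlonglongrightarrow> lim (\<lambda>k. f (r k) x)"
  proof eventually_elim
    fix x assume "(\<Sum>k. ennreal (h k x)) \<noteq> \<infinity>"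
    then have "summable (\<lambda>k. h k x)"
      by (intro summable_suminf_not_top) (auto simp: h_def)
    then have "(\<lambda>k. h k x) \<longlonglongrightarrow> 0" by (rule summable_LIMSEQ_zero)
    then have "\<forall>\<^sub>F k in sequentially. h k x < 1" by (rule order_tendstoD) simp
    then have "\<forall>\<^sub>F k in sequentially. norm (f (r (Suc k)) x - f (r k) x) \<le> (1/2) ^ k"
    proof eventually_elim
      fix k assume "h k x < 1"
      then have "2 ^ k * cmod (f (r (Suc k)) x - f (r k) x) < 1"
        unfolding h_def by (simp add: power_less_one_iff abs_square_less_1)
      then show "norm (f (r (Suc k)) x - f (r k) x) \<le> (1/2) ^ k"
        by (simp add: power_one_over field_simps)
    qed
    then have "summable (\<lambda>k. f (r (Suc k)) x - f (r k) x)"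
      by (rule summable_comparison_test_ev) (simp add: summable_geometric)
    from summable_LIMSEQ[OF this]
    have "(\<lambda>n. \<Sum>k<n. f (r (Suc k)) x - f (r k) x) \<longlonglongrightarrow> (\<Sum>k. f (r (Suc k)) x - f (r k) x)" .
    then have "(\<lambda>n. f (r n) x - f (r 0) x) \<longlonglongrightarrow> (\<Sum>k. f (r (Suc k)) x - f (r k) x)"
      by (simp only: sum_lessThan_telescope[of "\<lambda>k. f (r k) x"])
    from tendsto_add[OF this tendsto_const[of "f (r 0) x"]]
    have "convergent (\<lambda>n. f (r n) x)" unfolding convergent_def by auto
    then show "(\<lambda>k. f (r k) x) \<longlonglongrightarrow> lim (\<lambda>k. f (r k) x)" by (simp add: convergent_LIMSEQ_iff)
  qed
  define F where "F x = lim (\<lambda>k. f (r k) x)" for x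
  have Fm [measurable]: "F \<in> borel_measurable borel" unfolding F_def by measurable
  \<comment> \<open>Almost everywhere the integrand is the limit, hence the liminf, of the same
    expression with \<open>F\<close> replaced by \<open>f (r k)\<close>, and for large
    \<open>k\<close> those integrals obey the Cauchy bound.\<close>
  have fatou: "(\<integral>\<^sup>+x. ennreal ((cmod (f n x - F x))\<^sup>2) \<partial>lborel) \<le> ennreal e"
    if n: "\<forall>m\<ge>n. (norm (X n - X m))\<^sup>2 \<le> e" for n e
  proof -
    have "(\<integral>\<^sup>+x. ennreal ((cmod (f n x - F x))\<^sup>2) \<partial>lborel) =
        (\<integral>\<^sup>+x. liminf (\<lambda>k. ennreal ((cmod (f n x - f (r k) x))\<^sup>2)) \<partial>lborel)"
    proof (intro nn_integral_cong_AE)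
      show "AE x in lborel. ennreal ((cmod (f n x - F x))\<^sup>2) =
          liminf (\<lambda>k. ennreal ((cmod (f n x - f (r k) x))\<^sup>2))"
        using conv
      proof eventually_elim
        fix x assume "(\<lambda>k. f (r k) x) \<longlonglongrightarrow> lim (\<lambda>k. f (r k) x)"
        then have "(\<lambda>k. ennreal ((cmod (f n x - f (r k) x))\<^sup>2)) \<longlonglongrightarrow> ennreal ((cmod (f n x - F x))\<^sup>2)"
          unfolding F_def by (intro tendsto_ennrealI tendsto_intros)
        then show "ennreal ((cmod (f n x - F x))\<^sup>2) = liminf (\<lambda>k. ennreal ((cmod (f n x - f (r k) x))\<^sup>2))"
          by (intro lim_imp_Liminf[symmetric]) auto
      qed
    qed
    also have "\<dots> \<le> liminf (\<lambda>k. \<integral>\<^sup>+x. ennreal ((cmod (f n x - f (r k) x))\<^sup>2) \<partial>lborel)"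
      by (intro nn_integral_liminf) measurable
    also have "\<dots> \<le> ennreal e"
    proof (rule Liminf_le)
      show "\<forall>\<^sub>F k in sequentially. (\<integral>\<^sup>+x. ennreal ((cmod (f n x - f (r k) x))\<^sup>2) \<partial>lborel) \<le> ennreal e"
        using eventually_ge_at_top[of n]
      proof eventually_elim
        fix k assume "n \<le> k"
        then have "n \<le> r k" using rk[of k] by linarith
        then show "(\<integral>\<^sup>+x. ennreal ((cmod (f n x - f (r k) x))\<^sup>2) \<partial>lborel) \<le> ennreal e"
          using n unfolding norm_abs_L2_diff[OF f f, symmetric] X[symmetric] by (intro ennreal_leI) auto
      qed
    qed simp
    finally show ?thesis .
  qed
  have F: "square_integrable F"
  proof -
    obtain n where "\<forall>m\<ge>n. \<forall>k\<ge>n. (norm (X m - X k))\<^sup>2 \<le> 1" using N[of 1] by auto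
    then have "(\<integral>\<^sup>+x. ennreal ((cmod (f n x - F x))\<^sup>2) \<partial>lborel) \<le> ennreal 1" by (intro fatou) auto
    also have "\<dots> < top" by simp
    finally have "square_integrable (\<lambda>x. f n x - F x)"
      unfolding square_integrable_def by (auto intro!: integrableI_bounded)
    from square_integrable_diff[OF f[of n] this] show ?thesis by simp
  qed
  have "X \<longlonglongrightarrow> abs_L2 F"
  proof (rule metric_LIMSEQ_I)
    fix e :: real assume e: "e > 0"
    then have "(e/2)\<^sup>2 > 0" by simp
    from N[OF this] obtain n0 where n0: "\<forall>m\<ge>n0. \<forall>n\<ge>n0. (norm (X m - X n))\<^sup>2 \<le> (e/2)\<^sup>2" by blast
    have "dist (X n) (abs_L2 F) < e" if "n \<ge> n0" for n
    proof -
      have "ennreal ((norm (X n - abs_L2 F))\<^sup>2) \<le> ennreal ((e/2)\<^sup>2)"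
        unfolding X norm_abs_L2_diff[OF f F] using n0 that by (intro fatou) auto
      then have "(norm (X n - abs_L2 F))\<^sup>2 \<le> (e/2)\<^sup>2" by (subst (asm) ennreal_le_iff) auto
      from power2_le_imp_le[OF this] have "norm (X n - abs_L2 F) \<le> e/2" using e by simp
      then have "norm (X n - abs_L2 F) < e" using e by linarith
      then show ?thesis by (simp only: dist_norm)
    qed
    then show "\<exists>no. \<forall>n\<ge>no. dist (X n) (abs_L2 F) < e" by blast
  qed
  then show ?thesis by (auto simp: convergent_def)
qed

text \<open>The representing vector is found by minimising \<open>E\<close>, which equals the
  squared distance to it up to a constant. Completing the square bounds \<open>E\<close> from below,
  the parallelogram law makes a minimising sequence Cauchy, and comparing the minimiser with points
  on a line through it gives the representation.\<close>

lemma L2_riesz_real: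
  fixes \<phi> :: "'l::euclidean_space L2 \<Rightarrow> real"
  assumes \<phi>: "bounded_linear \<phi>"
  shows "\<exists>u. \<forall>v. \<phi> v = inner u v"
proof -
  interpret \<phi>: bounded_linear \<phi> by fact
  define E where "E v = (norm v)\<^sup>2 - 2 * \<phi> v" for v
  obtain K where K: "\<And>v. norm (\<phi> v) \<le> norm v * K" using \<phi>.bounded by blast
  have bdd: "- (K\<^sup>2) \<le> E v" for v
  proof -
    have "0 \<le> (norm v - K)\<^sup>2" by simp
    moreover have "\<phi> v \<le> norm v * K" using K[of v] by simp
    ultimately show ?thesis by (simp add: E_def power2_diff)
  qed
  then have bb: "bdd_below (range E)" by (auto intro!: bdd_belowI)
  define m where "m = Inf (range E)"
  have m: "m \<le> E v" for v unfolding m_def by (rule cInf_lower[OF _ bb]) simp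
  have "\<exists>v. E v < m + 1 / (real n + 1)" for n
    using cInf_lessD[of "range E" "m + 1 / (real n + 1)"] unfolding m_def by (auto simp: add_pos_nonneg)
  then obtain v where v: "\<And>n. E (v n) < m + 1 / (real n + 1)" by metis
  \<comment> \<open>\<open>E\<close> is at least \<open>m\<close> at the midpoint; the parallelogram
    law turns this into a bound on the distance of two near-minimisers.\<close>
  have par: "(norm (a - b))\<^sup>2 \<le> 2 * (E a - m) + 2 * (E b - m)" for a b
  proof -
    have "(norm ((1/2) *\<^sub>R (a + b)))\<^sup>2 = (norm (a + b))\<^sup>2 / 4" by (simp add: power_divide)
    then have "E ((1/2) *\<^sub>R (a + b)) = (norm (a + b))\<^sup>2 / 4 - (\<phi> a + \<phi> b)"
      by (simp only: E_def \<phi>.scaleR \<phi>.add) (simp add: field_simps)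
    then have "4 * m \<le> (norm (a + b))\<^sup>2 - 4 * (\<phi> a + \<phi> b)" using m[of "(1/2) *\<^sub>R (a + b)"] by simp
    then show ?thesis
      by (simp add: E_def power2_norm_eq_inner inner_add_left inner_add_right inner_diff_left inner_diff_right inner_commute)
  qed
  have "Cauchy v"
  proof (rule metric_CauchyI)
    fix e :: real assume e: "e > 0"
    then obtain N where N: "inverse (real (Suc N)) < e\<^sup>2 / 4" using reals_Archimedean[of "e\<^sup>2 / 4"] by auto
    have "dist (v a) (v b) < e" if "a \<ge> N" "b \<ge> N" for a b
    proof -
      have small: "E (v n) - m < e\<^sup>2 / 4" if "n \<ge> N" for n
      proof -
        have "1 / (real n + 1) \<le> 1 / (real N + 1)" using that by (simp add: field_simps)
        then show ?thesis using v[of n] N by (simp add: inverse_eq_divide add.commute)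
      qed
      have "2 * (E (v a) - m) + 2 * (E (v b) - m) < 2 * (e\<^sup>2 / 4) + 2 * (e\<^sup>2 / 4)"
        using small[OF that(1)] small[OF that(2)] by (intro add_strict_mono mult_strict_left_mono) auto
      also have "\<dots> = e\<^sup>2" by simp
      finally have "(norm (v a - v b))\<^sup>2 < e\<^sup>2" using par[of "v a" "v b"] by (rule le_less_trans[rotated])
      then show ?thesis using e by (simp add: dist_norm power_less_imp_less_base)
    qed
    then show "\<exists>M. \<forall>a\<ge>M. \<forall>b\<ge>M. dist (v a) (v b) < e" by blast
  qed
  then obtain u where u: "v \<longlonglongrightarrow> u" using L2_Cauchy_convergent convergent_def by metis
  have "(\<lambda>n. E (v n)) \<longlonglongrightarrow> E u"
    unfolding E_def by (intro tendsto_intros u \<phi>.tendsto)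
  moreover have "(\<lambda>n. m + 1 / (real n + 1)) \<longlonglongrightarrow> m + 0"
    by (intro tendsto_intros LIMSEQ_Suc[OF lim_1_over_n, unfolded of_nat_Suc] | simp add: add.commute)+
  ultimately have "E u \<le> m" using v by (auto intro: LIMSEQ_le less_imp_le)
  then have min: "E u \<le> E x" for x using m[of x] by simp
  have "\<phi> x = inner u x" for x
  proof -
    define c where "c = inner u x - \<phi> x"
    \<comment> \<open>The optimal step along \<open>x\<close> would be \<open>- c\<close> over the
      squared norm; the \<open>+ 1\<close> keeps it defined for \<open>x = 0\<close>, and the
      resulting change of \<open>E\<close> is still negative unless \<open>c = 0\<close>.\<close>
    define s where "s = (norm x)\<^sup>2 + 1"
    have s: "s > 0" by (simp add: s_def add_nonneg_pos)
    let ?t = "- (c / s)"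
    have "E (u + t *\<^sub>R x) = E u + 2 * t * c + t\<^sup>2 * (norm x)\<^sup>2" for t
      unfolding E_def c_def power2_norm_eq_inner \<phi>.add \<phi>.scaleR
      by (simp add: inner_add_left inner_add_right inner_commute power2_eq_square algebra_simps)
    from this[of ?t] have "0 \<le> 2 * ?t * c + ?t\<^sup>2 * (norm x)\<^sup>2" using min[of "u + ?t *\<^sub>R x"] by linarith
    also have "\<dots> = (c\<^sup>2 / s\<^sup>2) * ((norm x)\<^sup>2 - 2 * s)"
      using s by (simp add: field_simps power2_eq_square)
    finally have "0 \<le> (c\<^sup>2 / s\<^sup>2) * ((norm x)\<^sup>2 - 2 * s)" .
    moreover have "(norm x)\<^sup>2 - 2 * s < 0"
    proof -
      have "(norm x)\<^sup>2 - 2 * s = - ((norm x)\<^sup>2 + 2)" by (simp add: s_def)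
      then show ?thesis by (simp only: neg_less_0_iff_less) (intro add_nonneg_pos, auto)
    qed
    ultimately have "c\<^sup>2 / s\<^sup>2 \<le> 0" by (meson linorder_not_less mult_pos_neg)
    then have "c = 0" using s by (simp add: divide_le_0_iff)
    then show ?thesis by (simp add: c_def)
  qed
  then show ?thesis by blast
qed

section \<open>Sesquilinearity and the norm of complex multiples\<close>

lemma L2_inner_commute: "L2_inner x y = cnj (L2_inner y x)"
proof transfer
  fix f g :: "'a \<Rightarrow> complex"
  show "(\<integral>x. cnj (f x) * g x \<partial>lborel) = cnj (\<integral>x. cnj (g x) * f x \<partial>lborel)"
    by (subst Bochner_Integration.integral_cnj[symmetric]) (simp add: mult.commute)
qed

lemma L2_inner_add_left: "L2_inner (x + y) z = L2_inner x z + L2_inner y z"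
  by transfer (simp add: distrib_right square_integrable_mult)

lemma L2_inner_add_right: "L2_inner z (x + y) = L2_inner z x + L2_inner z y"
  by transfer (simp add: distrib_left square_integrable_mult)

lemma L2_inner_scaleC_right: "L2_inner x (c *\<^sub>C y) = c * L2_inner x y"
  by transfer (simp add: mult.left_commute)

lemma L2_inner_scaleC_left: "L2_inner (c *\<^sub>C x) y = cnj c * L2_inner x y"
  by transfer (simp add: mult.assoc)

lemma scaleC_one: "1 *\<^sub>C (x :: 'a::complex_vect) = x"
  using scaleR_scaleC[of 1 x] by simp

lemma scaleC_zero: "0 *\<^sub>C (x :: 'a::complex_vect) = 0"
  using scaleR_scaleC[of 0 x] by simp

lemma scaleC_zero_right: "c *\<^sub>C (0 :: 'a::complex_vect) = 0"
  using scaleC_add_right[of c "0::'a" 0] by simp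

lemma scaleC_sum: "c *\<^sub>C (\<Sum>i\<in>I. (f i :: 'a::complex_vect)) = (\<Sum>i\<in>I. c *\<^sub>C f i)"
  by (induction I rule: infinite_finite_induct) (auto simp: scaleC_zero_right scaleC_add_right)

lemma complex_linear_add: "complex_linear f \<Longrightarrow> f (x + y) = f x + f y"
  and complex_linear_scaleC: "complex_linear f \<Longrightarrow> f (c *\<^sub>C x) = c *\<^sub>C f x"
  by (auto simp: complex_linear_def)

lemma complex_linear_linear: "complex_linear f \<Longrightarrow> linear f"
  by (intro linearI) (auto simp: complex_linear_def scaleR_scaleC)

lemma complex_linear_compose: "complex_linear f \<Longrightarrow> complex_linear g \<Longrightarrow> complex_linear (\<lambda>x. f (g x))"
  by (simp add: complex_linear_def)

lemma L2_inner_diff_right: "L2_inner z (x - y) = L2_inner z x - L2_inner z y"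
  using L2_inner_add_right[of z "x - y" y] by simp

lemma L2_inner_diff_left: "L2_inner (x - y) z = L2_inner x z - L2_inner y z"
  using L2_inner_add_left[of "x - y" y z] by simp

lemma L2_inner_zero: "L2_inner z 0 = 0" "L2_inner 0 z = 0"
  using L2_inner_diff_right[of z 0 0] L2_inner_diff_left[of 0 0 z] by auto

lemma L2_inner_eqI: "(\<And>v. L2_inner u v = L2_inner u' v) \<Longrightarrow> u = u'"
  by (metis inner_L2_def inner_eq_zero_iff inner_diff_left right_minus_eq diff_self)

lemma L2_inner_self: "L2_inner x x = complex_of_real ((norm x)\<^sup>2)"
proof (rule complex_eqI)
  show "Re (L2_inner x x) = Re (complex_of_real ((norm x)\<^sup>2))"
    by (simp add: power2_norm_eq_inner inner_L2_def del: of_real_power)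
  have "Im (L2_inner x x) = - Im (L2_inner x x)" using arg_cong[OF L2_inner_commute[of x x], of Im] by simp
  then show "Im (L2_inner x x) = Im (complex_of_real ((norm x)\<^sup>2))" by simp
qed

lemma norm_scaleC_L2: "norm (c *\<^sub>C (x :: 'l::euclidean_space L2)) = cmod c * norm x"
proof -
  have "complex_of_real ((norm (c *\<^sub>C x))\<^sup>2) = complex_of_real ((cmod c * norm x)\<^sup>2)"
    unfolding L2_inner_self[symmetric] L2_inner_scaleC_left L2_inner_scaleC_right
    using complex_norm_square[of c] by (simp add: L2_inner_self power_mult_distrib)
  then have "(norm (c *\<^sub>C x))\<^sup>2 = (cmod c * norm x)\<^sup>2" by (simp only: of_real_eq_iff)
  from power2_eq_imp_eq[OF this] show ?thesis by simp
qed

text \<open>Multiplying \<open>v\<close> by a phase makes the product real and nonnegative, which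
  reduces the claim to the real inequality.\<close>

lemma L2_Cauchy_Schwarz: "cmod (L2_inner u v) \<le> norm u * norm v"
proof (cases "L2_inner u v = 0")
  case False
  define c where "c = cnj (sgn (L2_inner u v))"
  have c: "cmod c = 1" using False by (simp add: c_def norm_sgn)
  have "L2_inner u (c *\<^sub>C v) = complex_of_real (cmod (L2_inner u v))"
    using False by (simp add: L2_inner_scaleC_right c_def sgn_div_norm scaleR_conv_of_real field_simps
        complex_norm_square[symmetric] power2_eq_square del: of_real_power)
  then have "cmod (L2_inner u v) = inner u (c *\<^sub>C v)" by (simp add: inner_L2_def)
  also have "\<dots> \<le> norm u * norm (c *\<^sub>C v)" by (rule norm_cauchy_schwarz)
  finally show ?thesis by (simp add: norm_scaleC_L2 c)
qed simp

lemma bounded_linear_L2_inner: "bounded_linear (L2_inner u)"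
  by (rule bounded_linear_intro[where K = "norm u"])
    (auto simp: L2_inner_add_right scaleR_scaleC L2_inner_scaleC_right scaleC_complex_def scaleR_conv_of_real
      mult.commute intro: order_trans[OF L2_Cauchy_Schwarz])


subsection \<open>The dual space\<close>

lemma functional_scaleC_right: "functional f (c *\<^sub>C v) = c * functional f v"
  using functional[of f] by (simp add: complex_linear_def scaleC_complex_def)

lemma L2_dual_eqI: "(\<And>v. functional f v = functional g v) \<Longrightarrow> f = g"
  by (metis blinfun_eqI functional_inject)

lemma functional_add: "functional (f + g) v = functional f v + functional g v"
  by (simp add: plus_L2_dual.rep_eq blinfun.add_left)

lemma functional_scaleC: "functional (c *\<^sub>C f) v = c * functional f v"
  by (simp add: scaleC_L2_dual.rep_eq mult_functional_def)

lemma functional_scaleR: "functional (r *\<^sub>R f) v = r *\<^sub>R functional f v"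
  by (simp add: scaleR_L2_dual.rep_eq blinfun.scaleR_left)

lemma functional_flat: "functional (flat v) w = L2_inner v w"
proof -
  have "blinfun_apply (Blinfun (L2_inner v)) = L2_inner v"
    by (rule bounded_linear_Blinfun_apply[OF bounded_linear_L2_inner])
  moreover have "complex_linear (L2_inner v)"
    by (simp add: complex_linear_def L2_inner_add_right L2_inner_scaleC_right scaleC_complex_def)
  ultimately show ?thesis
    unfolding flat_def by (subst Functional_inverse) auto
qed

text \<open>The real Riesz theorem represents the real part of the functional; evaluating it at
  \<open>\<i> *\<^sub>C v\<close> recovers the imaginary part by complex linearity.\<close>

lemma functional_sharp: "functional f v = L2_inner (sharp f) v"
proof -
  have "bounded_linear (\<lambda>v. Re (functional f v))"
    by (intro bounded_linear_compose[OF bounded_linear_Re] blinfun.bounded_linear_right)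
  then obtain u where u: "\<And>v. Re (functional f v) = Re (L2_inner u v)"
    using L2_riesz_real unfolding inner_L2_def by blast
  have "functional f v = L2_inner u v" for v
  proof (rule complex_eqI)
    have "Re (functional f (\<i> *\<^sub>C v)) = Re (L2_inner u (\<i> *\<^sub>C v))" by (rule u)
    then show "Im (functional f v) = Im (L2_inner u v)"
      by (simp add: functional_scaleC_right L2_inner_scaleC_right)
  qed (rule u)
  then have ex: "\<forall>v. functional f v = L2_inner u v" by blast
  have "\<forall>v. functional f v = L2_inner (sharp f) v"
    unfolding sharp_def
    by (rule theI[where P = "\<lambda>u. \<forall>v. functional f v = L2_inner u v" and a = u])
      (use ex in \<open>auto intro!: L2_inner_eqI\<close>)
  then show ?thesis by blast
qed

lemma sharp_flat: "sharp (flat v) = v"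
  by (rule L2_inner_eqI) (simp add: functional_sharp[symmetric] functional_flat)

lemma flat_sharp: "flat (sharp f) = f"
  by (rule L2_dual_eqI) (simp add: functional_sharp[symmetric] functional_flat)

lemma flat_add: "flat (u + v) = flat u + flat v"
  by (rule L2_dual_eqI) (simp add: functional_flat functional_add L2_inner_add_left)

lemma flat_scaleC: "flat (c *\<^sub>C u) = cnj c *\<^sub>C flat u"
  by (rule L2_dual_eqI) (simp add: functional_flat functional_scaleC L2_inner_scaleC_left)

lemma sharp_add: "sharp (f + g) = sharp f + sharp g"
  by (metis flat_add flat_sharp sharp_flat)

lemma sharp_scaleC: "sharp (c *\<^sub>C f) = cnj c *\<^sub>C sharp f"
  by (metis flat_scaleC flat_sharp sharp_flat complex_cnj_cnj)

lemma dual_inner_flat: "dual_inner (flat u) (flat v) = L2_inner v u"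
  by (simp add: dual_inner_def sharp_flat)

lemma functional_dual_comp:
  "complex_linear (blinfun_apply T) \<Longrightarrow> functional (dual_comp f T) v = functional f (T v)"
proof -
  assume "complex_linear (blinfun_apply T)"
  then have "complex_linear (blinfun_apply (functional f o\<^sub>L T))"
    using functional[of f] by (auto simp: complex_linear_def)
  then show ?thesis unfolding dual_comp_def by (subst Functional_inverse) auto
qed

lemma norm_L2_dual_bound:
  "0 \<le> b \<Longrightarrow> (\<And>v. cmod (functional f v) \<le> b * norm v) \<Longrightarrow> norm f \<le> b"
  unfolding norm_L2_dual.rep_eq by (rule norm_blinfun_bound) auto

lemma norm_functional: "cmod (functional f v) \<le> norm f * norm v"
  unfolding norm_L2_dual.rep_eq by (rule norm_blinfun)

lemma bounded_linear_dual_comp: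
  assumes T: "complex_linear (blinfun_apply T)"
  shows "bounded_linear (\<lambda>f. dual_comp f T)"
proof (rule bounded_linear_intro[where K = "norm T"])
  show "dual_comp (f + g) T = dual_comp f T + dual_comp g T" for f g
    by (rule L2_dual_eqI) (simp add: functional_dual_comp[OF T] functional_add)
  show "dual_comp (r *\<^sub>R f) T = r *\<^sub>R dual_comp f T" for r f
    by (rule L2_dual_eqI) (simp add: functional_dual_comp[OF T] functional_scaleR)
  show "norm (dual_comp f T) \<le> norm f * norm T" for f
  proof (rule norm_L2_dual_bound)
    fix v
    have "cmod (functional f (T v)) \<le> norm f * norm (T v)" by (rule norm_functional)
    also have "\<dots> \<le> norm f * (norm T * norm v)" by (intro mult_left_mono norm_blinfun) auto
    finally show "cmod (functional (dual_comp f T) v) \<le> norm f * norm T * norm v"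
      by (simp add: functional_dual_comp[OF T] mult.assoc)
  qed simp
qed


subsection \<open>Compact operators\<close>

lemma rank_one_apply: "rank_one u f w = functional f w *\<^sub>C u"
proof -
  have "bounded_linear (\<lambda>w. functional f w *\<^sub>C u)"
    by (rule bounded_linear_intro[where K = "norm f * norm u"])
      (auto simp: blinfun.add_right scaleC_add_left scaleR_scaleC functional_scaleC_right scaleC_scaleC
        norm_scaleC_L2 mult.assoc mult.left_commute intro!: order_trans[OF mult_right_mono[OF norm_functional]])
  then show ?thesis unfolding rank_one_def by (simp add: bounded_linear_Blinfun_apply)
qed

lemma op_scaleC_apply: "op_scaleC c T u = c *\<^sub>C T u"
proof -
  have "bounded_linear (\<lambda>u. c *\<^sub>C blinfun_apply T u)"
  proof (rule bounded_linear_intro[where K = "cmod c * norm T"])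
    show "norm (c *\<^sub>C T x) \<le> norm x * (cmod c * norm T)" for x
      using mult_left_mono[OF norm_blinfun[of T x], of "cmod c"]
      by (simp add: norm_scaleC_L2 mult.commute mult.left_commute)
    show "c *\<^sub>C T (r *\<^sub>R x) = r *\<^sub>R (c *\<^sub>C T x)" for r x
      unfolding blinfun.scaleR_right by (simp add: scaleR_scaleC scaleC_scaleC mult.commute)
  qed (simp add: blinfun.add_right scaleC_add_right)
  then show ?thesis unfolding op_scaleC_def by (simp add: bounded_linear_Blinfun_apply)
qed

lemma compact_opsI:
  "complex_linear (blinfun_apply T) \<Longrightarrow> compact K \<Longrightarrow> T ` cball 0 1 \<subseteq> K \<Longrightarrow> T \<in> compact_ops"
  unfolding compact_ops_def
  using compact_Int_closed[of K "closure (T ` cball 0 1)"] closure_minimal[of "T ` cball 0 1" K] compact_imp_closed[of K]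
  by (simp add: Int_absorb1)

lemma complex_linear_compact_ops: "T \<in> compact_ops \<Longrightarrow> complex_linear (blinfun_apply T)"
  by (simp add: compact_ops_def)

lemma rank_one_compact: "rank_one u f \<in> compact_ops"
proof (rule compact_opsI)
  show "complex_linear (blinfun_apply (rank_one u f))"
    by (simp add: complex_linear_def rank_one_apply blinfun.add_right scaleC_add_left functional_scaleC_right scaleC_scaleC)
  have "continuous_on (cball 0 (norm f)) (\<lambda>c. c *\<^sub>C u)"
  proof (intro linear_continuous_on bounded_linear_intro)
    show "(r *\<^sub>R c) *\<^sub>C u = r *\<^sub>R c *\<^sub>C u" for r c
      by (simp only: scaleR_conv_of_real scaleR_scaleC[of r "c *\<^sub>C u"] scaleC_scaleC)
  qed (auto simp: scaleC_add_left norm_scaleC_L2)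
  then show "compact ((\<lambda>c. c *\<^sub>C u) ` cball 0 (norm f))" by (rule compact_continuous_image) simp
  show "rank_one u f ` cball 0 1 \<subseteq> (\<lambda>c. c *\<^sub>C u) ` cball 0 (norm f)"
  proof (intro image_subsetI)
    fix v :: "'a L2" assume "v \<in> cball 0 1"
    then have "cmod (functional f v) \<le> norm f"
      using norm_functional[of f v] mult_left_mono[of "norm v" 1 "norm f"] by simp
    then show "rank_one u f v \<in> (\<lambda>c. c *\<^sub>C u) ` cball 0 (norm f)" by (auto simp: rank_one_apply)
  qed
qed

lemma compact_ops_add: "S \<in> compact_ops \<Longrightarrow> T \<in> compact_ops \<Longrightarrow> S + T \<in> compact_ops"
proof (rule compact_opsI)
  assume *: "S \<in> compact_ops" "T \<in> compact_ops"
  show "complex_linear (blinfun_apply (S + T))"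
    using * by (auto simp: compact_ops_def complex_linear_def blinfun.add_left scaleC_add_right)
  show "compact {x + y | x y. x \<in> closure (S ` cball 0 1) \<and> y \<in> closure (T ` cball 0 1)}"
    using * by (intro compact_sums) (auto simp: compact_ops_def)
  show "(S + T) ` cball 0 1 \<subseteq> {x + y | x y. x \<in> closure (S ` cball 0 1) \<and> y \<in> closure (T ` cball 0 1)}"
  proof (intro image_subsetI)
    fix v :: "'a L2" assume "v \<in> cball 0 1"
    then have "S v \<in> closure (S ` cball 0 1)" "T v \<in> closure (T ` cball 0 1)"
      by (auto intro: subsetD[OF closure_subset imageI])
    then show "(S + T) v \<in> {x + y | x y. x \<in> closure (S ` cball 0 1) \<and> y \<in> closure (T ` cball 0 1)}"
      by (auto simp: blinfun.add_left)
  qed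
qed

lemma compact_ops_compose:
  assumes A: "complex_linear (blinfun_apply A)" and B: "complex_linear (blinfun_apply B)"
    and n: "\<And>v. norm (B v) \<le> norm v" and T: "T \<in> compact_ops"
  shows "A o\<^sub>L T o\<^sub>L B \<in> compact_ops"
proof (rule compact_opsI)
  show "complex_linear (blinfun_apply (A o\<^sub>L T o\<^sub>L B))"
    using A B T by (auto simp: compact_ops_def complex_linear_def)
  show "compact (A ` closure (T ` cball 0 1))"
    using T by (intro compact_continuous_image) (auto simp: compact_ops_def intro: continuous_intros)
  show "(A o\<^sub>L T o\<^sub>L B) ` cball 0 1 \<subseteq> A ` closure (T ` cball 0 1)"
  proof (intro image_subsetI)
    fix v :: "'b L2" assume "v \<in> cball 0 1"
    then have "B v \<in> cball 0 1" using n[of v] by simp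
    then have "T (B v) \<in> closure (T ` cball 0 1)" by (rule subsetD[OF closure_subset imageI])
    then show "(A o\<^sub>L T o\<^sub>L B) v \<in> A ` closure (T ` cball 0 1)" by simp
  qed
qed

text \<open>An orthogonal projection that fixes the given vectors, built by Gram-Schmidt: a new
  vector contributes the unit vector \<open>a\<close> along its component \<open>d\<close>
  orthogonal to the range so far. It is written as a sum so that composing it with an operator
  visibly gives a sum of rank one operators.\<close>

lemma finite_rank_projection:
  assumes "finite F"
  shows "\<exists>(n::nat) e f. let P = (\<lambda>x :: 'l::euclidean_space L2. \<Sum>i<n. functional (f i) x *\<^sub>C e i) in
    (\<forall>y\<in>F. P y = y) \<and> (\<forall>x. P (P x) = P x) \<and> (\<forall>x y. L2_inner (P x) y = L2_inner x (P y))"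
  using assms
proof (induction F rule: finite_induct)
  case empty
  then show ?case
    by (intro exI[of _ "0::nat"] exI[of _ "\<lambda>_. 0"]) (simp add: Let_def L2_inner_zero)
next
  case (insert y F)
  then obtain n :: nat and e and f :: "nat \<Rightarrow> 'l L2_dual" where P: "let P = (\<lambda>x. \<Sum>i<n. functional (f i) x *\<^sub>C e i) in
    (\<forall>y\<in>F. P y = y) \<and> (\<forall>x. P (P x) = P x) \<and> (\<forall>x y. L2_inner (P x) y = L2_inner x (P y))" by blast
  define P where "P x = (\<Sum>i<n. functional (f i) x *\<^sub>C e i)" for x
  have P1: "\<And>y. y \<in> F \<Longrightarrow> P y = y" and P2: "\<And>x. P (P x) = P x"
    and P3: "\<And>x y. L2_inner (P x) y = L2_inner x (P y)"
    using P by (auto simp: P_def Let_def)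
  have Padd: "P (x + z) = P x + P z" for x z
    by (simp add: P_def blinfun.add_right scaleC_add_left sum.distrib)
  have Pscale: "P (c *\<^sub>C x) = c *\<^sub>C P x" for c x
    by (simp add: P_def functional_scaleC_right scaleC_scaleC scaleC_sum)
  define d where "d = y - P y"
  show ?case
  proof (cases "d = 0")
    case True
    then have "P y = y" by (simp add: d_def)
    then show ?thesis using P1 P2 P3 by (intro exI[of _ n] exI[of _ e] exI[of _ f]) (auto simp: Let_def P_def)
  next
    case False
    define a where "a = complex_of_real (1 / norm d) *\<^sub>C d"
    have "P d = 0"
      using Padd[of d "P y"] P2[of y] by (simp add: d_def)
    then have Pa: "P a = 0" by (simp add: a_def Pscale scaleC_zero_right)
    have "norm a = 1" using False by (simp add: a_def norm_scaleC_L2 norm_divide)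
    then have aa: "L2_inner a a = 1" by (simp add: L2_inner_self)
    have aP: "L2_inner a (P z) = 0" for z using P3[of a z] Pa by (simp add: L2_inner_zero)
    define Q where "Q x = P x + L2_inner a x *\<^sub>C a" for x
    have "Q z = z" if "z \<in> F" for z using P1[OF that] aP[of z] by (simp add: Q_def scaleC_zero)
    moreover have "Q y = y"
    proof -
      have "L2_inner a y = L2_inner a d" using aP[of y] by (simp add: d_def L2_inner_diff_right)
      also have "\<dots> = complex_of_real (norm d)"
        using False by (simp add: a_def L2_inner_scaleC_left L2_inner_self power2_eq_square)
      finally have "L2_inner a y *\<^sub>C a = d"
        using False by (simp add: a_def scaleC_scaleC of_real_mult[symmetric] scaleC_one del: of_real_mult)
      then show ?thesis by (simp add: Q_def d_def)
    qed
    moreover have "Q (Q x) = Q x" for x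
    proof -
      have "P (Q x) = P x" unfolding Q_def Padd P2 Pscale Pa by (simp add: scaleC_zero_right)
      moreover have "L2_inner a (Q x) = L2_inner a x"
        by (simp add: Q_def L2_inner_add_right aP L2_inner_scaleC_right aa)
      ultimately show ?thesis by (simp add: Q_def)
    qed
    moreover have "L2_inner (Q x) z = L2_inner x (Q z)" for x z
      using L2_inner_commute[of a x]
      by (simp add: Q_def L2_inner_add_left L2_inner_add_right P3 L2_inner_scaleC_left L2_inner_scaleC_right)
    moreover have "(\<lambda>x. \<Sum>i<Suc n. functional ((f(n := flat a)) i) x *\<^sub>C (e(n := a)) i) = Q"
      by (rule ext) (simp add: Q_def P_def functional_flat)
    ultimately show ?thesis
      by (intro exI[of _ "Suc n"] exI[of _ "e(n := a)"] exI[of _ "f(n := flat a)"]) (simp only: Let_def, auto)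
  qed
qed

text \<open>Points of a finite \<open>\<epsilon>\<close>-net for the image of the unit ball are
  fixed by \<open>P\<close>, and the complementary projection does not increase norms. Hence it
  sends \<open>T v\<close> to its value on the difference from a net point, which has norm at most
  \<open>\<epsilon>\<close>, and \<open>P\<close> after \<open>T\<close> is the
  approximation.\<close>

lemma finite_rank_dense:
  assumes T: "T \<in> compact_ops" and \<epsilon>: "\<epsilon> > 0"
  shows "\<exists>n u f. norm (T - (\<Sum>i<n::nat. rank_one (u i) (f i))) \<le> \<epsilon>"
proof -
  have "compact (closure (T ` cball 0 1))" using T by (simp add: compact_ops_def)
  then obtain F where F: "finite F" "closure (T ` cball 0 1) \<subseteq> (\<Union>y\<in>F. ball y \<epsilon>)"
    using \<epsilon> compact_imp_seq_compact seq_compact_imp_totally_bounded by metis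
  obtain n :: nat and e and f where P: "let P = (\<lambda>x. \<Sum>i<n. functional (f i) x *\<^sub>C e i) in
    (\<forall>y\<in>F. P y = y) \<and> (\<forall>x. P (P x) = P x) \<and> (\<forall>x y. L2_inner (P x) y = L2_inner x (P y))"
    using finite_rank_projection[OF F(1)] by blast
  define P where "P x = (\<Sum>i<n. functional (f i) x *\<^sub>C e i)" for x
  have P1: "\<And>y. y \<in> F \<Longrightarrow> P y = y" and P2: "\<And>x. P (P x) = P x"
    and P3: "\<And>x y. L2_inner (P x) y = L2_inner x (P y)"
    using P by (auto simp: P_def Let_def)
  have Padd: "P (x + z) = P x + P z" for x z
    by (simp add: P_def blinfun.add_right scaleC_add_left sum.distrib)
  have Pdiff: "P (x - z) = P x - P z" for x z using Padd[of "x - z" z] by simp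
  \<comment> \<open>A self-adjoint idempotent splits \<open>x\<close> orthogonally into
    \<open>P x\<close> and \<open>x - P x\<close>.\<close>
  have contr: "norm (x - P x) \<le> norm x" for x
  proof -
    have "L2_inner (P x) (P x) = L2_inner (P x) x" using P3[of "P x" x] P2 by simp
    then have "inner (P x) (x - P x) = 0" by (simp add: inner_L2_def L2_inner_diff_right)
    then have "(norm x)\<^sup>2 = (norm (P x))\<^sup>2 + (norm (x - P x))\<^sup>2"
      using norm_add_Pythagorean[of "P x" "x - P x"] by (simp add: orthogonal_def)
    then have "(norm (x - P x))\<^sup>2 \<le> (norm x)\<^sup>2"
      by (simp only: le_add_same_cancel2 zero_le_power2)
    then show ?thesis by (rule power2_le_imp_le[OF _ norm_ge_zero])
  qed
  define S where "S = (\<Sum>i<n. rank_one (e i) (dual_comp (f i) T))"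
  have S: "S v = P (T v)" for v
    unfolding S_def P_def
    by (simp add: blinfun.sum_left rank_one_apply functional_dual_comp complex_linear_compact_ops[OF T])
  have ball: "norm ((T - S) v) \<le> \<epsilon>" if "norm v \<le> 1" for v
  proof -
    have "T v \<in> closure (T ` cball 0 1)" using that by (intro subsetD[OF closure_subset imageI]) simp
    then obtain y where y: "y \<in> F" "dist y (T v) < \<epsilon>" using F(2) by auto
    have "(T - S) v = (T v - y) - P (T v - y)"
      using P1[OF y(1)] by (simp add: blinfun.diff_left S Pdiff)
    then have "norm ((T - S) v) \<le> norm (T v - y)" using contr by simp
    then show ?thesis using y(2) by (simp add: dist_norm norm_minus_commute)
  qed
  have "norm (T - S) \<le> \<epsilon>"
  proof (rule norm_blinfun_bound)
    fix v
    show "norm ((T - S) v) \<le> \<epsilon> * norm v"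
    proof (cases "v = 0")
      case False
      have "norm ((T - S) (v /\<^sub>R norm v)) \<le> \<epsilon>" using False by (intro ball) simp
      then show ?thesis using False by (simp add: blinfun.scaleR_right field_simps)
    qed simp
  qed (use \<epsilon> in simp)
  then show ?thesis
    unfolding S_def by (intro exI[of _ n] exI[of _ e] exI[of _ "\<lambda>i. dual_comp (f i) T"])
qed

section \<open>Compatible complex structures are conjugate under the symplectic group\<close>

context
  fixes w :: "'v::euclidean_space \<Rightarrow> 'v \<Rightarrow> real"
  assumes sv: "symplectic_vector_space w"
begin

lemma bilinear_form: "bilinear w" and form_self [simp]: "w u u = 0"
  using sv by (auto simp: symplectic_vector_space_def)

lemmas form_simps = bilinear_ladd[OF bilinear_form] bilinear_radd[OF bilinear_form]
  bilinear_lmul[OF bilinear_form] bilinear_rmul[OF bilinear_form]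
  bilinear_lneg[OF bilinear_form] bilinear_rneg[OF bilinear_form]
  bilinear_lzero[OF bilinear_form] bilinear_rzero[OF bilinear_form]
  bilinear_lsub[OF bilinear_form] bilinear_rsub[OF bilinear_form]

lemma linear_form_right: "linear (w u)" and linear_form_left: "linear (\<lambda>v. w v u)"
  using bilinear_form by (auto simp: bilinear_def)

lemma form_skew: "w u v = - w v u"
proof -
  have "w (u + v) (u + v) = w u u + w v v + w u v + w v u"
    by (simp only: form_simps add_ac)
  then show ?thesis unfolding form_self by linarith
qed

lemma form_complex_structure:
  assumes "compatible_complex_structure w j"
  shows "w (j u) (j v) = w u v" "w u (j v) = - w (j u) v" "linear j" "j (j u) = - u"
proof -
  have j: "\<And>u. j (j u) = - u" "\<And>u v. w (j u) v = w (j v) u"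
    using assms by (auto simp: compatible_complex_structure_def)
  show "w (j u) (j v) = w u v"
    using j(2)[of u "j v"] form_skew[of u v] by (simp add: j(1) form_simps)
  show "w u (j v) = - w (j u) v"
    using j(2)[of u v] form_skew[of u "j v"] by simp
  show "linear j" "j (j u) = - u" using assms by (auto simp: compatible_complex_structure_def)
qed

text \<open>The required equations are \<open>2 * k\<close> linear conditions in a space of larger
  dimension, so they have a nonzero solution. Positivity of \<open>w (j x) x\<close> allows it to be
  normalised.\<close>

lemma unitary_family_extend:
  assumes j: "compatible_complex_structure w j" and "2 * k < DIM('v)"
  shows "\<exists>x. w (j x) x = 1 \<and> (\<forall>a<k. w (e a) x = 0 \<and> w (j (e a)) x = 0)"
proof -
  \<comment> \<open>\<open>r u\<close> represents the functional \<open>w u\<close> by the inner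
    product of the type, so that the conditions become orthogonality to a set of at most
    \<open>2 * k\<close> vectors.\<close>
  define r where "r u = (\<Sum>b\<in>Basis. w u b *\<^sub>R b)" for u
  have r: "r u \<bullet> v = w u v" for u v
  proof -
    have "w u v = w u (\<Sum>b\<in>Basis. (v \<bullet> b) *\<^sub>R b)" by (simp add: euclidean_representation)
    also have "\<dots> = (\<Sum>b\<in>Basis. w u b * (b \<bullet> v))"
      by (simp add: linear_sum[OF linear_form_right] linear_scale[OF linear_form_right] inner_commute mult.commute)
    also have "\<dots> = r u \<bullet> v" by (simp add: r_def inner_sum_left)
    finally show ?thesis by simp
  qed
  let ?A = "(\<lambda>a. r (e a)) ` {..<k} \<union> (\<lambda>a. r (j (e a))) ` {..<k}"
  have "dim ?A \<le> card ?A" by (rule dim_le_card') simp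
  also have "\<dots> \<le> card ((\<lambda>a. r (e a)) ` {..<k}) + card ((\<lambda>a. r (j (e a))) ` {..<k})"
    by (rule card_Un_le)
  also have "\<dots> \<le> k + k" using card_image_le[of "{..<k}"] by (intro add_mono) auto
  finally have "dim ?A < DIM('v)" using assms(2) by simp
  then obtain x where x: "x \<noteq> 0" "\<And>y. y \<in> span ?A \<Longrightarrow> orthogonal x y"
    using orthogonal_to_subspace_exists by metis
  have x0: "w (e a) x = 0" "w (j (e a)) x = 0" if "a < k" for a
    using x(2)[of "r (e a)"] x(2)[of "r (j (e a))"] that r[symmetric]
    by (auto simp: orthogonal_def inner_commute intro!: span_base)
  have pos: "w (j x) x > 0" using j x(1) by (auto simp: compatible_complex_structure_def)
  define c where "c = 1 / sqrt (w (j x) x)"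
  have "c * c * w (j x) x = 1" using pos by (simp add: c_def field_simps)
  then have "w (j (c *\<^sub>R x)) (c *\<^sub>R x) = 1"
    using form_complex_structure(3)[OF j] by (simp add: linear_scale form_simps mult.assoc)
  then show ?thesis using x0 by (intro exI[of _ "c *\<^sub>R x"]) (simp add: form_simps)
qed

text \<open>The equations express orthonormality for the Hermitian form whose real part is
  \<open>w (j u) v\<close> and whose imaginary part is, up to sign, \<open>w u v\<close>.\<close>

lemma unitary_family_exists:
  assumes j: "compatible_complex_structure w j"
  shows "2 * k \<le> DIM('v) \<Longrightarrow>
    \<exists>e. \<forall>a<k. \<forall>b<k. w (j (e a)) (e b) = (if a = b then 1 else 0) \<and> w (e a) (e b) = 0"
proof (induction k)
  case (Suc k)
  then obtain e where e: "\<forall>a<k. \<forall>b<k. w (j (e a)) (e b) = (if a = b then 1 else 0) \<and> w (e a) (e b) = 0"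
    by auto
  obtain x where x: "w (j x) x = 1" "\<forall>a<k. w (e a) x = 0 \<and> w (j (e a)) x = 0"
    using unitary_family_extend[OF j, of k e] Suc.prems by auto
  have "w (j x) (e a) = 0 \<and> w x (e a) = 0" if "a < k" for a
    using x(2) that form_skew[of x "e a"] form_skew[of "j x" "e a"] form_complex_structure(2)[OF j, of "e a" x] by auto
  then show ?case using e x by (intro exI[of _ "e(k := x)"]) (auto simp: less_Suc_eq)
qed simp

lemma orthonormal_independent:
  assumes j: "compatible_complex_structure w j" and "finite A"
    and on: "\<And>x y. x \<in> A \<Longrightarrow> y \<in> A \<Longrightarrow> w (j x) y = (if x = y then 1 else 0)"
  shows "independent A"
proof (rule independent_if_scalars_zero)
  fix f x assume f: "(\<Sum>x\<in>A. f x *\<^sub>R x) = 0" and x: "x \<in> A"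
  have "0 = w (j x) (\<Sum>y\<in>A. f y *\<^sub>R y)" using f by (simp add: form_simps)
  also have "\<dots> = (\<Sum>y\<in>A. f y * w (j x) y)"
    by (simp add: linear_sum[OF linear_form_right] linear_scale[OF linear_form_right])
  also have "\<dots> = (\<Sum>y\<in>A. if x = y then f y else 0)" using x on by (intro sum.cong) auto
  also have "\<dots> = f x" using x assms(2) by simp
  finally show "f x = 0" by simp
qed fact

text \<open>A nonzero such \<open>r\<close>, normalised, would together with the vectors
  \<open>e a\<close> and \<open>j (e a)\<close> form \<open>2 * n + 1\<close> orthonormal and hence
  independent vectors.\<close>

lemma unitary_family_complete:
  assumes j: "compatible_complex_structure w j" and n: "DIM('v) = 2 * n"
    and e: "\<And>a b. a < n \<Longrightarrow> b < n \<Longrightarrow> w (j (e a)) (e b) = (if a = b then 1 else 0)"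
      "\<And>a b. a < n \<Longrightarrow> b < n \<Longrightarrow> w (e a) (e b) = 0"
    and r: "\<And>a. a < n \<Longrightarrow> w (e a) r = 0" "\<And>a. a < n \<Longrightarrow> w (j (e a)) r = 0"
  shows "r = 0"
proof (rule ccontr)
  assume "r \<noteq> 0"
  note fc = form_complex_structure[OF j]
  have pos: "w (j r) r > 0" using j \<open>r \<noteq> 0\<close> by (auto simp: compatible_complex_structure_def)
  define x where "x = (1 / sqrt (w (j r) r)) *\<^sub>R r"
  have "(1 / sqrt (w (j r) r)) * (1 / sqrt (w (j r) r)) * w (j r) r = 1" using pos by (simp add: field_simps)
  then have x1: "w (j x) x = 1"
    using fc(3) unfolding x_def by (simp add: linear_scale form_simps mult.assoc)
  have x0: "w (e a) x = 0" "w (j (e a)) x = 0" "w (j x) (e a) = 0" "w (j x) (j (e a)) = 0" if "a < n" for a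
  proof -
    show *: "w (e a) x = 0" "w (j (e a)) x = 0" using r[OF that] by (auto simp: x_def form_simps)
    show "w (j x) (e a) = 0" "w (j x) (j (e a)) = 0"
      using * fc(1)[of x "e a"] fc(2)[of x "e a"] form_skew[of x "e a"] form_skew[of x "j (e a)"] by auto
  qed
  let ?E = "e ` {..<n}" and ?F = "(\<lambda>a. j (e a)) ` {..<n}"
  have inj: "inj_on e {..<n}" "inj_on (\<lambda>a. j (e a)) {..<n}"
    using e(1) by (auto simp: inj_on_def) (metis zero_neq_one)+
  have ef: "e a \<noteq> j (e b)" if "a < n" "b < n" for a b
    using e[of a b] e[of a a] e[of b b] that fc(1)[of "e b" "e a"] fc(1)[of "e a" "e b"]
    by (metis e(2) fc(1) zero_neq_one)
  have xe: "x \<notin> ?E" "x \<notin> ?F" using x0 x1 by (auto simp: fc(1))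
  have "card (?E \<union> ?F) = 2 * n"
    using inj ef by (subst card_Un_disjoint) (auto simp: card_image)
  then have "card (insert x (?E \<union> ?F)) = Suc (2 * n)" using xe by simp
  moreover have "independent (insert x (?E \<union> ?F))"
  proof (rule orthonormal_independent[OF j])
    have pairing: "w (j (j (e a))) (e b) = 0" "w (j (j (e a))) (j (e b)) = (if a = b then 1 else 0)"
        "w (j (e a)) (j (e b)) = 0" "w (j (j (e a))) x = 0"
        "e a = e b \<longleftrightarrow> a = b" "j (e a) = j (e b) \<longleftrightarrow> a = b" "e a \<noteq> j (e b)" "j (e b) \<noteq> e a"
        "x \<noteq> e a" "x \<noteq> j (e a)" "e a \<noteq> x" "j (e a) \<noteq> x" if "a < n" "b < n" for a b
      using that e[OF that] x0[OF that(1)] xe ef[OF that] inj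
      by (auto simp: fc(1) fc(4) fc(2) form_simps inj_on_def linear_neg[OF fc(3)])
    fix y z assume "y \<in> insert x (?E \<union> ?F)" "z \<in> insert x (?E \<union> ?F)"
    then show "w (j y) z = (if y = z then 1 else 0)"
      by (elim insertE UnE imageE) (simp_all add: pairing e x0 x1)
  qed simp
  ultimately show False using independent_card_le[of "insert x (?E \<union> ?F)"] n by simp
qed

text \<open>\<open>B\<close> carries a unitary basis for \<open>j\<close> to one for
  \<open>j'\<close>. It serves to turn an arbitrary symplectic frame into a unitary one.\<close>

lemma complex_structures_conjugate:
  assumes j: "compatible_complex_structure w j" and j': "compatible_complex_structure w j'"
    and n: "DIM('v) = 2 * n"
  shows "\<exists>B. linear B \<and> (\<forall>u v. w (B u) (B v) = w u v) \<and> (\<forall>v. B (j v) = j' (B v))"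
proof -
  note fc = form_complex_structure[OF j] and fc' = form_complex_structure[OF j']
  obtain e where e: "\<And>a b. a < n \<Longrightarrow> b < n \<Longrightarrow> w (j (e a)) (e b) = (if a = b then 1 else 0)"
      "\<And>a b. a < n \<Longrightarrow> b < n \<Longrightarrow> w (e a) (e b) = 0"
    using unitary_family_exists[OF j, of n] n by auto
  obtain e' where e': "\<And>a b. a < n \<Longrightarrow> b < n \<Longrightarrow> w (j' (e' a)) (e' b) = (if a = b then 1 else 0)"
      "\<And>a b. a < n \<Longrightarrow> b < n \<Longrightarrow> w (e' a) (e' b) = 0"
    using unitary_family_exists[OF j', of n] n by auto
  \<comment> \<open>The coordinates of \<open>v\<close> along \<open>e a\<close> and
    \<open>j (e a)\<close> are \<open>w (j (e a)) v\<close> and \<open>- w (e a) v\<close>; the sign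
    comes from \<open>w (e a) (j (e a)) = - 1\<close>.\<close>
  define B where "B v = (\<Sum>a<n. w (j (e a)) v *\<^sub>R e' a - w (e a) v *\<^sub>R j' (e' a))" for v
  have lin: "linear B"
    unfolding B_def by (intro linearI) (simp_all add: form_simps algebra_simps sum.distrib sum_subtractf scaleR_sum_right)
  \<comment> \<open>The difference of \<open>v\<close> and its expansion pairs to zero with all
    basis vectors, so it vanishes by completeness.\<close>
  have expand: "(\<Sum>a<n. w (j (e a)) v *\<^sub>R e a - w (e a) v *\<^sub>R j (e a)) = v" for v
  proof -
    let ?P = "\<Sum>a<n. w (j (e a)) v *\<^sub>R e a - w (e a) v *\<^sub>R j (e a)"
    have "w (e b) (v - ?P) = 0 \<and> w (j (e b)) (v - ?P) = 0" if b: "b < n" for b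
    proof -
      have "w (e b) ?P = (\<Sum>a<n. w (j (e a)) v * w (e b) (e a) - w (e a) v * w (e b) (j (e a)))"
        by (simp add: linear_sum[OF linear_form_right] form_simps)
      also have "\<dots> = (\<Sum>a<n. if a = b then w (e a) v else 0)"
        using b e by (intro sum.cong) (auto simp: fc(2))
      also have "\<dots> = w (e b) v" using b by simp
      finally have 1: "w (e b) ?P = w (e b) v" .
      have "w (j (e b)) ?P = (\<Sum>a<n. w (j (e a)) v * w (j (e b)) (e a) - w (e a) v * w (j (e b)) (j (e a)))"
        by (simp add: linear_sum[OF linear_form_right] form_simps)
      also have "\<dots> = (\<Sum>a<n. if a = b then w (j (e a)) v else 0)"
        using b e by (intro sum.cong) (auto simp: fc(1))
      also have "\<dots> = w (j (e b)) v" using b by simp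
      finally have 2: "w (j (e b)) ?P = w (j (e b)) v" .
      show ?thesis using 1 2 by (simp add: form_simps(10))
    qed
    then have "v - ?P = 0" using unitary_family_complete[OF j n e] by blast
    then show ?thesis by simp
  qed
  have pair: "w (e' b) (B v) = w (e b) v" "w (j' (e' b)) (B v) = w (j (e b)) v" if b: "b < n" for b v
  proof -
    have "w (e' b) (B v) = (\<Sum>a<n. w (j (e a)) v * w (e' b) (e' a) - w (e a) v * w (e' b) (j' (e' a)))"
      unfolding B_def by (simp add: linear_sum[OF linear_form_right] form_simps)
    also have "\<dots> = (\<Sum>a<n. if a = b then w (e a) v else 0)"
      using b e' by (intro sum.cong) (auto simp: fc'(2))
    finally show "w (e' b) (B v) = w (e b) v" using b by simp
    have "w (j' (e' b)) (B v) = (\<Sum>a<n. w (j (e a)) v * w (j' (e' b)) (e' a) - w (e a) v * w (j' (e' b)) (j' (e' a)))"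
      unfolding B_def by (simp add: linear_sum[OF linear_form_right] form_simps)
    also have "\<dots> = (\<Sum>a<n. if a = b then w (j (e a)) v else 0)"
      using b e' by (intro sum.cong) (auto simp: fc'(1))
    finally show "w (j' (e' b)) (B v) = w (j (e b)) v" using b by simp
  qed
  have "w (B u) (B v) = w u v" for u v
  proof -
    have "w (B u) (B v) = (\<Sum>a<n. w (j (e a)) u * w (e' a) (B v) - w (e a) u * w (j' (e' a)) (B v))"
      unfolding B_def[of u] by (simp add: linear_sum[OF linear_form_left] form_simps)
    also have "\<dots> = (\<Sum>a<n. w (j (e a)) u * w (e a) v - w (e a) u * w (j (e a)) v)"
      by (simp add: pair)
    also have "\<dots> = w (\<Sum>a<n. w (j (e a)) u *\<^sub>R e a - w (e a) u *\<^sub>R j (e a)) v"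
      by (simp add: linear_sum[OF linear_form_left] form_simps)
    finally show ?thesis by (simp add: expand)
  qed
  moreover have "B (j v) = j' (B v)" for v
    unfolding B_def
    by (simp add: linear_sum[OF fc'(3)] linear_diff[OF fc'(3)] linear_scale[OF fc'(3)] fc(2) fc(4) fc'(4) form_simps add.commute)
  ultimately show ?thesis using lin by blast
qed

end

section \<open>Charts and tangent spaces\<close>

context
  fixes A :: "('x::{t2_space, second_countable_topology}, 'e::euclidean_space) atlas"
  assumes manifold: "smooth_manifold A"
begin

lemma open_chart: "c \<in> A \<Longrightarrow> open (fst c)"
  and open_chart_image: "c \<in> A \<Longrightarrow> open (snd c ` fst c)"
  using manifold by (auto simp: smooth_manifold_def)

lemma chart_homeomorphism: "c \<in> A \<Longrightarrow> homeomorphism (fst c) (snd c ` fst c) (snd c) (chart_inv c)"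
  using manifold by (auto simp: smooth_manifold_def)

lemma chart_inv_chart: "c \<in> A \<Longrightarrow> x \<in> fst c \<Longrightarrow> chart_inv c (snd c x) = x"
  by (rule homeomorphism_apply1[OF chart_homeomorphism])

lemma chart_chart_inv: "c \<in> A \<Longrightarrow> y \<in> snd c ` fst c \<Longrightarrow> snd c (chart_inv c y) = y"
  by (rule homeomorphism_apply2[OF chart_homeomorphism])

lemma chart_inv_in: "c \<in> A \<Longrightarrow> y \<in> snd c ` fst c \<Longrightarrow> chart_inv c y \<in> fst c"
  using chart_inv_chart[of c] by auto

lemma open_chart_image_Int:
  assumes "c \<in> A" "open W"
  shows "open (snd c ` (fst c \<inter> W))"
proof -
  have "snd c ` (fst c \<inter> W) = snd c ` fst c \<inter> chart_inv c -` W"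
    using chart_inv_chart[OF assms(1)] by force
  moreover have "continuous_on (snd c ` fst c) (chart_inv c)"
    using chart_homeomorphism[OF assms(1)] by (simp add: homeomorphism_def)
  ultimately show ?thesis
    using continuous_open_preimage[OF _ open_chart_image[OF assms(1)] assms(2)] by simp
qed

lemma some_chart_at: "(SOME c. c \<in> charts_at A x) \<in> charts_at A x"
proof -
  have "\<Union> (fst ` A) = UNIV" using manifold by (simp add: smooth_manifold_def)
  then obtain c where "c \<in> A" "x \<in> fst c" by blast
  then show ?thesis by - (rule someI[of _ c], simp add: charts_at_def)
qed

lemma smooth_transition:
  "c \<in> A \<Longrightarrow> d \<in> A \<Longrightarrow> smooth_on (snd c ` (fst c \<inter> fst d)) (\<lambda>y. snd d (chart_inv c y))"
  using manifold unfolding smooth_manifold_def o_def by blast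

lemma open_transition: "c \<in> A \<Longrightarrow> d \<in> A \<Longrightarrow> open (snd c ` (fst c \<inter> fst d))"
  by (intro open_chart_image_Int open_chart)

lemma charts_atD: "c \<in> charts_at A x \<Longrightarrow> c \<in> A" "c \<in> charts_at A x \<Longrightarrow> x \<in> fst c"
  by (auto simp: charts_at_def)

lemma chart_change_has_derivative:
  assumes "c \<in> charts_at A x" "d \<in> charts_at A x"
  shows "((\<lambda>y. snd d (chart_inv c y)) has_derivative chart_change c d x) (at (snd c x))"
proof -
  have "snd c x \<in> snd c ` (fst c \<inter> fst d)" using assms charts_atD by blast
  from smooth_on_has_derivative[OF smooth_transition this] show ?thesis
    using assms charts_atD unfolding chart_change_def o_def by blast
qed

lemma linear_chart_change: "c \<in> charts_at A x \<Longrightarrow> d \<in> charts_at A x \<Longrightarrow> linear (chart_change c d x)"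
  using chart_change_has_derivative has_derivative_linear by blast

lemma chart_change_self:
  assumes c: "c \<in> charts_at A x"
  shows "chart_change c c x v = v"
proof -
  have c': "c \<in> A" "x \<in> fst c" using c charts_atD by auto
  have "frechet_derivative (snd c \<circ> chart_inv c) (at (snd c x)) = frechet_derivative (\<lambda>y. y) (at (snd c x))"
    using chart_chart_inv[OF c'(1)] c'
    by (intro frechet_derivative_cong_open[OF open_chart_image[OF c'(1)]]) auto
  then show ?thesis
    unfolding chart_change_def using frechet_derivative_eq[OF has_derivative_ident] by simp
qed

text \<open>The chain rule. The composite of two transitions agrees with the direct one only near
  the point, so the derivatives are compared on an open overlap.\<close>

lemma chart_change_chart_change:
  assumes c: "c \<in> charts_at A x" and d: "d \<in> charts_at A x" and e: "e \<in> charts_at A x"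
  shows "chart_change d e x (chart_change c d x v) = chart_change c e x v"
proof -
  note cA = charts_atD[OF c] and dA = charts_atD[OF d] and eA = charts_atD[OF e]
  have x: "chart_inv c (snd c x) = x" by (rule chart_inv_chart[OF cA])
  have "((\<lambda>y. snd e (chart_inv d y)) \<circ> (\<lambda>y. snd d (chart_inv c y)) has_derivative
      chart_change d e x \<circ> chart_change c d x) (at (snd c x))"
    using chart_change_has_derivative[OF c d] chart_change_has_derivative[OF d e]
    by (intro diff_chain_at) (simp_all add: x)
  then have "((\<lambda>y. snd e (chart_inv c y)) has_derivative chart_change d e x \<circ> chart_change c d x) (at (snd c x))"
  proof (rule has_derivative_transform_within_open)
    show "open (snd c ` (fst c \<inter> fst d))" by (rule open_transition[OF cA(1) dA(1)])
    show "snd c x \<in> snd c ` (fst c \<inter> fst d)" using cA dA by auto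
    show "((\<lambda>y. snd e (chart_inv d y)) \<circ> (\<lambda>y. snd d (chart_inv c y))) y = snd e (chart_inv c y)"
      if "y \<in> snd c ` (fst c \<inter> fst d)" for y
      using that chart_inv_chart[OF cA(1)] chart_inv_chart[OF dA(1)] by auto
  qed
  from has_derivative_unique[OF this chart_change_has_derivative[OF c e]]
  show ?thesis by (metis o_apply)
qed

lemma tspace_outside: "t \<in> tspace A x \<Longrightarrow> c \<notin> charts_at A x \<Longrightarrow> t c = 0"
  unfolding tspace_def by blast

lemma tspace_change:
  "t \<in> tspace A x \<Longrightarrow> c \<in> charts_at A x \<Longrightarrow> d \<in> charts_at A x \<Longrightarrow> chart_change c d x (t c) = t d"
  unfolding tspace_def by fastforce

lemma tspaceI:
  "(\<And>c. c \<notin> charts_at A x \<Longrightarrow> t c = 0) \<Longrightarrow>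
    (\<And>c d. c \<in> charts_at A x \<Longrightarrow> d \<in> charts_at A x \<Longrightarrow> chart_change c d x (t c) = t d) \<Longrightarrow> t \<in> tspace A x"
  unfolding tspace_def by fastforce

lemma tspace_eqI:
  assumes t: "t \<in> tspace A x" and u: "u \<in> tspace A x" and c: "c \<in> charts_at A x" and "t c = u c"
  shows "t = u"
proof
  fix d
  show "t d = u d"
  proof (cases "d \<in> charts_at A x")
    case True
    then show ?thesis using tspace_change[OF t c True] tspace_change[OF u c True] assms(4) by metis
  next
    case False
    then show ?thesis using tspace_outside[OF t] tspace_outside[OF u] by simp
  qed
qed

lemma subspace_tspace: "subspace (tspace A x)"
proof (rule subspaceI)
  show "0 \<in> tspace A x" by (rule tspaceI) (simp_all add: linear_0[OF linear_chart_change])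
  show "t + u \<in> tspace A x" if "t \<in> tspace A x" "u \<in> tspace A x" for t u
    using that
    by (intro tspaceI) (simp_all add: tspace_outside tspace_change linear_add[OF linear_chart_change])
  show "r *\<^sub>R t \<in> tspace A x" if "t \<in> tspace A x" for r t
    using that
    by (intro tspaceI) (simp_all add: tspace_outside tspace_change linear_scale[OF linear_chart_change] scaleR_fun_def)
qed

lemma coord_vec_in_tspace: "c \<in> charts_at A x \<Longrightarrow> coord_vec A c x v \<in> tspace A x"
  by (intro tspaceI) (simp_all add: coord_vec_def chart_change_chart_change)

lemma coord_vec_apply: "c \<in> charts_at A x \<Longrightarrow> d \<in> charts_at A x \<Longrightarrow> coord_vec A c x v d = chart_change c d x v"
  by (simp add: coord_vec_def)

lemma coord_vec_same: "c \<in> charts_at A x \<Longrightarrow> coord_vec A c x v c = v"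
  by (simp add: coord_vec_def chart_change_self)

lemma coord_vec_components: "c \<in> charts_at A x \<Longrightarrow> t \<in> tspace A x \<Longrightarrow> coord_vec A c x (t c) = t"
  by (rule tspace_eqI[of _ x _ c]) (auto simp: coord_vec_in_tspace coord_vec_same)

lemma map_coord_vec_components:
  "c \<in> charts_at A x \<Longrightarrow> set ts \<subseteq> tspace A x \<Longrightarrow> map (coord_vec A c x) (map (\<lambda>t. t c) ts) = ts"
  by (induction ts) (auto simp: coord_vec_components)

lemma set_map_coord_vec: "c \<in> charts_at A x \<Longrightarrow> set (map (coord_vec A c x) vs) \<subseteq> tspace A x"
  by (auto simp: coord_vec_in_tspace)

lemma linear_coord_vec: "c \<in> charts_at A x \<Longrightarrow> linear (coord_vec A c x)"
  by (intro linearI) (auto simp: coord_vec_def fun_eq_iff scaleR_fun_def linear_add[OF linear_chart_change]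
      linear_scale[OF linear_chart_change])

lemma coord_vec_change:
  assumes "c \<in> charts_at A x" "d \<in> charts_at A x"
  shows "coord_vec A c x v = coord_vec A d x (chart_change c d x v)"
  using assms by (intro tspace_eqI[of _ x _ d]) (auto simp: coord_vec_in_tspace coord_vec_same coord_vec_apply)

lemma charts_at_chart_inv:
  assumes "c \<in> A" "d \<in> A" "y \<in> snd c ` (fst c \<inter> fst d)"
  shows "c \<in> charts_at A (chart_inv c y)" "d \<in> charts_at A (chart_inv c y)"
  using assms chart_inv_chart[OF assms(1)] by (auto simp: charts_at_def)

lemma chart_change_chart_inv:
  assumes "c \<in> A" "d \<in> A" "y \<in> snd c ` (fst c \<inter> fst d)"
  shows "chart_change c d (chart_inv c y) = frechet_derivative (\<lambda>y. snd d (chart_inv c y)) (at y)"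
proof -
  have "snd c (chart_inv c y) = y" using assms chart_chart_inv[OF assms(1)] by blast
  then show ?thesis by (simp add: chart_change_def o_def)
qed

lemma alternating_form_coord_vec:
  assumes F: "alternating_form (tspace A x) k F" and c: "c \<in> charts_at A x"
  shows "alternating_form UNIV k (\<lambda>vs. F (map (coord_vec A c x) vs))"
  unfolding alternating_form_def
proof (intro conjI allI impI)
  fix xs :: "'e list" and i and u v :: 'e and a b
  assume *: "length xs = k \<and> set xs \<subseteq> UNIV \<and> i < k \<and> u \<in> UNIV \<and> v \<in> UNIV"
  let ?C = "coord_vec A c x"
  have "\<forall>xs i x' y a b. length xs = k \<and> set xs \<subseteq> tspace A x \<and> i < k \<and> x' \<in> tspace A x \<and> y \<in> tspace A x \<longrightarrow>
      F (xs[i := a *\<^sub>R x' + b *\<^sub>R y]) = a *\<^sub>R F (xs[i := x']) + b *\<^sub>R F (xs[i := y])"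
    using F unfolding alternating_form_def by (elim conjE)
  then have "F ((map ?C xs)[i := a *\<^sub>R ?C u + b *\<^sub>R ?C v]) =
      a *\<^sub>R F ((map ?C xs)[i := ?C u]) + b *\<^sub>R F ((map ?C xs)[i := ?C v])"
    using * coord_vec_in_tspace[OF c] set_map_coord_vec[OF c] by (metis length_map)
  then show "F (map ?C (xs[i := a *\<^sub>R u + b *\<^sub>R v])) = a *\<^sub>R F (map ?C (xs[i := u])) + b *\<^sub>R F (map ?C (xs[i := v]))"
    using linear_coord_vec[OF c] by (simp add: map_update linear_add linear_scale)
next
  fix xs :: "'e list" and i j
  assume *: "length xs = k \<and> set xs \<subseteq> UNIV \<and> i < j \<and> j < k \<and> xs ! i = xs ! j"
  have "\<forall>xs i j. length xs = k \<and> set xs \<subseteq> tspace A x \<and> i < j \<and> j < k \<and> xs ! i = xs ! j \<longrightarrow> F xs = 0"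
    using F unfolding alternating_form_def by (elim conjE)
  from this[rule_format, of "map (coord_vec A c x) xs" i j] show "F (map (coord_vec A c x) xs) = 0"
    using * set_map_coord_vec[OF c, of xs] by simp
next
  fix xs :: "'e list"
  assume *: "length xs \<noteq> k \<or> \<not> set xs \<subseteq> UNIV"
  have "\<forall>xs. length xs \<noteq> k \<or> \<not> set xs \<subseteq> tspace A x \<longrightarrow> F xs = 0"
    using F unfolding alternating_form_def by (elim conjE)
  then show "F (map (coord_vec A c x) xs) = 0" using * by simp
qed

text \<open>The coordinate form dx^I of the chart \<open>c\<close>, set to zero on lists that are
  not tangent, as \<open>alternating_form\<close> demands.\<close>

definition chart_form :: "('x, 'e) chart \<Rightarrow> 'e list \<Rightarrow> ('x, 'e) form"
  where "chart_form c I x ts = (if set ts \<subseteq> tspace A x then basis_form I (map (\<lambda>t. t c) ts) else 0)"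

lemma smooth_form_on_chart_form:
  assumes c: "c \<in> A"
  shows "smooth_form_on A (fst c) (length I) (chart_form c I)"
  unfolding smooth_form_on_def
proof (intro conjI ballI allI)
  fix x assume "x \<in> fst c"
  show "alternating_form (tspace A x) (length I) (chart_form c I x)"
    unfolding chart_form_def[abs_def]
    by (rule alternating_form_pullback[OF alternating_form_basis_form subspace_tspace]) (simp add: scaleR_fun_def)
next
  fix d and vs :: "'e list" assume d: "d \<in> A"
  let ?S = "snd d ` (fst d \<inter> fst c)"
  show "smooth_on ?S (\<lambda>y. chart_form c I (chart_inv d y) (map (coord_vec A d (chart_inv d y)) vs))"
  proof (rule smooth_on_cong)
    show "open ?S" by (rule open_transition[OF d c])
    show "smooth_on ?S (\<lambda>y. basis_form I (map (frechet_derivative (\<lambda>y. snd c (chart_inv d y)) (at y)) vs))"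
      by (rule smooth_on_basis_form_pullback[OF open_transition[OF d c] smooth_transition[OF d c]])
    fix y assume y: "y \<in> ?S"
    note ch = charts_at_chart_inv[OF d c y]
    show "basis_form I (map (frechet_derivative (\<lambda>y. snd c (chart_inv d y)) (at y)) vs) =
        chart_form c I (chart_inv d y) (map (coord_vec A d (chart_inv d y)) vs)"
      using set_map_coord_vec[OF ch(1), of vs]
      by (simp add: chart_form_def chart_change_chart_inv[OF d c y, symmetric] o_def coord_vec_apply[OF ch])
  qed
qed

lemma dual_frames_on_chart:
  assumes c: "c \<in> A"
  shows "dual_frames_on A (fst c) (\<lambda>i x. coord_vec A c x i) (\<lambda>i. chart_form c [i])"
  unfolding dual_frames_on_def
proof (intro conjI ballI)
  fix i :: 'e
  show "smooth_form_on A (fst c) 1 (chart_form c [i])"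
    using smooth_form_on_chart_form[OF c, of "[i]"] by simp
  show "smooth_field_on A (fst c) (\<lambda>x. coord_vec A c x i)"
    unfolding smooth_field_on_def
  proof (intro conjI ballI)
    show "coord_vec A c x i \<in> tspace A x" if "x \<in> fst c" for x
      using that c by (intro coord_vec_in_tspace) (simp add: charts_at_def)
    fix d assume d: "d \<in> A"
    let ?S = "snd d ` (fst d \<inter> fst c)" and ?\<phi> = "\<lambda>y. snd c (chart_inv d y)"
    show "smooth_on ?S (\<lambda>y. coord_vec A c (chart_inv d y) i d)"
    proof (rule smooth_on_cong)
      show "open ?S" by (rule open_transition[OF d c])
      show "smooth_on ?S (\<lambda>y. frechet_derivative (\<lambda>y. snd d (chart_inv c y)) (at (?\<phi> y)) i)"
      proof (rule smooth_on_compose[where f = ?\<phi> and T = "snd c ` (fst c \<inter> fst d)"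
            and g = "\<lambda>z. frechet_derivative (\<lambda>y. snd d (chart_inv c y)) (at z) i"])
        show "open ?S" "open (snd c ` (fst c \<inter> fst d))"
          using c d by (simp_all add: open_transition)
        show "smooth_on ?S ?\<phi>" by (rule smooth_transition[OF d c])
        show "smooth_on (snd c ` (fst c \<inter> fst d)) (\<lambda>z. frechet_derivative (\<lambda>y. snd d (chart_inv c y)) (at z) i)"
          by (rule smooth_on_frechet_derivative[OF smooth_transition[OF c d]])
        show "?\<phi> ` ?S \<subseteq> snd c ` (fst c \<inter> fst d)" using chart_inv_chart[OF d] by auto
      qed
      fix y assume y: "y \<in> ?S"
      note ch = charts_at_chart_inv[OF d c y]
      show "frechet_derivative (\<lambda>y. snd d (chart_inv c y)) (at (?\<phi> y)) i = coord_vec A c (chart_inv d y) i d"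
        by (simp add: coord_vec_apply[OF ch(2,1)] chart_change_def o_def)
    qed
  qed
next
  fix x and i j :: 'e assume x: "x \<in> fst c" and ij: "i \<in> Basis" "j \<in> Basis"
  have "c \<in> charts_at A x" using c x by (simp add: charts_at_def)
  then show "chart_form c [i] x [coord_vec A c x j] = (if i = j then 1 else 0)"
    using ij by (auto simp: chart_form_def coord_vec_in_tspace coord_vec_same inner_Basis delete_nth_def)
qed

text \<open>In a chart, duality only says that the coefficient map \<open>S\<close> is a left
  inverse of the synthesis map \<open>T\<close>. Both are endomorphisms of the finite dimensional
  model space, so it is a right inverse too, and that is the expansion.\<close>

lemma dual_frames_expand:
  assumes df: "dual_frames_on A W e \<epsilon>" and x: "x \<in> W" and t: "t \<in> tspace A x"
  shows "(\<Sum>i\<in>Basis. \<epsilon> i x [t] *\<^sub>R e i x) = t"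
proof -
  define c where "c = (SOME c. c \<in> charts_at A x)"
  have c: "c \<in> charts_at A x" unfolding c_def by (rule some_chart_at)
  have e: "e i x \<in> tspace A x" and \<epsilon>: "alternating_form (tspace A x) 1 (\<epsilon> i x)" if "i \<in> Basis" for i
    using df x that by (auto simp: dual_frames_on_def smooth_field_on_def smooth_form_on_def)
  have dual: "\<epsilon> i x [e j x] = (if i = j then 1 else 0)" if "i \<in> Basis" "j \<in> Basis" for i j
    using df x that by (auto simp: dual_frames_on_def)
  define L where "L i v = \<epsilon> i x [coord_vec A c x v]" for i v
  have L: "linear (L i)" if "i \<in> Basis" for i
    using linear_alternating_form_Cons[OF alternating_form_coord_vec[OF \<epsilon>[OF that] c], of "[]"]
    by (simp add: L_def[abs_def])
  have Le: "L i (e j x c) = (if i = j then 1 else 0)" if "i \<in> Basis" "j \<in> Basis" for i j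
    using dual[OF that] e[OF that(2)] by (simp add: L_def coord_vec_components[OF c])
  define S where "S v = (\<Sum>i\<in>Basis. L i v *\<^sub>R i)" for v
  define T where "T v = (\<Sum>i\<in>Basis. (v \<bullet> i) *\<^sub>R e i x c)" for v :: 'e
  have linS: "linear S"
    unfolding S_def[abs_def]
    by (intro linearI) (simp_all add: linear_add[OF L] linear_scale[OF L] scaleR_add_left sum.distrib scaleR_sum_right)
  have linT: "linear T"
    unfolding T_def[abs_def] by (intro linearI) (simp_all add: inner_add_left scaleR_add_left sum.distrib scaleR_sum_right)
  have "S (T v) = v" for v
  proof -
    have "L i (T v) = v \<bullet> i" if i: "i \<in> Basis" for i
    proof -
      have "L i (T v) = (\<Sum>j\<in>Basis. (v \<bullet> j) * L i (e j x c))"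
        unfolding T_def by (simp add: linear_sum[OF L[OF i]] linear_scale[OF L[OF i]])
      also have "\<dots> = (\<Sum>j\<in>Basis. if i = j then v \<bullet> j else 0)"
        using i Le by (intro sum.cong) auto
      finally show ?thesis using i by simp
    qed
    then show ?thesis by (simp add: S_def euclidean_representation)
  qed
  then have "S \<circ> T = id" by auto
  then have "T \<circ> S = id" using linear_inverse_left[OF linS linT] by simp
  then have TS: "T (S v) = v" for v by (metis comp_apply id_apply)
  have "(\<Sum>i\<in>Basis. L i (t c) *\<^sub>R e i x c) = t c"
    using TS[of "t c"] by (simp add: T_def S_def inner_sum_left inner_Basis if_distrib[of "\<lambda>r. _ * r"] cong: if_cong)
  moreover have "(\<Sum>i\<in>Basis. \<epsilon> i x [t] *\<^sub>R e i x) c = (\<Sum>i\<in>Basis. \<epsilon> i x [t] *\<^sub>R e i x c)"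
    by (induction rule: infinite_finite_induct) (auto simp: scaleR_fun_def)
  moreover have "(\<Sum>i\<in>Basis. \<epsilon> i x [t] *\<^sub>R e i x) \<in> tspace A x"
    using e subspace_tspace by (intro subspace_sum subspace_scale)
  ultimately show ?thesis
    using t c by (intro tspace_eqI[of _ x _ c]) (auto simp: L_def coord_vec_components)
qed

end

section \<open>Associated bundles\<close>

text \<open>Common to the classes \<open>clsH\<close>, \<open>clsHcheck\<close> and
  \<open>clsCH\<close>, where \<open>N\<close> is the whole group, and \<open>clsHkR\<close>, where
  \<open>N\<close> is \<open>Ktilde\<close>. Freeness makes the fibre coordinate over a fixed
  \<open>p\<close> unique.\<close>

locale associated_bundle =
  fixes N :: "'g::group_add set" and act :: "'p \<Rightarrow> 'g \<Rightarrow> 'p" and \<kappa> :: "'g \<Rightarrow> 'f \<Rightarrow> 'f"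
  assumes subgroup: "0 \<in> N" "\<And>g h. g \<in> N \<Longrightarrow> h \<in> N \<Longrightarrow> g + h \<in> N" "\<And>g. g \<in> N \<Longrightarrow> - g \<in> N"
    and act_0: "\<And>p. act p 0 = p"
    and act_act: "\<And>p g h. act (act p g) h = act p (g + h)"
    and act_free: "\<And>p g. act p g = p \<Longrightarrow> g = 0"
    and rep_0: "\<And>f. \<kappa> 0 f = f"
    and rep_add: "\<And>g h f. \<kappa> (g + h) f = \<kappa> g (\<kappa> h f)"
begin

lemma assoc_class_move:
  assumes "g \<in> N"
  shows "assoc_class N act \<kappa> (act p (- g)) (\<kappa> g f) = assoc_class N act \<kappa> p f"
proof -
  have "(act (act p (- g)) (- h), \<kappa> h (\<kappa> g f)) = (act p (- (h + g)), \<kappa> (h + g) f)" for h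
    by (simp add: act_act rep_add minus_add)
  then have "assoc_class N act \<kappa> (act p (- g)) (\<kappa> g f) = {(act p (- (h + g)), \<kappa> (h + g) f) | h. h \<in> N}"
    by (simp add: assoc_class_def)
  also have "\<dots> = assoc_class N act \<kappa> p f"
  proof -
    have "\<exists>h. x = h + g \<and> h \<in> N" if "x \<in> N" for x
      by (rule exI[of _ "x + - g"]) (use subgroup(2)[OF that subgroup(3)[OF assms]] in simp)
    then show ?thesis
      unfolding assoc_class_def using assms subgroup(2) by blast
  qed
  finally show ?thesis .
qed

lemma assoc_class_eq_iff:
  "assoc_class N act \<kappa> p f = assoc_class N act \<kappa> p' f' \<longleftrightarrow> (\<exists>g\<in>N. p' = act p (- g) \<and> f' = \<kappa> g f)"
proof
  have "(act p' (- 0), \<kappa> 0 f') \<in> assoc_class N act \<kappa> p' f'"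
    unfolding assoc_class_def using subgroup(1) by blast
  then have "(p', f') \<in> assoc_class N act \<kappa> p' f'" by (simp add: act_0 rep_0)
  moreover assume "assoc_class N act \<kappa> p f = assoc_class N act \<kappa> p' f'"
  ultimately have "(p', f') \<in> assoc_class N act \<kappa> p f" by simp
  then show "\<exists>g\<in>N. p' = act p (- g) \<and> f' = \<kappa> g f" by (auto simp: assoc_class_def)
qed (auto simp: assoc_class_move)

lemma assoc_class_inject: "assoc_class N act \<kappa> p f = assoc_class N act \<kappa> p f' \<longleftrightarrow> f = f'"
proof
  assume "assoc_class N act \<kappa> p f = assoc_class N act \<kappa> p f'"
  then obtain g where g: "p = act p (- g)" "f' = \<kappa> g f" by (auto simp: assoc_class_eq_iff)
  then have "g = 0" using act_free[of p "- g"] by simp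
  then show "f = f'" using g(2) by (simp add: rep_0)
qed simp

end

text \<open>Any other common frame differs by some \<open>h\<close>, and freeness forces both
  coordinates to be moved by the same \<open>\<kappa> h\<close>, through which the sum
  passes.\<close>

lemma fibre_add_assoc_class:
  assumes "associated_bundle N act \<kappa>" and add: "\<And>g f f'. \<kappa> g (f + f') = \<kappa> g f + \<kappa> g f'"
  shows "fibre_add (assoc_class N act \<kappa>) (assoc_class N act \<kappa> p f) (assoc_class N act \<kappa> p f') =
    assoc_class N act \<kappa> p (f + f')"
proof -
  interpret associated_bundle N act \<kappa> by fact
  show ?thesis
    unfolding fibre_add_def
  proof (rule the_equality)
    show "\<exists>q g g'. assoc_class N act \<kappa> p f = assoc_class N act \<kappa> q g \<and>
        assoc_class N act \<kappa> p f' = assoc_class N act \<kappa> q g' \<and>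
        assoc_class N act \<kappa> p (f + f') = assoc_class N act \<kappa> q (g + g')" by blast
    fix z assume "\<exists>q g g'. assoc_class N act \<kappa> p f = assoc_class N act \<kappa> q g \<and>
        assoc_class N act \<kappa> p f' = assoc_class N act \<kappa> q g' \<and> z = assoc_class N act \<kappa> q (g + g')"
    then obtain q g g' where z: "z = assoc_class N act \<kappa> q (g + g')"
      and *: "assoc_class N act \<kappa> p f = assoc_class N act \<kappa> q g" "assoc_class N act \<kappa> p f' = assoc_class N act \<kappa> q g'"
      by blast
    obtain h where h: "h \<in> N" "q = act p (- h)" "g = \<kappa> h f" using * by (auto simp: assoc_class_eq_iff)
    have "assoc_class N act \<kappa> q (\<kappa> h f') = assoc_class N act \<kappa> q g'"
      using * h by (simp add: assoc_class_move)
    then have "g' = \<kappa> h f'" by (simp add: assoc_class_inject)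
    then show "z = assoc_class N act \<kappa> p (f + f')"
      using z h by (simp add: assoc_class_move add[symmetric])
  qed
qed

lemma fibre_scale_assoc_class:
  assumes "associated_bundle N act \<kappa>" and scale: "\<And>g a f. \<kappa> g (a *\<^sub>R f) = a *\<^sub>R \<kappa> g f"
  shows "fibre_scale (assoc_class N act \<kappa>) a (assoc_class N act \<kappa> p f) = assoc_class N act \<kappa> p (a *\<^sub>R f)"
proof -
  interpret associated_bundle N act \<kappa> by fact
  show ?thesis
    unfolding fibre_scale_def
  proof (rule the_equality)
    show "\<exists>q g. assoc_class N act \<kappa> p f = assoc_class N act \<kappa> q g \<and>
        assoc_class N act \<kappa> p (a *\<^sub>R f) = assoc_class N act \<kappa> q (a *\<^sub>R g)" by blast
    fix z assume "\<exists>q g. assoc_class N act \<kappa> p f = assoc_class N act \<kappa> q g \<and> z = assoc_class N act \<kappa> q (a *\<^sub>R g)"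
    then obtain q g where z: "z = assoc_class N act \<kappa> q (a *\<^sub>R g)"
      and *: "assoc_class N act \<kappa> p f = assoc_class N act \<kappa> q g" by blast
    obtain h where h: "h \<in> N" "q = act p (- h)" "g = \<kappa> h f" using * by (auto simp: assoc_class_eq_iff)
    then show "z = assoc_class N act \<kappa> p (a *\<^sub>R f)"
      using z by (simp add: assoc_class_move scale[symmetric])
  qed
qed

section \<open>Unitary frames and the bundles of the metaplectic structure\<close>

locale kuiper =
  fixes D :: "('v::euclidean_space, 'l::euclidean_space, 'm::{t2_space, second_countable_topology},
      'g::{topological_group_add, t2_space, second_countable_topology}, 'k::euclidean_space,
      'p::{t2_space, second_countable_topology}) metaplectic_data"
    and J :: "('p \<times> 'l L2_dual) set \<Rightarrow> 'm \<times> 'l L2_dual"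
  assumes symplectic: "symplectic_vector_space (om0 D)"
    and complex_structure: "compatible_complex_structure (om0 D) (J0 D)"
    and lagrangian: "lagrangian_embedding (om0 D) (iota D)"
    and double_cover: "connected_double_cover (om0 D) (atlasG D) (lam D)"
    and ssw: "segal_shale_weil (om0 D) (J0 D) (iota D) (lam D) (ssw D)"
    and symplectic_manifold: "symplectic_manifold (atlasM D) (om D)"
    and acs: "compatible_positive_acs (atlasM D) (om D) (JM D)"
    and metaplectic: "metaplectic_structure D"
    and kuiper: "kuiper_map D J"
begin

section \<open>The covering group and its representations\<close>

abbreviation "A \<equiv> atlasM D"

lemma manifold: "smooth_manifold A"
  using symplectic_manifold by (simp add: symplectic_manifold_def)

lemma nondegenerate: "(\<And>v. om0 D u v = 0) \<Longrightarrow> u = 0"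
  using symplectic unfolding symplectic_vector_space_def by blast

lemma lam_add: "lam D (g + h) = lam D g o\<^sub>L lam D h"
  using double_cover unfolding connected_double_cover_def by blast

lemma range_lam: "range (lam D) = symplectic_group (om0 D)"
  using double_cover covering_space_imp_surjective unfolding connected_double_cover_def by blast

lemma lam_symplectic: "om0 D (lam D g u) (lam D g v) = om0 D u v"
  using range_lam unfolding symplectic_group_def by blast

text \<open>\<open>lam D 0\<close> is idempotent, and preserving a nondegenerate form makes it
  injective.\<close>

lemma lam_0: "lam D 0 v = v"
proof -
  have "lam D (0 + 0) v = lam D 0 (lam D 0 v)" unfolding lam_add by simp
  then have z: "lam D 0 (lam D 0 v - v) = 0" by (simp add: blinfun.diff_right)
  have "om0 D (lam D 0 v - v) u = 0" for u
    using lam_symplectic[of 0 "lam D 0 v - v" u] unfolding z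
    by (simp add: bilinear_lzero[OF bilinear_form[OF symplectic]])
  then show ?thesis using nondegenerate[of "lam D 0 v - v"] by simp
qed

lemma lam_minus: "lam D (- g) (lam D g v) = v" "lam D g (lam D (- g) v) = v"
  using lam_add[of "- g" g] lam_add[of g "- g"] lam_0[of v] by (metis add.left_inverse add.right_inverse blinfun_apply_blinfun_compose)+

lemma ssw_unitary: "unitary_op (ssw D g)"
  and ssw_add: "ssw D (g + h) = ssw D g o\<^sub>L ssw D h"
  using ssw unfolding segal_shale_weil_def by blast+

lemma ssw_diff: "ssw D (g - h) = ssw D g o\<^sub>L ssw D (- h)"
  and lam_diff: "lam D (g - h) = lam D g o\<^sub>L lam D (- h)"
  using ssw_add[of g "- h"] lam_add[of g "- h"] by simp_all

lemma ssw_complex_linear: "complex_linear (blinfun_apply (ssw D g))"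
  and ssw_inner: "L2_inner (ssw D g u) (ssw D g v) = L2_inner u v"
  using ssw_unitary by (auto simp: unitary_op_def)

lemma ssw_0: "ssw D 0 u = u"
proof -
  obtain v where "u = ssw D 0 v" using ssw_unitary[of 0] unfolding unitary_op_def by (metis surjD)
  then show ?thesis using ssw_add[of 0 0] by (metis add_0 blinfun_apply_blinfun_compose)
qed

lemma ssw_minus: "ssw D (- g) (ssw D g v) = v" "ssw D g (ssw D (- g) v) = v"
  using ssw_add[of "- g" g] ssw_add[of g "- g"] ssw_0[of v] by (metis add.left_inverse add.right_inverse blinfun_apply_blinfun_compose)+

lemma functional_sigma: "functional (sigma D g f) v = functional f (ssw D (- g) v)"
  by (simp add: sigma_def functional_dual_comp ssw_complex_linear)

lemma sigma_0: "sigma D 0 f = f"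
  by (rule L2_dual_eqI) (simp add: functional_sigma ssw_0)

lemma sigma_sigma: "sigma D (g + h) f = sigma D g (sigma D h f)"
  by (rule L2_dual_eqI) (simp add: functional_sigma minus_add ssw_diff)

lemma sigma_add: "sigma D g (f + f') = sigma D g f + sigma D g f'"
  by (rule L2_dual_eqI) (simp add: functional_sigma functional_add)

lemma sigma_scaleR: "sigma D g (a *\<^sub>R f) = a *\<^sub>R sigma D g f"
  by (rule L2_dual_eqI) (simp add: functional_sigma functional_scaleR)

lemma sigma_flat: "sigma D g (flat v) = flat (ssw D g v)"
proof (rule L2_dual_eqI)
  fix w
  show "functional (sigma D g (flat v)) w = functional (flat (ssw D g v)) w"
    using ssw_inner[of g v "ssw D (- g) w"] by (simp add: functional_sigma functional_flat ssw_minus)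
qed

section \<open>Fibres of the principal bundle\<close>

lemma principal: "principal_bundle (atlasG D) A (atlasP D) (projP D) (actP D)"
  using metaplectic by (simp add: metaplectic_structure_def)

lemma actP_0: "actP D p 0 = p"
  and actP_actP: "actP D (actP D p g) h = actP D p (g + h)"
  using principal unfolding principal_bundle_def by blast+

text \<open>Only the fibre over \<open>m\<close> is kept: \<open>\<psi>\<close> identifies it with
  the group acting on itself by translation, from which freeness and transitivity follow.\<close>

lemma local_trivialisation:
  obtains \<psi> where "\<And>g h. \<psi> g = \<psi> h \<Longrightarrow> g = h" "\<And>p. projP D p = m \<longleftrightarrow> (\<exists>g. p = \<psi> g)"
    "\<And>g h. actP D (\<psi> g) h = \<psi> (g + h)"
proof -
  have "\<forall>m. \<exists>W \<psi>. open W \<and> m \<in> W \<and> bij_betw \<psi> (W \<times> UNIV) (projP D -` W) \<and>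
      smooth_map_on (prod_atlas A (atlasG D)) (atlasP D) (W \<times> UNIV) \<psi> \<and>
      smooth_map_on (atlasP D) (prod_atlas A (atlasG D)) (projP D -` W) (inv_into (W \<times> UNIV) \<psi>) \<and>
      (\<forall>x\<in>W. \<forall>g h. projP D (\<psi> (x, g)) = x \<and> actP D (\<psi> (x, g)) h = \<psi> (x, g + h))"
    using principal unfolding principal_bundle_def by (elim conjE)
  then obtain W \<psi> where W: "m \<in> W" "bij_betw \<psi> (W \<times> UNIV) (projP D -` W)"
    and \<psi>: "\<forall>x\<in>W. \<forall>g h. projP D (\<psi> (x, g)) = x \<and> actP D (\<psi> (x, g)) h = \<psi> (x, g + h)"
    by metis
  have inj: "g = h" if "\<psi> (m, g) = \<psi> (m, h)" for g h
    using W that by (auto simp: bij_betw_def inj_on_def)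
  have "\<exists>g. p = \<psi> (m, g)" if "projP D p = m" for p
  proof -
    have "p \<in> \<psi> ` (W \<times> UNIV)" using W that by (auto simp: bij_betw_def)
    then obtain x g where "x \<in> W" "p = \<psi> (x, g)" by blast
    then show ?thesis using \<psi> that by auto
  qed
  then show thesis using \<psi> W(1) inj by (intro that[of "\<lambda>g. \<psi> (m, g)"]) auto
qed

lemma projP_surj: "\<exists>p. projP D p = m"
  by (rule local_trivialisation[of m]) blast

lemma projP_actP: "projP D (actP D p g) = projP D p"
  by (rule local_trivialisation[of "projP D p"]) metis

lemma actP_free: "actP D p g = p \<Longrightarrow> g = 0"
proof (rule local_trivialisation[of "projP D p"])
  fix \<psi> assume inj: "\<And>g h. \<psi> g = \<psi> h \<Longrightarrow> g = h" and fib: "\<And>q. projP D q = projP D p \<longleftrightarrow> (\<exists>g. q = \<psi> g)"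
    and act: "\<And>g h. actP D (\<psi> g) h = \<psi> (g + h)" and g: "actP D p g = p"
  obtain a where a: "p = \<psi> a" using fib by blast
  then have "a + g = a + 0" using act[of a g] g inj by simp
  then show "g = 0" by (rule add_left_imp_eq)
qed

lemma actP_transitive: "projP D p = projP D q \<Longrightarrow> \<exists>g. q = actP D p (- g)"
proof (rule local_trivialisation[of "projP D p"])
  fix \<psi> assume fib: "\<And>q. projP D q = projP D p \<longleftrightarrow> (\<exists>g. q = \<psi> g)"
    and act: "\<And>g h. actP D (\<psi> g) h = \<psi> (g + h)" and pq: "projP D p = projP D q"
  obtain a b where ab: "p = \<psi> a" "q = \<psi> b" using fib[of p] fib[of q] pq by auto
  have "actP D p (- (- (- a + b))) = \<psi> (a + (- a + b))" using act[of a] ab(1) by simp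
  also have "\<dots> = q" using ab(2) by (simp add: add.assoc[symmetric])
  finally show "\<exists>g. q = actP D p (- g)" by metis
qed

lemma associated_bundleI:
  assumes "0 \<in> N" "\<And>g h. g \<in> N \<Longrightarrow> h \<in> N \<Longrightarrow> g + h \<in> N" "\<And>g. g \<in> N \<Longrightarrow> - g \<in> N"
    "\<And>f. \<kappa> 0 f = f" "\<And>g h f. \<kappa> (g + h) f = \<kappa> g (\<kappa> h f)"
  shows "associated_bundle N (actP D) \<kappa>"
  using assms actP_0 actP_actP actP_free by unfold_locales auto

lemma assoc_sigma: "associated_bundle UNIV (actP D) (sigma D)"
  by (rule associated_bundleI) (auto simp: sigma_0 sigma_sigma)

lemma assoc_ssw: "associated_bundle UNIV (actP D) (\<lambda>g. blinfun_apply (ssw D g))"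
  by (rule associated_bundleI) (auto simp: ssw_0 ssw_add)

lemma assoc_rho: "associated_bundle UNIV (actP D) (rho D)"
  by (rule associated_bundleI)
    (auto intro!: blinfun_eqI simp: rho_def ssw_0 minus_add ssw_add ssw_diff)

lemmas clsH_inject = associated_bundle.assoc_class_inject[OF assoc_sigma, folded clsH_def]
  and clsH_move = associated_bundle.assoc_class_move[OF assoc_sigma UNIV_I, folded clsH_def]
  and clsHcheck_eq_iff = associated_bundle.assoc_class_eq_iff[OF assoc_ssw, folded clsHcheck_def]
  and clsCH_inject = associated_bundle.assoc_class_inject[OF assoc_rho, folded clsCH_def]
  and clsCH_eq_iff = associated_bundle.assoc_class_eq_iff[OF assoc_rho, folded clsCH_def]
  and clsCH_move = associated_bundle.assoc_class_move[OF assoc_rho UNIV_I, folded clsCH_def]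
  and fibre_add_clsH = fibre_add_assoc_class[OF assoc_sigma sigma_add, folded clsH_def]
  and fibre_scale_clsH = fibre_scale_assoc_class[OF assoc_sigma sigma_scaleR, folded clsH_def]

section \<open>Frames as isomorphisms, and unitary frames\<close>

abbreviation frame :: "'p \<Rightarrow> 'v \<Rightarrow> ('m, 'v) tangent" where "frame q \<equiv> snd (Lam D q)"

lemma frame_props: "linear (frame q)" "range (frame q) \<subseteq> tspace A (projP D q)"
    "om D (projP D q) [frame q u, frame q v] = om0 D u v"
proof -
  have "Lam D q \<in> symplectic_frames (om0 D) A (om D)" "fst (Lam D q) = projP D q"
    using metaplectic unfolding metaplectic_structure_def by blast+
  then show "linear (frame q)" "range (frame q) \<subseteq> tspace A (projP D q)"
    "om D (projP D q) [frame q u, frame q v] = om0 D u v"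
    unfolding symplectic_frames_def by (auto simp: split_beta)
qed

lemma frame_actP: "frame (actP D r g) v = frame r (lam D g v)"
  using metaplectic unfolding metaplectic_structure_def by (metis comp_apply)

lemma inj_frame: "inj (frame q)"
proof (rule linear_injective_0[OF frame_props(1), THEN iffD2], intro allI impI)
  fix u assume u: "frame q u = 0"
  have "om0 D u v = om0 D 0 v" for v
    using frame_props(3)[of q u v] frame_props(3)[of q 0 v] by (simp add: u linear_0[OF frame_props(1)])
  then show "u = 0"
    using nondegenerate[of u] by (simp add: bilinear_lzero[OF bilinear_form[OF symplectic]])
qed

lemma frame_in_tspace: "frame q v \<in> tspace A (projP D q)"
  using frame_props(2) by blast

lemma inv_frame_frame: "inv (frame q) (frame q v) = v"
  by (rule inv_f_f[OF inj_frame])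

text \<open>Read in a chart, the frame is an injective endomorphism of the model space and therefore
  surjective.\<close>

lemma frame_inv_frame:
  assumes t: "t \<in> tspace A (projP D q)"
  shows "frame q (inv (frame q) t) = t"
proof -
  define c where "c = (SOME c. c \<in> charts_at A (projP D q))"
  have c: "c \<in> charts_at A (projP D q)" unfolding c_def by (rule some_chart_at[OF manifold])
  have lin: "linear (\<lambda>v. frame q v c)"
    using frame_props(1)[of q] by (intro linearI) (simp_all add: linear_add linear_scale scaleR_fun_def)
  have "inj (\<lambda>v. frame q v c)"
    using tspace_eqI[OF manifold frame_in_tspace frame_in_tspace c] inj_frame[of q] by (auto simp: inj_def)
  then have "surj (\<lambda>v. frame q v c)" by (rule linear_inj_imp_surj[OF lin])
  then obtain v where "t c = frame q v c" by (metis surjD)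
  then have "t = frame q v" using tspace_eqI[OF manifold t frame_in_tspace c] by blast
  then show ?thesis by (simp add: inv_frame_frame)
qed

text \<open>For a symplectic map, preserving the inner product and commuting with
  \<open>J0 D\<close> differ only by the nondegenerate form.\<close>

lemma Ktilde_iff: "g \<in> Ktilde D \<longleftrightarrow> (\<forall>v. lam D g (J0 D v) = J0 D (lam D g v))"
proof -
  have surj: "\<exists>u. v = lam D g u" for v using lam_minus(2)[of g v] by metis
  have sub: "om0 D (u - u') v = om0 D u v - om0 D u' v" for u u' v
    by (rule bilinear_lsub[OF bilinear_form[OF symplectic]])
  have "(\<forall>u v. om0 D (J0 D (lam D g u)) (lam D g v) = om0 D (J0 D u) v) \<longleftrightarrow>
      (\<forall>u v. om0 D (J0 D (lam D g u)) (lam D g v) = om0 D (lam D g (J0 D u)) (lam D g v))"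
    by (simp add: lam_symplectic)
  also have "\<dots> \<longleftrightarrow> (\<forall>u v. om0 D (J0 D (lam D g u) - lam D g (J0 D u)) v = 0)"
    using surj by (simp add: sub) metis
  also have "\<dots> \<longleftrightarrow> (\<forall>u. J0 D (lam D g u) - lam D g (J0 D u) = 0)"
    using nondegenerate bilinear_lzero[OF bilinear_form[OF symplectic]] by metis
  finally show ?thesis
    using lam_symplectic unfolding Ktilde_def symplectic_group_def by auto
qed

lemma Ktilde_subgroup: "0 \<in> Ktilde D" "g \<in> Ktilde D \<Longrightarrow> h \<in> Ktilde D \<Longrightarrow> g + h \<in> Ktilde D"
  "g \<in> Ktilde D \<Longrightarrow> - g \<in> Ktilde D"
proof -
  show "0 \<in> Ktilde D" by (simp add: Ktilde_iff lam_0)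
  show "g \<in> Ktilde D \<Longrightarrow> h \<in> Ktilde D \<Longrightarrow> g + h \<in> Ktilde D" by (simp add: Ktilde_iff lam_add)
  show "- g \<in> Ktilde D" if g: "g \<in> Ktilde D"
    unfolding Ktilde_iff
  proof
    fix v
    have "lam D g (J0 D (lam D (- g) v)) = J0 D v" using g by (simp add: Ktilde_iff lam_minus)
    then show "lam D (- g) (J0 D v) = J0 D (lam D (- g) v)" by (metis lam_minus(1))
  qed
qed

lemma PR_iff: "q \<in> PR D m \<longleftrightarrow> projP D q = m \<and> (\<forall>v. frame q (J0 D v) = JM D m (frame q v))"
  by (simp add: PR_def)

lemma PR_projP: "q \<in> PR D m \<Longrightarrow> projP D q = m"
  by (simp add: PR_iff)

text \<open>Some group element relates the two frames by transitivity; comparing both unitarity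
  conditions through the injective frame shows that its image commutes with
  \<open>J0 D\<close>.\<close>

lemma PR_transitive:
  assumes "q \<in> PR D m" "q' \<in> PR D m"
  shows "\<exists>g\<in>Ktilde D. q' = actP D q (- g)"
proof -
  obtain g where g: "q' = actP D q (- g)" using actP_transitive[of q q'] assms by (auto simp: PR_iff)
  have "frame q (lam D (- g) (J0 D v)) = frame q (J0 D (lam D (- g) v))" for v
    using assms by (simp add: PR_iff g frame_actP)
  then have "- g \<in> Ktilde D" using inj_frame[of q] by (simp add: Ktilde_iff inj_eq)
  then show ?thesis using g Ktilde_subgroup(3)[of "- g"] by auto
qed

text \<open>A symplectic frame becomes unitary after composition with a symplectic map that conjugates \<open>J\<^sub>0\<close>
  to the complex structure pulled back from the tangent space.\<close>

lemma PR_nonempty: "\<exists>q. q \<in> PR D m"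
proof -
  obtain p where p: "projP D p = m" using projP_surj by blast
  let ?F = "frame p" and ?G = "inv (frame p)"
  note acs' = acs[unfolded compatible_positive_acs_def]
  have J1: "t \<in> tspace A m \<Longrightarrow> JM D m t \<in> tspace A m \<and> JM D m (JM D m t) = - t" for t
    using acs'[THEN conjunct1] by blast
  have J2: "t \<in> tspace A m \<Longrightarrow> u \<in> tspace A m \<Longrightarrow>
      JM D m (a *\<^sub>R t + b *\<^sub>R u) = a *\<^sub>R JM D m t + b *\<^sub>R JM D m u" for t u a b
    using acs'[THEN conjunct2, THEN conjunct1] by blast
  have J3: "t \<in> tspace A m \<Longrightarrow> u \<in> tspace A m \<Longrightarrow> om D m [JM D m t, u] = om D m [JM D m u, t]" for t u
    using acs'[THEN conjunct2, THEN conjunct2, THEN conjunct2, THEN conjunct1] by blast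
  have J4: "t \<in> tspace A m \<Longrightarrow> t \<noteq> 0 \<Longrightarrow> om D m [JM D m t, t] > 0" for t
    using acs'[THEN conjunct2, THEN conjunct2, THEN conjunct2, THEN conjunct2] by blast
  have F: "?F v \<in> tspace A m" for v using frame_in_tspace[of p] p by simp
  have FG: "t \<in> tspace A m \<Longrightarrow> ?F (?G t) = t" for t using frame_inv_frame[of t p] p by simp
  have om: "om D m [?F u, ?F v] = om0 D u v" for u v using frame_props(3)[of p] p by simp
  define j where "j v = ?G (JM D m (?F v))" for v
  have Fj: "?F (j v) = JM D m (?F v)" for v unfolding j_def using FG J1 F by blast
  have eqI: "u = v" if "?F u = ?F v" for u v using that inj_frame[of p] by (simp add: inj_eq)
  have lin: "linear j"
  proof (rule linearI)
    fix u v a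
    have "?F (j (u + v)) = ?F (j u + j v)"
      using J2[OF F F, of 1 u 1 v] by (simp add: Fj linear_add[OF frame_props(1)])
    then show "j (u + v) = j u + j v" by (rule eqI)
    have "?F (j (a *\<^sub>R u)) = ?F (a *\<^sub>R j u)"
      using J2[OF F F, of a u 0 u] by (simp add: Fj linear_scale[OF frame_props(1)])
    then show "j (a *\<^sub>R u) = a *\<^sub>R j u" by (rule eqI)
  qed
  have "compatible_complex_structure (om0 D) j"
    unfolding compatible_complex_structure_def
  proof (intro conjI allI impI)
    show "linear j" by fact
    show "j (j u) = - u" for u
      by (rule eqI) (simp add: Fj J1[OF F] linear_neg[OF frame_props(1)])
    show "om0 D (j u) v = om0 D (j v) u" for u v
      unfolding om[symmetric] Fj by (rule J3[OF F F])
    show "om0 D (j u) u > 0" if "u \<noteq> 0" for u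
      unfolding om[symmetric] Fj using that eqI[of u 0] linear_0[OF frame_props(1)] by (intro J4[OF F]) metis
  qed
  \<comment> \<open>The Lagrangian embedding supplies the half dimension.\<close>
  from complex_structures_conjugate[OF symplectic complex_structure this, of "DIM('l)"] lagrangian
  obtain B where B: "linear B" "\<And>u v. om0 D (B u) (B v) = om0 D u v" "\<And>v. B (J0 D v) = j (B v)"
    unfolding lagrangian_embedding_def by blast
  have Bl: "blinfun_apply (Blinfun B) = B"
    using B(1) by (intro bounded_linear_Blinfun_apply) (simp add: linear_linear)
  then have "Blinfun B \<in> range (lam D)" using B(2) unfolding range_lam symplectic_group_def by simp
  then obtain g where "lam D g = Blinfun B" by force
  then have "actP D p g \<in> PR D m"
    using p B(3) by (simp add: PR_iff projP_actP frame_actP Bl Fj)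
  then show ?thesis by blast
qed

lemma some_PR: "(SOME q. q \<in> PR D m) \<in> PR D m"
  using PR_nonempty by (rule someI_ex)

lemma assoc_sigma_k: "associated_bundle (Ktilde D) (actP D) (sigma_k D)"
proof (rule associated_bundleI)
  show "sigma_k D 0 f = f" for f 
  proof -
    have "blinfun_apply (lam D 0) = (\<lambda>v. v)" by (simp add: fun_eq_iff lam_0)
    then show ?thesis by (simp add: sigma_k_def sigma_0)
  qed
  show "sigma_k D (g + h) f = sigma_k D g (sigma_k D h f)" for g h f
    by (simp add: sigma_k_def fun_eq_iff sigma_sigma minus_add lam_diff o_def blinfun_compose.rep_eq)
qed (use Ktilde_subgroup in auto)

lemma sigma_k_add: "sigma_k D g (F + F') = sigma_k D g F + sigma_k D g F'"
  by (simp add: sigma_k_def fun_eq_iff sigma_add)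

lemmas clsHkR_eq_iff = associated_bundle.assoc_class_eq_iff[OF assoc_sigma_k, folded clsHkR_def]
  and clsHkR_move = associated_bundle.assoc_class_move[OF assoc_sigma_k, folded clsHkR_def]
  and fibre_add_clsHkR = fibre_add_assoc_class[OF assoc_sigma_k sigma_k_add, folded clsHkR_def]

end

section \<open>The fibre maps of a Kuiper map\<close>

context kuiper
begin

text \<open>The action of \<open>J\<close> on the fibre, read in the frame \<open>r\<close>. By
  \<open>U_move\<close> it depends only on the class of the pair.\<close>

definition U :: "'p \<Rightarrow> 'l L2_dual \<Rightarrow> 'l L2_dual"
  where "U r f = snd (J (clsH D r f))"

lemma J_clsH: "J (clsH D r f) = (projP D r, U r f)"
  using kuiper unfolding kuiper_map_def U_def by (metis prod.collapse)

lemma complex_linear_U: "complex_linear (U r)"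
  using kuiper unfolding kuiper_map_def U_def[abs_def] by blast

lemma dual_inner_U: "dual_inner (U r f) (U r g) = dual_inner f g"
  using kuiper unfolding kuiper_map_def U_def by blast

lemma linear_U: "linear (U r)"
  by (rule complex_linear_linear[OF complex_linear_U])

text \<open>\<open>topology\<close> returns the given family of open sets only when that family is a
  topology. Knowing the total space turns the homeomorphism property of \<open>J\<close> into
  bijectivity from \<open>H_bundle D\<close> onto all pairs.\<close>

lemma topspace_H_topology: "topspace (H_topology D) = H_bundle D"
proof -
  let ?L = "\<lambda>U. U \<subseteq> H_bundle D \<and> open {(p, f). clsH D p f \<in> U}"
  have "istopology ?L"
    unfolding istopology_def
  proof (intro conjI allI impI)
    fix S T assume "?L S" "?L T"
    moreover have "{(p, f). clsH D p f \<in> S \<inter> T} = {(p, f). clsH D p f \<in> S} \<inter> {(p, f). clsH D p f \<in> T}" by auto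
    ultimately show "S \<inter> T \<subseteq> H_bundle D" "open {(p, f). clsH D p f \<in> S \<inter> T}" by auto
  next
    fix \<K> assume "\<forall>K\<in>\<K>. ?L K"
    moreover have "{(p, f). clsH D p f \<in> \<Union>\<K>} = (\<Union>K\<in>\<K>. {(p, f). clsH D p f \<in> K})" by auto
    ultimately show "\<Union>\<K> \<subseteq> H_bundle D" "open {(p, f). clsH D p f \<in> \<Union>\<K>}" by auto
  qed
  then have openin: "openin (H_topology D) = ?L"
    unfolding H_topology_def by (rule topology_inverse')
  have "{(p, f). clsH D p f \<in> H_bundle D} = UNIV" by (auto simp: H_bundle_def H_fibre_def)
  then have "openin (H_topology D) (H_bundle D)" unfolding openin by simp
  then show ?thesis unfolding topspace_def openin by blast
qed

lemma inj_on_J: "inj_on J (H_bundle D)" and J_surj: "J ` H_bundle D = UNIV"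
  using kuiper homeomorphic_imp_injective_map[of "H_topology D" euclidean J]
    homeomorphic_imp_surjective_map[of "H_topology D" euclidean J]
  by (auto simp: kuiper_map_def topspace_H_topology)

lemma clsH_in_H_fibre: "projP D r = m \<Longrightarrow> clsH D r f \<in> H_fibre D m"
  unfolding H_fibre_def by blast

lemma H_fibre_in_bundle: "x \<in> H_fibre D m \<Longrightarrow> x \<in> H_bundle D"
  unfolding H_bundle_def by blast

lemma H_fibre_clsH:
  assumes "x \<in> H_fibre D m" "projP D r = m"
  shows "\<exists>f. x = clsH D r f"
proof -
  obtain p f where x: "x = clsH D p f" "projP D p = m" using assms(1) unfolding H_fibre_def by blast
  obtain g where "r = actP D p (- g)" using actP_transitive[of p r] x assms by auto
  then have "x = clsH D r (sigma D g f)" using x by (simp add: clsH_move)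
  then show ?thesis by blast
qed

lemma H_fibre_iff: "x \<in> H_bundle D \<Longrightarrow> x \<in> H_fibre D m \<longleftrightarrow> fst (J x) = m"
  unfolding H_bundle_def H_fibre_def by (auto simp: J_clsH)

lemma fst_J: "x \<in> H_fibre D m \<Longrightarrow> fst (J x) = m"
  using H_fibre_iff H_fibre_in_bundle by blast

definition Jinv :: "'m \<Rightarrow> 'l L2_dual \<Rightarrow> ('p \<times> 'l L2_dual) set"
  where "Jinv m h = inv_into (H_bundle D) J (m, h)"

lemma J_Jinv: "J (Jinv m h) = (m, h)"
  unfolding Jinv_def using J_surj by (intro f_inv_into_f) simp

lemma Jinv_in_bundle: "Jinv m h \<in> H_bundle D"
  unfolding Jinv_def using J_surj by (intro inv_into_into) simp

lemma Jinv_in_fibre: "Jinv m h \<in> H_fibre D m"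
  using H_fibre_iff[OF Jinv_in_bundle] J_Jinv by simp

lemma Jinv_J: "x \<in> H_fibre D m \<Longrightarrow> Jinv m (snd (J x)) = x"
  unfolding Jinv_def using fst_J[of x m] inv_into_f_f[OF inj_on_J H_fibre_in_bundle, of x m]
  by (metis prod.collapse)

lemma bij_U: "bij (U r)"
proof (rule bijI)
  show "inj (U r)"
  proof (rule injI)
    fix f g assume "U r f = U r g"
    then have "J (clsH D r f) = J (clsH D r g)" by (simp add: J_clsH)
    then have "clsH D r f = clsH D r g"
      using inj_on_J by (auto simp: inj_on_def intro: H_fibre_in_bundle[OF clsH_in_H_fibre])
    then show "f = g" by (simp add: clsH_inject)
  qed
  have "\<exists>f. h = U r f" for h
  proof -
    obtain f where "Jinv (projP D r) h = clsH D r f" using H_fibre_clsH[OF Jinv_in_fibre] by blast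
    then have "U r f = h" using J_Jinv[of "projP D r" h] by (simp add: J_clsH)
    then show ?thesis by blast
  qed
  then show "surj (U r)" by (auto simp: surj_def)
qed

lemma U_inject: "U r f = U r g \<longleftrightarrow> f = g"
  using bij_U[of r] by (auto simp: bij_def inj_eq)

lemma U_move: "U (actP D r (- g)) (sigma D g f) = U r f"
  by (simp add: U_def clsH_move)

lemma clsH_H_coord:
  assumes "x \<in> H_fibre D (projP D q)"
  shows "clsH D q (H_coord D q x) = x" "U q (H_coord D q x) = snd (J x)"
proof -
  obtain f where f: "x = clsH D q f" using H_fibre_clsH[OF assms] by blast
  then have "H_coord D q x = f" unfolding H_coord_def by (auto simp: clsH_inject)
  then show "clsH D q (H_coord D q x) = x" "U q (H_coord D q x) = snd (J x)" using f by (simp_all add: J_clsH)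
qed


subsection \<open>Elements of the bundles of forms\<close>

text \<open>Via J, an element of the fibre of the bundle of k-forms at m becomes an alternating form on the
  tangent space with values in the dual of \<open>L\<^sup>2(L)\<close>.\<close>

definition Form :: "('p \<times> ('v list \<Rightarrow> 'l L2_dual)) set \<Rightarrow> ('m, 'v) tangent list \<Rightarrow> 'l L2_dual"
  where "Form h ts = snd (J (HkR_eval D h ts))"

text \<open>Passing to another unitary frame changes the arguments by \<open>lam\<close> and the
  value by \<open>sigma\<close>; the first is absorbed by the inverse frame, the second by the
  class.\<close>

lemma HkR_eval_clsHkR:
  assumes q: "q \<in> PR D m" and ts: "set ts \<subseteq> tspace A m"
  shows "HkR_eval D (clsHkR D q F) ts = clsH D q (F (map (inv (frame q)) ts))"
  unfolding HkR_eval_def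
proof (rule the_equality)
  show "\<exists>q' F'. q' \<in> PR D (projP D q') \<and> clsHkR D q F = clsHkR D q' F' \<and>
      clsH D q (F (map (inv (frame q)) ts)) = clsH D q' (F' (map (inv (frame q')) ts))"
    using q PR_projP[OF q] by metis
  fix x assume "\<exists>q' F'. q' \<in> PR D (projP D q') \<and> clsHkR D q F = clsHkR D q' F' \<and>
      x = clsH D q' (F' (map (inv (frame q')) ts))"
  then obtain q' F' where q': "clsHkR D q F = clsHkR D q' F'" "x = clsH D q' (F' (map (inv (frame q')) ts))"
    by blast
  then obtain g where g: "q' = actP D q (- g)" "F' = sigma_k D g F" by (auto simp: clsHkR_eq_iff)
  have inv: "lam D (- g) (inv (frame q') t) = inv (frame q) t" if "t \<in> set ts" for t
  proof -
    have "t \<in> tspace A (projP D q')" using that ts PR_projP[OF q] by (auto simp: g(1) projP_actP)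
    from frame_inv_frame[OF this] have "frame q (lam D (- g) (inv (frame q') t)) = t"
      by (simp add: g(1) frame_actP)
    then show ?thesis by (metis inv_frame_frame)
  qed
  have "F' (map (inv (frame q')) ts) = sigma D g (F (map (inv (frame q)) ts))"
    unfolding g(2) sigma_k_def using inv by (simp add: o_def cong: map_cong)
  then show "x = clsH D q (F (map (inv (frame q)) ts))" using q'(2) g(1) by (simp add: clsH_move)
qed

lemma Form_clsHkR:
  "q \<in> PR D m \<Longrightarrow> set ts \<subseteq> tspace A m \<Longrightarrow> Form (clsHkR D q F) ts = U q (F (map (inv (frame q)) ts))"
  by (simp add: Form_def HkR_eval_clsHkR J_clsH)

lemma Form_frame:
  assumes "q \<in> PR D m"
  shows "Form (clsHkR D q F) (map (frame q) vs) = U q (F vs)"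
proof -
  have "set (map (frame q) vs) \<subseteq> tspace A m" using frame_in_tspace[of q] PR_projP[OF assms] by auto
  from Form_clsHkR[OF assms this] show ?thesis by (simp add: o_def inv_frame_frame)
qed

lemma sigma_k_Hk:
  assumes "F \<in> Hk k"
  shows "sigma_k D g F \<in> Hk k"
proof -
  have "linear (sigma D g)" by (intro linearI) (simp_all add: sigma_add sigma_scaleR)
  moreover have "linear (blinfun_apply (lam D (- g)))" by (rule bounded_linear.linear[OF blinfun.bounded_linear_right])
  ultimately show ?thesis
    using assms unfolding Hk_def sigma_k_def
    by (auto intro: alternating_form_apply[OF alternating_form_compose])
qed

lemma HkR_fibre_clsHkR:
  assumes "h \<in> HkR_fibre D k m" "q \<in> PR D m"
  shows "\<exists>F\<in>Hk k. h = clsHkR D q F"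
proof -
  obtain p F where h: "h = clsHkR D p F" "p \<in> PR D m" "F \<in> Hk k"
    using assms(1) unfolding HkR_fibre_def by blast
  obtain g where "g \<in> Ktilde D" "q = actP D p (- g)" using PR_transitive[OF h(2) assms(2)] by blast
  then have "h = clsHkR D q (sigma_k D g F)" using h by (simp add: clsHkR_move)
  then show ?thesis using sigma_k_Hk[OF h(3)] by blast
qed

lemma clsHkR_in_fibre: "q \<in> PR D m \<Longrightarrow> F \<in> Hk k \<Longrightarrow> clsHkR D q F \<in> HkR_fibre D k m"
  unfolding HkR_fibre_def by blast

text \<open>Both final identities are proved through this: the lists of frame vectors recover the
  coordinate of an element because \<open>U q\<close> is injective.\<close>

lemma Form_eqI:
  assumes h: "h \<in> HkR_fibre D k m" "h' \<in> HkR_fibre D k m"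
    and eq: "\<And>ts. set ts \<subseteq> tspace A m \<Longrightarrow> Form h ts = Form h' ts"
  shows "h = h'"
proof -
  obtain q where q: "q \<in> PR D m" using PR_nonempty by blast
  obtain F F' where F: "h = clsHkR D q F" "h' = clsHkR D q F'"
    using HkR_fibre_clsHkR[OF _ q] h by metis
  have "F vs = F' vs" for vs
  proof -
    have "set (map (frame q) vs) \<subseteq> tspace A m" using frame_in_tspace[of q] PR_projP[OF q] by auto
    from eq[OF this] show ?thesis by (simp add: F Form_frame[OF q] U_inject)
  qed
  then have "F = F'" by (rule ext)
  then show ?thesis by (simp add: F)
qed

lemma alternating_form_Form:
  assumes h: "h \<in> HkR_fibre D k m" and c: "c \<in> charts_at A m"
  shows "alternating_form UNIV k (\<lambda>vs. Form h (map (coord_vec A c m) vs))"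
proof -
  obtain q where q: "q \<in> PR D m" using PR_nonempty by blast
  obtain F where F: "F \<in> Hk k" "h = clsHkR D q F" using HkR_fibre_clsHkR[OF h q] by blast
  let ?L = "\<lambda>v. inv (frame q) (coord_vec A c m v)"
  have Fr: "frame q (?L v) = coord_vec A c m v" for v
    using frame_inv_frame[of _ q] coord_vec_in_tspace[OF manifold c] PR_projP[OF q] by simp
  have lin: "linear ?L"
  proof (rule linearI)
    fix u v a
    have "frame q (?L (u + v)) = frame q (?L u + ?L v)"
      unfolding linear_add[OF frame_props(1)] Fr by (rule linear_add[OF linear_coord_vec[OF manifold c]])
    then show "?L (u + v) = ?L u + ?L v" by (metis inv_frame_frame)
    have "frame q (?L (a *\<^sub>R u)) = frame q (a *\<^sub>R ?L u)"
      unfolding linear_scale[OF frame_props(1)] Fr by (rule linear_scale[OF linear_coord_vec[OF manifold c]])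
    then show "?L (a *\<^sub>R u) = a *\<^sub>R ?L u" by (metis inv_frame_frame)
  qed
  have "alternating_form UNIV k (\<lambda>vs. U q (F (map ?L vs)))"
    using F(1) unfolding Hk_def
    by (intro alternating_form_apply[OF alternating_form_compose[OF _ lin] linear_U]) simp
  moreover have "U q (F (map ?L vs)) = Form h (map (coord_vec A c m) vs)" for vs
    unfolding F(2) by (subst Form_clsHkR[OF q set_map_coord_vec[OF manifold c]]) (simp add: o_def)
  ultimately show ?thesis by simp
qed

text \<open>Lets alternation be checked on values in the trivialisation, where the exterior
  derivative is computed.\<close>

lemma Hk_if_U:
  assumes "alternating_form UNIV k (\<lambda>vs. U q (F vs))"
  shows "F \<in> Hk k"
proof -
  have "linear (inv (U q))"
  proof (rule linearI)
    fix f g a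
    have s: "U q (inv (U q) f) = f" for f using bij_U[of q] by (simp add: bij_def surj_f_inv_f)
    show "inv (U q) (f + g) = inv (U q) f + inv (U q) g"
      by (rule iffD1[OF U_inject[of q]]) (simp add: s linear_add[OF linear_U])
    show "inv (U q) (a *\<^sub>R f) = a *\<^sub>R inv (U q) f"
      by (rule iffD1[OF U_inject[of q]]) (simp add: s linear_scale[OF linear_U])
  qed
  from alternating_form_apply[OF assms this] show ?thesis
    using bij_U[of q] by (simp add: Hk_def bij_def inv_f_f)
qed

lemma zero_section_in_fibre: "zero_section D m \<in> HkR_fibre D k m"
  unfolding zero_section_def
  by (rule clsHkR_in_fibre[OF some_PR]) (simp add: Hk_def zero_fun_def alternating_form_0)

lemma Form_zero_section: "set ts \<subseteq> tspace A m \<Longrightarrow> Form (zero_section D m) ts = 0"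
  unfolding zero_section_def by (simp add: Form_clsHkR[OF some_PR] linear_0[OF linear_U])

text \<open>The same choice as inside \<open>tensor_sum\<close> and
  \<open>zero_section\<close>.\<close>

definition unitary_frame :: "'m \<Rightarrow> 'p"
  where "unitary_frame m = (SOME q. q \<in> PR D m)"

lemma unitary_frame: "unitary_frame m \<in> PR D m"
  unfolding unitary_frame_def by (rule some_PR)

lemma tensor_sum_eq:
  "tensor_sum D m I \<alpha> x = clsHkR D (unitary_frame m)
    (\<lambda>vs. \<Sum>i\<in>I. \<alpha> i (map (frame (unitary_frame m)) vs) *\<^sub>R H_coord D (unitary_frame m) (x i))"
  by (simp add: tensor_sum_def unitary_frame_def Let_def)

lemma U_tensor_sum:
  assumes "\<And>i. i \<in> I \<Longrightarrow> x i \<in> H_fibre D m"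
  shows "U (unitary_frame m) (\<Sum>i\<in>I. r i *\<^sub>R H_coord D (unitary_frame m) (x i)) = (\<Sum>i\<in>I. r i *\<^sub>R snd (J (x i)))"
proof -
  have "U (unitary_frame m) (H_coord D (unitary_frame m) (x i)) = snd (J (x i))" if "i \<in> I" for i
    using clsH_H_coord(2)[of "x i" "unitary_frame m"] assms[OF that] PR_projP[OF unitary_frame, of m] by simp
  then show ?thesis by (simp add: linear_sum[OF linear_U] linear_scale[OF linear_U])
qed

lemma map_frame_inv_frame:
  assumes "q \<in> PR D m" "set ts \<subseteq> tspace A m"
  shows "map (frame q) (map (inv (frame q)) ts) = ts"
  using assms PR_projP[OF assms(1)] frame_inv_frame[of _ q] by (induction ts) auto

lemma Form_tensor_sum:
  assumes "\<And>i. i \<in> I \<Longrightarrow> x i \<in> H_fibre D m" "set ts \<subseteq> tspace A m"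
  shows "Form (tensor_sum D m I \<alpha> x) ts = (\<Sum>i\<in>I. \<alpha> i ts *\<^sub>R snd (J (x i)))"
  unfolding tensor_sum_eq Form_clsHkR[OF unitary_frame assms(2)]
    map_frame_inv_frame[OF unitary_frame assms(2)] by (rule U_tensor_sum[OF assms(1)])


subsection \<open>The action of compact operators\<close>

text \<open>The unitary operator on the Hilbert space itself that corresponds to \<open>U r\<close>
  on its dual. \<open>flat\<close> and \<open>sharp\<close> are both antilinear, so the composite is
  linear.\<close>

definition Uc :: "'p \<Rightarrow> 'l L2 \<Rightarrow>\<^sub>L 'l L2"
  where "Uc r = Blinfun (\<lambda>v. sharp (U r (flat v)))"

definition Uci :: "'p \<Rightarrow> 'l L2 \<Rightarrow>\<^sub>L 'l L2"
  where "Uci r = Blinfun (\<lambda>v. sharp (inv (U r) (flat v)))"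

lemma norm_eq_if_L2_inner:
  "L2_inner (u :: 'l L2) u = L2_inner v v \<Longrightarrow> norm u = norm v"
  unfolding L2_inner_self by (simp only: of_real_eq_iff power2_eq_iff_nonneg norm_ge_zero)

lemma Uc_inner: "L2_inner (sharp (U r (flat u))) (sharp (U r (flat v))) = L2_inner u v"
  using dual_inner_U[of r "flat v" "flat u"] by (simp add: dual_inner_flat dual_inner_def[of "U r _"])

lemma Uc_complex_linear: "complex_linear (\<lambda>v. sharp (U r (flat v)))"
  using complex_linear_U[of r] by (simp add: complex_linear_def flat_add flat_scaleC sharp_add sharp_scaleC)

lemma bounded_linear_isometry:
  assumes "complex_linear (T :: 'l L2 \<Rightarrow> 'l L2)" "\<And>v. norm (T v) = norm v"
  shows "bounded_linear T"
  using complex_linear_linear[OF assms(1)] assms(2)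
  by (intro bounded_linear_intro[where K = 1]) (auto simp: linear_add linear_scale)

lemma Uc_apply: "Uc r v = sharp (U r (flat v))"
proof -
  have "norm (sharp (U r (flat v))) = norm v" for v
    by (rule norm_eq_if_L2_inner[OF Uc_inner])
  from bounded_linear_isometry[OF Uc_complex_linear this] show ?thesis
    unfolding Uc_def by (simp add: bounded_linear_Blinfun_apply)
qed

lemma sharp_inv_U: "sharp (U r (flat (sharp (inv (U r) (flat v))))) = v"
  "sharp (inv (U r) (flat (sharp (U r (flat v))))) = v"
  using bij_U[of r] by (simp_all add: flat_sharp sharp_flat bij_def surj_f_inv_f inv_f_f)

lemma Uci_complex_linear: "complex_linear (\<lambda>v. sharp (inv (U r) (flat v)))"
proof -
  let ?T = "\<lambda>v. sharp (inv (U r) (flat v))" and ?S = "\<lambda>v. sharp (U r (flat v))"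
  have inj: "a = b" if "?S a = ?S b" for a b using that sharp_inv_U(2) by metis
  have "?T (x + y) = ?T x + ?T y" for x y
    by (rule inj) (simp only: complex_linear_add[OF Uc_complex_linear] sharp_inv_U)
  moreover have "?T (c *\<^sub>C x) = c *\<^sub>C ?T x" for c x
    by (rule inj) (simp only: complex_linear_scaleC[OF Uc_complex_linear] sharp_inv_U)
  ultimately show ?thesis by (simp add: complex_linear_def)
qed

lemma Uci_apply: "Uci r v = sharp (inv (U r) (flat v))"
proof -
  have "norm (sharp (inv (U r) (flat v))) = norm v" for v
    using Uc_inner[of r "sharp (inv (U r) (flat v))" "sharp (inv (U r) (flat v))"]
    unfolding sharp_inv_U by (rule norm_eq_if_L2_inner[OF sym])
  from bounded_linear_isometry[OF Uci_complex_linear this] show ?thesis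
    unfolding Uci_def by (simp add: bounded_linear_Blinfun_apply)
qed

lemma Uc_Uci: "Uc r (Uci r v) = v" and Uci_Uc: "Uci r (Uc r v) = v"
  by (simp_all add: Uc_apply Uci_apply sharp_inv_U)

lemma complex_linear_Uc: "complex_linear (blinfun_apply (Uc r))"
  and complex_linear_Uci: "complex_linear (blinfun_apply (Uci r))"
  using Uc_complex_linear Uci_complex_linear by (simp_all add: Uc_apply[abs_def] Uci_apply[abs_def])

lemma norm_Uc: "norm (Uc r v) = norm v" and norm_Uci: "norm (Uci r v) = norm v"
proof -
  show *: "norm (Uc r v) = norm v" for v
    unfolding Uc_apply by (rule norm_eq_if_L2_inner[OF Uc_inner])
  show "norm (Uci r v) = norm v" using *[of "Uci r v"] by (simp add: Uc_Uci)
qed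

text \<open>Unitarity of \<open>U r\<close> makes it the transpose of the inverse of
  \<open>Uc r\<close>, and this is what makes \<open>J_CH\<close> act on rank one operators by
  conjugation.\<close>

lemma functional_U: "functional (U r f) w = functional f (Uci r w)"
proof -
  have "functional (U r f) w = L2_inner (Uc r (sharp f)) (Uc r (Uci r w))"
    unfolding functional_sharp[of "U r f"] by (simp add: Uc_apply[of r "sharp f"] flat_sharp Uc_Uci)
  also have "\<dots> = functional f (Uci r w)"
    unfolding Uc_apply Uc_inner by (simp add: functional_sharp)
  finally show ?thesis .
qed

lemma Uc_move: "Uc (actP D r (- g)) (ssw D g v) = Uc r v"
  by (simp add: Uc_apply sigma_flat[symmetric] U_move)

lemma kuiper_check_clsHcheck: "kuiper_check D J (clsHcheck D r v) = (projP D r, Uc r v)"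
  unfolding kuiper_check_def
proof (rule the_equality)
  show "\<exists>r' v'. clsHcheck D r v = clsHcheck D r' v' \<and>
      (projP D r, Uc r v) = (projP D r', sharp (snd (J (clsH D r' (flat v')))))"
    by (auto simp: Uc_apply J_clsH)
  fix y assume "\<exists>r' v'. clsHcheck D r v = clsHcheck D r' v' \<and>
      y = (projP D r', sharp (snd (J (clsH D r' (flat v')))))"
  then obtain r' v' where "clsHcheck D r v = clsHcheck D r' v'" and y: "y = (projP D r', Uc r' v')"
    by (auto simp: Uc_apply J_clsH)
  then obtain g where "r' = actP D r (- g)" "v' = ssw D g v" by (auto simp: clsHcheck_eq_iff)
  then show "y = (projP D r, Uc r v)" using y by (simp add: projP_actP Uc_move)
qed

definition Ad :: "'p \<Rightarrow> ('l L2 \<Rightarrow>\<^sub>L 'l L2) \<Rightarrow> 'l L2 \<Rightarrow>\<^sub>L 'l L2"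
  where "Ad r b = Uc r o\<^sub>L b o\<^sub>L Uci r"

lemma Ad_rank_one: "Ad r (rank_one v f) = rank_one (Uc r v) (U r f)"
  by (rule blinfun_eqI)
    (simp add: Ad_def rank_one_apply functional_U complex_linear_scaleC[OF complex_linear_Uc])

lemma Ad_compact: "b \<in> compact_ops \<Longrightarrow> Ad r b \<in> compact_ops"
  unfolding Ad_def by (rule compact_ops_compose[OF complex_linear_Uc complex_linear_Uci]) (simp_all add: norm_Uci)

lemma Ad_add: "Ad r (b + b') = Ad r b + Ad r b'"
  by (rule blinfun_eqI) (simp add: Ad_def blinfun.add_left blinfun.add_right)

lemma Ad_op_scaleC: "Ad r (op_scaleC c b) = op_scaleC c (Ad r b)"
  by (rule blinfun_eqI) (simp add: Ad_def op_scaleC_apply complex_linear_scaleC[OF complex_linear_Uc])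

lemma continuous_on_Ad: "continuous_on S (Ad r)"
  unfolding Ad_def[abs_def]
  by (intro bounded_bilinear.continuous_on[OF bounded_bilinear_blinfun_compose] continuous_intros)

lemma Ad_move: "Ad (actP D r (- g)) (rho D g b) = Ad r b"
proof (rule blinfun_eqI)
  fix w
  have "Uci (actP D r (- g)) w = ssw D g (Uci r w)"
    using Uci_Uc[of "actP D r (- g)" "ssw D g (Uci r w)"] by (simp add: Uc_move Uc_Uci)
  then show "Ad (actP D r (- g)) (rho D g b) w = Ad r b w"
    by (simp add: Ad_def rho_def ssw_minus Uc_move)
qed

lemma Ad_inverse: "Ad r (Uci r o\<^sub>L a o\<^sub>L Uc r) = a"
  by (rule blinfun_eqI) (simp add: Ad_def Uc_Uci)

lemma inj_Ad: "Ad r b = Ad r b' \<Longrightarrow> b = b'"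
proof (rule blinfun_eqI)
  fix v assume "Ad r b = Ad r b'"
  then have "Ad r b (Uc r v) = Ad r b' (Uc r v)" by simp
  then have "Uc r (b v) = Uc r (b' v)" by (simp add: Ad_def Uci_Uc)
  then show "b v = b' v" by (metis Uci_Uc)
qed

text \<open>\<open>kuiper_CH\<close> is a choice, so an extension must be exhibited. Conjugation
  defines one because \<open>Ad_move\<close> makes it independent of the representative.\<close>

lemma extends_to_CH_exists: "\<exists>j. extends_to_CH D J j"
proof -
  define j where "j x = (THE y. \<exists>r b. x = clsCH D r b \<and> y = (projP D r, Ad r b))" for x
  have "j (clsCH D r b) = (projP D r, Ad r b)" for r b
    unfolding j_def
  proof (rule the_equality)
    fix y assume "\<exists>r' b'. clsCH D r b = clsCH D r' b' \<and> y = (projP D r', Ad r' b')"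
    then obtain r' b' where "clsCH D r b = clsCH D r' b'" and y: "y = (projP D r', Ad r' b')" by blast
    then obtain g where "r' = actP D r (- g)" "b' = rho D g b" by (auto simp: clsCH_eq_iff)
    then show "y = (projP D r, Ad r b)" using y by (simp add: projP_actP Ad_move)
  qed blast
  then have "extends_to_CH D J j"
    unfolding extends_to_CH_def
    by (simp add: Ad_compact Ad_add Ad_op_scaleC continuous_on_Ad Ad_rank_one kuiper_check_clsHcheck J_clsH)
  then show ?thesis by blast
qed

lemma extends_to_CH_unique:
  assumes j: "extends_to_CH D J j" and b: "b \<in> compact_ops"
  shows "j (clsCH D r b) = (projP D r, Ad r b)"
proof -
  define \<phi> where "\<phi> b = snd (j (clsCH D r b))" for b
  note ext = j[unfolded extends_to_CH_def, rule_format, of r]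
  have fst: "fst (j (clsCH D r b)) = projP D r" using ext b by blast
  have add: "\<phi> (b + b') = \<phi> b + \<phi> b'" if "b \<in> compact_ops" "b' \<in> compact_ops" for b b'
    unfolding \<phi>_def using ext that by blast
  have cont: "continuous_on compact_ops \<phi>" unfolding \<phi>_def[abs_def] using ext by blast
  have "j (clsCH D r (rank_one v f)) = (projP D r,
      rank_one (snd (kuiper_check D J (clsHcheck D r v))) (snd (J (clsH D r f))))" for v f
    using ext by blast
  then have r1: "\<phi> (rank_one v f) = Ad r (rank_one v f)" for v f
    by (simp add: \<phi>_def kuiper_check_clsHcheck J_clsH Ad_rank_one)
  \<comment> \<open>The empty sum must be covered as well, and the defining property of the
    extension speaks of rank one operators only.\<close>
  have zero: "(0 :: 'l L2 \<Rightarrow>\<^sub>L 'l L2) = rank_one 0 0"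
    by (rule blinfun_eqI) (simp add: rank_one_apply scaleC_zero_right)
  have fin: "(\<Sum>i<n. rank_one (u i) (f i)) \<in> compact_ops \<and>
      \<phi> (\<Sum>i<n. rank_one (u i) (f i)) = Ad r (\<Sum>i<n. rank_one (u i) (f i))" for n :: nat and u f
  proof (induction n)
    case 0
    then show ?case by (simp add: zero rank_one_compact r1)
  next
    case (Suc n)
    then show ?case by (simp add: compact_ops_add rank_one_compact add r1 Ad_add)
  qed
  have "\<exists>S. norm (b - S) \<le> inverse (real (Suc n)) \<and> S \<in> compact_ops \<and> \<phi> S = Ad r S" for n
  proof -
    obtain k u f where "norm (b - (\<Sum>i<k::nat. rank_one (u i) (f i))) \<le> inverse (real (Suc n))"
      using finite_rank_dense[OF b, of "inverse (real (Suc n))"] by auto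
    then show ?thesis using fin by blast
  qed
  then obtain S where S: "\<And>n. norm (b - S n) \<le> inverse (real (Suc n))"
      "\<And>n. S n \<in> compact_ops" "\<And>n. \<phi> (S n) = Ad r (S n)" by metis
  have "(\<lambda>n. S n - b) \<longlonglongrightarrow> 0"
    using S(1) by (intro Lim_null_comparison[OF _ LIMSEQ_inverse_real_of_nat]) (simp add: norm_minus_commute)
  then have "S \<longlonglongrightarrow> b" by (simp add: LIM_zero_iff)
  then have "(\<lambda>n. \<phi> (S n)) \<longlonglongrightarrow> \<phi> b" "(\<lambda>n. Ad r (S n)) \<longlonglongrightarrow> Ad r b"
    using S(2) b
    by (auto intro!: continuous_on_tendsto_compose[OF cont] continuous_on_tendsto_compose[OF continuous_on_Ad[of compact_ops]])
  then have "\<phi> b = Ad r b" unfolding S(3) by (rule LIMSEQ_unique)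
  then show ?thesis using fst unfolding \<phi>_def by (metis prod.collapse)
qed

lemma kuiper_CH_clsCH: "b \<in> compact_ops \<Longrightarrow> kuiper_CH D J (clsCH D r b) = (projP D r, Ad r b)"
  unfolding kuiper_CH_def by (rule extends_to_CH_unique[OF someI_ex[OF extends_to_CH_exists]])

text \<open>For injectivity, two classes with equal image lie over one point, so both can be written
  over the same frame, where conjugation is injective.\<close>

lemma inv_kuiper_CH:
  assumes a: "a \<in> compact_ops" and r: "projP D r = m"
  shows "inv_into (CH_bundle D) (kuiper_CH D J) (m, a) = clsCH D r (Uci r o\<^sub>L a o\<^sub>L Uc r)"
proof (rule inv_into_f_eq)
  have c: "Uci r o\<^sub>L a o\<^sub>L Uc r \<in> compact_ops"
    by (rule compact_ops_compose[OF complex_linear_Uci complex_linear_Uc _ a]) (simp add: norm_Uc)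
  then show "clsCH D r (Uci r o\<^sub>L a o\<^sub>L Uc r) \<in> CH_bundle D" unfolding CH_bundle_def by blast
  show "kuiper_CH D J (clsCH D r (Uci r o\<^sub>L a o\<^sub>L Uc r)) = (m, a)"
    by (simp add: kuiper_CH_clsCH[OF c] Ad_inverse r)
  show "inj_on (kuiper_CH D J) (CH_bundle D)"
  proof (rule inj_onI)
    fix x y assume "x \<in> CH_bundle D" "y \<in> CH_bundle D" and eq: "kuiper_CH D J x = kuiper_CH D J y"
    then obtain p b p' b' where x: "x = clsCH D p b" "b \<in> compact_ops" and y: "y = clsCH D p' b'" "b' \<in> compact_ops"
      unfolding CH_bundle_def by blast
    have "projP D p = projP D p'" "Ad p b = Ad p' b'" using eq x y by (auto simp: kuiper_CH_clsCH)
    then obtain g where g: "p' = actP D p (- g)" using actP_transitive by blast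
    then have "Ad p' (rho D g b) = Ad p' b'" using \<open>Ad p b = Ad p' b'\<close> by (simp add: Ad_move)
    then have "b' = rho D g b" using inj_Ad by metis
    then show "x = y" using x y g by (simp add: clsCH_move)
  qed
qed

text \<open>A change of frame acts on \<open>F vs\<close> by precomposition with the inverse
  operator and on \<open>b\<close> by conjugation; in the composite the inner factors
  cancel.\<close>

lemma fibre_mult_clsHkR:
  assumes q: "q \<in> PR D m" and b: "complex_linear (blinfun_apply b)"
  shows "fibre_mult D (clsHkR D q F) (clsCH D q b) = clsHkR D q (\<lambda>vs. dual_comp (F vs) b)"
  unfolding fibre_mult_def
proof (rule the_equality)
  show "\<exists>q' F' b'. q' \<in> PR D (projP D q') \<and> clsHkR D q F = clsHkR D q' F' \<and> clsCH D q b = clsCH D q' b' \<and>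
      clsHkR D q (\<lambda>vs. dual_comp (F vs) b) = clsHkR D q' (\<lambda>vs. dual_comp (F' vs) b')"
    using q PR_projP[OF q] by metis
  fix h assume "\<exists>q' F' b'. q' \<in> PR D (projP D q') \<and> clsHkR D q F = clsHkR D q' F' \<and> clsCH D q b = clsCH D q' b' \<and>
      h = clsHkR D q' (\<lambda>vs. dual_comp (F' vs) b')"
  then obtain q' F' b' where *: "clsHkR D q F = clsHkR D q' F'" "clsCH D q b = clsCH D q' b'"
    and h: "h = clsHkR D q' (\<lambda>vs. dual_comp (F' vs) b')" by blast
  then obtain g where g: "g \<in> Ktilde D" "q' = actP D q (- g)" "F' = sigma_k D g F" by (auto simp: clsHkR_eq_iff)
  have "clsCH D q' (rho D g b) = clsCH D q' b'" using * g by (simp add: clsCH_move)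
  then have b': "b' = rho D g b" by (simp add: clsCH_inject)
  have rho: "complex_linear (blinfun_apply (rho D g b))"
    using complex_linear_compose[OF ssw_complex_linear[of g] complex_linear_compose[OF b ssw_complex_linear[of "- g"]]]
    by (simp add: rho_def blinfun_compose.rep_eq o_def)
  have "dual_comp (sigma D g f) (rho D g b) = sigma D g (dual_comp f b)" for f
    by (rule L2_dual_eqI) (simp add: functional_dual_comp[OF rho] functional_dual_comp[OF b] functional_sigma,
        simp add: rho_def ssw_minus)
  then have "(\<lambda>vs. dual_comp (F' vs) b') = sigma_k D g (\<lambda>vs. dual_comp (F vs) b)"
    by (simp add: g(3) b' sigma_k_def)
  then show "h = clsHkR D q (\<lambda>vs. dual_comp (F vs) b)" using h g by (simp add: clsHkR_move)
qed

lemma section_mult_fibre: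
  assumes a: "a \<in> compact_ops" and s: "s m \<in> HkR_fibre D k m"
  shows "section_mult D J s a m \<in> HkR_fibre D k m"
    and "set ts \<subseteq> tspace A m \<Longrightarrow> Form (section_mult D J s a m) ts = dual_comp (Form (s m) ts) a"
proof -
  obtain q where q: "q \<in> PR D m" using PR_nonempty by blast
  obtain F where F: "F \<in> Hk k" "s m = clsHkR D q F" using HkR_fibre_clsHkR[OF s q] by blast
  define b where "b = Uci q o\<^sub>L a o\<^sub>L Uc q"
  have al: "complex_linear (blinfun_apply a)" by (rule complex_linear_compact_ops[OF a])
  have b: "complex_linear (blinfun_apply b)"
    using complex_linear_compose[OF complex_linear_Uci[of q] complex_linear_compose[OF al complex_linear_Uc[of q]]]
    by (simp add: b_def blinfun_compose.rep_eq o_def)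
  have sm: "section_mult D J s a m = clsHkR D q (\<lambda>vs. dual_comp (F vs) b)"
    unfolding section_mult_def inv_kuiper_CH[OF a PR_projP[OF q]] F(2) b_def[symmetric]
    by (rule fibre_mult_clsHkR[OF q b])
  have "(\<lambda>vs. dual_comp (F vs) b) \<in> Hk k"
    using F(1) alternating_form_apply[OF _ bounded_linear.linear[OF bounded_linear_dual_comp[OF b]]]
    by (auto simp: Hk_def)
  then show "section_mult D J s a m \<in> HkR_fibre D k m" unfolding sm by (rule clsHkR_in_fibre[OF q])
  \<comment> \<open>\<open>U q\<close> is precomposition with \<open>Uci q\<close>, which cancels
    the factor \<open>Uc q\<close> of \<open>b\<close>; what remains is precomposition with the
    constant operator \<open>a\<close>.\<close>
  have "U q (dual_comp f b) = dual_comp (U q f) a" for f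
    by (rule L2_dual_eqI)
      (simp add: functional_dual_comp[OF b] functional_dual_comp[OF al] functional_U, simp add: b_def Uc_Uci)
  then show "Form (section_mult D J s a m) ts = dual_comp (Form (s m) ts) a" if "set ts \<subseteq> tspace A m"
    unfolding sm F(2) by (simp add: Form_clsHkR[OF q that])
qed

end

section \<open>The Kuiper connection\<close>

context kuiper
begin

text \<open>The atlas of the model Hilbert space has a single chart, so charts of the product, and
  via \<open>J\<close> those of the bundle, are indexed by the charts of M.\<close>

definition pchart :: "('m, 'v) chart \<Rightarrow> ('m \<times> 'l L2_dual, 'v \<times> 'l L2_dual) chart"
  where "pchart c = (fst c \<times> UNIV, map_prod (snd c) id)"

definition hchart :: "('m, 'v) chart \<Rightarrow> (('p \<times> 'l L2_dual) set, 'v \<times> 'l L2_dual) chart"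
  where "hchart c = (H_bundle D \<inter> J -` (fst c \<times> UNIV), map_prod (snd c) id \<circ> J)"

abbreviation "B \<equiv> prod_atlas A (space_atlas :: ('l L2_dual, 'l L2_dual) atlas)"

lemma prod_atlas_eq: "B = pchart ` A"
proof -
  have "A \<times> (space_atlas :: ('l L2_dual, 'l L2_dual) atlas) = (\<lambda>c. (c, (UNIV, id))) ` A"
    by (auto simp: space_atlas_def)
  then show ?thesis by (simp add: prod_atlas_def image_image pchart_def[abs_def])
qed

lemma H_atlas_eq: "H_atlas D J = hchart ` A"
  unfolding H_atlas_def prod_atlas_eq image_image by (simp add: pchart_def hchart_def[abs_def])

lemma in_pchart: "(m, h) \<in> fst (pchart c) \<longleftrightarrow> m \<in> fst c"
  by (simp add: pchart_def)

lemma charts_at_space: "d \<in> charts_at space_atlas h \<longleftrightarrow> d = (UNIV, id)"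
  by (auto simp: charts_at_def space_atlas_def)

lemma charts_at_prod: "d \<in> charts_at B (m, h) \<longleftrightarrow> (\<exists>c\<in>charts_at A m. d = pchart c)"
  unfolding prod_atlas_eq charts_at_def using in_pchart by blast

lemma in_hchart: "x \<in> H_fibre D m \<Longrightarrow> x \<in> fst (hchart c) \<longleftrightarrow> m \<in> fst c"
  using fst_J[of x m] H_fibre_in_bundle[of x m] by (simp add: hchart_def mem_Times_iff)

lemma charts_at_H:
  assumes "x \<in> H_fibre D m"
  shows "d \<in> charts_at (H_atlas D J) x \<longleftrightarrow> (\<exists>c\<in>charts_at A m. d = hchart c)"
  unfolding H_atlas_eq charts_at_def using in_hchart[OF assms] by blast

lemma hchart_apply: "x \<in> H_fibre D m \<Longrightarrow> snd (hchart c) x = (snd c m, snd (J x))"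
  using fst_J[of x m] by (cases "J x") (simp add: hchart_def)

lemma pchart_apply: "snd (pchart c) (m, h) = (snd c m, h)"
  by (simp add: pchart_def)

lemma inj_on_chart: "c \<in> A \<Longrightarrow> inj_on (snd c) (fst c)"
  using chart_inv_chart[OF manifold, of c] by (metis inj_on_inverseI)

lemma chart_inv_pchart:
  assumes c: "c \<in> A" and y: "y \<in> snd c ` fst c"
  shows "chart_inv (pchart c) (y, h) = (chart_inv c y, h)"
  unfolding chart_inv_def[of "pchart c"]
proof (rule inv_into_f_eq)
  show "inj_on (snd (pchart c)) (fst (pchart c))"
    using inj_on_chart[OF c] by (auto simp: pchart_def inj_on_def)
  show "(chart_inv c y, h) \<in> fst (pchart c)" using chart_inv_in[OF manifold c y] by (simp add: pchart_def)
  show "snd (pchart c) (chart_inv c y, h) = (y, h)" using chart_chart_inv[OF manifold c y] by (simp add: pchart_def)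
qed

lemma chart_inv_hchart:
  assumes c: "c \<in> A" and y: "y \<in> snd c ` fst c"
  shows "chart_inv (hchart c) (y, h) = Jinv (chart_inv c y) h"
  unfolding chart_inv_def[of "hchart c"]
proof (rule inv_into_f_eq)
  show "inj_on (snd (hchart c)) (fst (hchart c))"
  proof (rule inj_onI)
    fix x x' assume x: "x \<in> fst (hchart c)" "x' \<in> fst (hchart c)" and eq: "snd (hchart c) x = snd (hchart c) x'"
    have "fst (J x) \<in> fst c" "fst (J x') \<in> fst c" using x by (auto simp: hchart_def mem_Times_iff)
    moreover have "snd c (fst (J x)) = snd c (fst (J x'))" "snd (J x) = snd (J x')"
      using eq by (auto simp: hchart_def map_prod_def split_beta)
    ultimately have "J x = J x'" using inj_on_chart[OF c] by (auto simp: inj_on_def prod_eq_iff)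
    then show "x = x'" using x inj_on_J by (auto simp: hchart_def inj_on_def)
  qed
  show "Jinv (chart_inv c y) h \<in> fst (hchart c)"
    using chart_inv_in[OF manifold c y] by (simp add: in_hchart[OF Jinv_in_fibre])
  show "snd (hchart c) (Jinv (chart_inv c y) h) = (y, h)"
    using chart_chart_inv[OF manifold c y] by (simp add: hchart_apply[OF Jinv_in_fibre] J_Jinv)
qed

text \<open>Chart changes of the product, and both \<open>J\<close> and its inverse in charts, all
  have this shape: a transition of M times the identity.\<close>

lemma frechet_derivative_chart_product:
  fixes f :: "'v \<times> 'l L2_dual \<Rightarrow> 'v \<times> 'l L2_dual"
  assumes c: "c \<in> charts_at A m" and d: "d \<in> charts_at A m"
    and f: "\<And>y h. y \<in> snd c ` fst c \<Longrightarrow> f (y, h) = (snd d (chart_inv c y), h)"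
  shows "frechet_derivative f (at (snd c m, h0)) z = (chart_change c d m (fst z), snd z)"
proof -
  have cA: "c \<in> A" "m \<in> fst c" using charts_atD[OF manifold c] by auto
  have "((\<lambda>z. snd d (chart_inv c (fst z))) has_derivative (\<lambda>z. chart_change c d m (fst z))) (at (snd c m, h0))"
    using diff_chain_at[OF has_derivative_fst[OF has_derivative_ident], of "\<lambda>y. snd d (chart_inv c y)"
        "chart_change c d m" "(snd c m, h0)"] chart_change_has_derivative[OF manifold c d]
    by (simp add: o_def)
  then have "((\<lambda>z. (snd d (chart_inv c (fst z)), snd z)) has_derivative (\<lambda>z. (chart_change c d m (fst z), snd z)))
      (at (snd c m, h0))"
    by (rule has_derivative_Pair[OF _ has_derivative_snd[OF has_derivative_ident]])
  then have "(f has_derivative (\<lambda>z. (chart_change c d m (fst z), snd z))) (at (snd c m, h0))"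
  proof (rule has_derivative_transform_within_open)
    show "open ((snd c ` fst c) \<times> (UNIV :: 'l L2_dual set))"
      by (intro open_Times open_chart_image[OF manifold cA(1)] open_UNIV)
    show "(snd c m, h0) \<in> (snd c ` fst c) \<times> UNIV" using cA by auto
    show "(snd d (chart_inv c (fst z)), snd z) = f z" if "z \<in> (snd c ` fst c) \<times> UNIV" for z
      using f[of "fst z" "snd z"] that by auto
  qed
  then show ?thesis by (rule frechet_derivative_eq)
qed

lemma chart_change_pchart:
  assumes c: "c \<in> charts_at A m" and d: "d \<in> charts_at A m"
  shows "chart_change (pchart c) (pchart d) (m, h) z = (chart_change c d m (fst z), snd z)"
  unfolding chart_change_def[of "pchart c"] pchart_apply
  by (rule frechet_derivative_chart_product[OF c d])
    (simp add: chart_inv_pchart[OF charts_atD(1)[OF manifold c]] pchart_apply)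

lemma some_chart_prod:
  obtains e where "e \<in> charts_at A m" "(SOME d. d \<in> charts_at B (m, h)) = pchart e"
proof -
  have "pchart (SOME c. c \<in> charts_at A m) \<in> charts_at B (m, h)"
    using some_chart_at[OF manifold] charts_at_prod by blast
  then have "(SOME d. d \<in> charts_at B (m, h)) \<in> charts_at B (m, h)" by (rule someI)
  then show thesis using charts_at_prod that by blast
qed

lemma some_chart_H:
  assumes "x \<in> H_fibre D m"
  obtains e where "e \<in> charts_at A m" "(SOME d. d \<in> charts_at (H_atlas D J) x) = hchart e"
proof -
  have "hchart (SOME c. c \<in> charts_at A m) \<in> charts_at (H_atlas D J) x"
    using some_chart_at[OF manifold] charts_at_H[OF assms] by blast
  then have "(SOME d. d \<in> charts_at (H_atlas D J) x) \<in> charts_at (H_atlas D J) x" by (rule someI)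
  then show thesis using charts_at_H[OF assms] that by blast
qed

text \<open>For \<open>ch\<close> either \<open>pchart\<close> or \<open>hchart\<close>: \<open>\<tau>\<close> is the family of chart components of a tangent vector of
  the product or of the bundle whose horizontal part is t and whose vertical part is v.\<close>

definition split_tangent :: "(('m, 'v) chart \<Rightarrow> ('x, 'v \<times> 'l L2_dual) chart) \<Rightarrow>
    'm \<Rightarrow> ('m, 'v) tangent \<Rightarrow> 'l L2_dual \<Rightarrow> ('x, 'v \<times> 'l L2_dual) tangent \<Rightarrow> bool"
  where "split_tangent ch m t v \<tau> \<longleftrightarrow> (\<forall>c\<in>charts_at A m. \<tau> (ch c) = (t c, v)) \<and>
    (\<forall>d. (\<forall>c\<in>charts_at A m. d \<noteq> ch c) \<longrightarrow> \<tau> d = 0)"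

lemma split_tangentI:
  "(\<And>c. c \<in> charts_at A m \<Longrightarrow> \<tau> (ch c) = (t c, v)) \<Longrightarrow>
    (\<And>d. \<not> (\<exists>c\<in>charts_at A m. d = ch c) \<Longrightarrow> \<tau> d = 0) \<Longrightarrow> split_tangent ch m t v \<tau>"
  unfolding split_tangent_def by blast

lemma split_tangent_unique:
  assumes "split_tangent ch m t v \<tau>" "split_tangent ch m t v \<tau>'"
  shows "\<tau> = \<tau>'"
proof
  fix d
  show "\<tau> d = \<tau>' d"
  proof (cases "\<exists>c\<in>charts_at A m. d = ch c")
    case True
    then obtain c where "c \<in> charts_at A m" "d = ch c" by blast
    then have "\<tau> d = (t c, v)" "\<tau>' d = (t c, v)" using assms unfolding split_tangent_def by blast+
    then show ?thesis by simp
  next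
    case False
    then have "\<tau> d = 0" "\<tau>' d = 0" using assms unfolding split_tangent_def by blast+
    then show ?thesis by simp
  qed
qed

section \<open>Tangent maps of sections, of J, of the projections and of the inverse of J\<close>

lemma H_section_derivative:
  assumes s: "H_section_on D J W s" and m: "m \<in> W" and c: "c \<in> charts_at A m"
  shows "(\<lambda>y. snd (J (s (chart_inv c y)))) differentiable (at (snd c m))"
    and "d \<in> charts_at A m \<Longrightarrow> frechet_derivative (snd (hchart d) \<circ> s \<circ> chart_inv c) (at (snd c m)) u =
      (chart_change c d m u, frechet_derivative (\<lambda>y. snd (J (s (chart_inv c y)))) (at (snd c m)) u)"
proof -
  have cA: "c \<in> A" "m \<in> fst c" using charts_atD[OF manifold c] by auto
  have fib: "s x \<in> H_fibre D x" if "x \<in> W" for x using s that by (simp add: H_section_on_def)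
  define V where "V = snd c ` (fst c \<inter> W \<inter> s -` fst (hchart c))"
  have "hchart c \<in> H_atlas D J" using cA by (simp add: H_atlas_eq)
  then have V: "open V" and sm: "smooth_on V (snd (hchart c) \<circ> s \<circ> chart_inv c)"
    using s cA unfolding H_section_on_def smooth_map_on_def V_def by blast+
  have mV: "snd c m \<in> V" unfolding V_def using m cA in_hchart[OF fib[OF m]] by blast
  have "(\<lambda>y. snd ((snd (hchart c) \<circ> s \<circ> chart_inv c) y)) differentiable (at (snd c m))"
    by (rule smooth_on_differentiable[OF smooth_on_bounded_linear[OF bounded_linear_snd V sm] mV])
  moreover have "(\<lambda>y. snd ((snd (hchart c) \<circ> s \<circ> chart_inv c) y)) = (\<lambda>y. snd (J (s (chart_inv c y))))"
    by (simp add: hchart_def fun_eq_iff)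
  ultimately show diff: "(\<lambda>y. snd (J (s (chart_inv c y)))) differentiable (at (snd c m))" by simp
  assume d: "d \<in> charts_at A m"
  have "((\<lambda>y. (snd d (chart_inv c y), snd (J (s (chart_inv c y))))) has_derivative
      (\<lambda>u. (chart_change c d m u, frechet_derivative (\<lambda>y. snd (J (s (chart_inv c y)))) (at (snd c m)) u)))
      (at (snd c m))"
    by (intro has_derivative_Pair chart_change_has_derivative[OF manifold c d] iffD1[OF frechet_derivative_works diff])
  then have "(snd (hchart d) \<circ> s \<circ> chart_inv c has_derivative
      (\<lambda>u. (chart_change c d m u, frechet_derivative (\<lambda>y. snd (J (s (chart_inv c y)))) (at (snd c m)) u)))
      (at (snd c m))"
  proof (rule has_derivative_transform_within_open[OF _ V mV])
    fix y assume "y \<in> V"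
    then obtain x where x: "x \<in> fst c" "x \<in> W" "y = snd c x" unfolding V_def by blast
    then have "chart_inv c y = x" using chart_inv_chart[OF manifold cA(1)] by simp
    then show "(snd d (chart_inv c y), snd (J (s (chart_inv c y)))) = (snd (hchart d) \<circ> s \<circ> chart_inv c) y"
      using hchart_apply[OF fib[OF x(2)], of d] by simp
  qed
  then show "frechet_derivative (snd (hchart d) \<circ> s \<circ> chart_inv c) (at (snd c m)) u =
      (chart_change c d m u, frechet_derivative (\<lambda>y. snd (J (s (chart_inv c y)))) (at (snd c m)) u)"
    by (rule frechet_derivative_eq)
qed

lemma tangent_map_section:
  assumes s: "H_section_on D J W s" and m: "m \<in> W" and t: "t \<in> tspace A m"
  defines "c \<equiv> SOME c. c \<in> charts_at A m"
  defines "v \<equiv> frechet_derivative (\<lambda>y. snd (J (s (chart_inv c y)))) (at (snd c m)) (t c)"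
  shows "\<exists>\<tau>. tangent_map A (H_atlas D J) s (m, t) = (s m, \<tau>) \<and> split_tangent hchart m t v \<tau>"
proof -
  have c: "c \<in> charts_at A m" unfolding c_def by (rule some_chart_at[OF manifold])
  have fib: "s m \<in> H_fibre D m" using s m by (simp add: H_section_on_def)
  define \<tau> where "\<tau> = snd (tangent_map A (H_atlas D J) s (m, t))"
  have \<tau>: "\<tau> d = (if d \<in> charts_at (H_atlas D J) (s m)
      then frechet_derivative (snd d \<circ> s \<circ> chart_inv c) (at (snd c m)) (t c) else 0)" for d
    unfolding \<tau>_def tangent_map_def c_def by (simp add: Let_def)
  have "split_tangent hchart m t v \<tau>"
  proof (rule split_tangentI)
    show "\<tau> (hchart d) = (t d, v)" if d: "d \<in> charts_at A m" for d
      using d H_section_derivative(2)[OF s m c d] tspace_change[OF manifold t c d] charts_at_H[OF fib]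
      unfolding \<tau> v_def by auto
    show "\<tau> d = 0" if "\<not> (\<exists>c\<in>charts_at A m. d = hchart c)" for d
      using that unfolding \<tau> charts_at_H[OF fib] by simp
  qed
  moreover have "tangent_map A (H_atlas D J) s (m, t) = (s m, \<tau>)"
    unfolding \<tau>_def by (simp add: tangent_map_def)
  ultimately show ?thesis by blast
qed

lemma tangent_map_J:
  assumes x: "x \<in> H_fibre D m" and t: "t \<in> tspace A m" and \<tau>: "split_tangent hchart m t v \<tau>"
  shows "\<exists>\<tau>'. tangent_map (H_atlas D J) B J (x, \<tau>) = (J x, \<tau>') \<and> split_tangent pchart m t v \<tau>'"
proof -
  obtain e where e: "e \<in> charts_at A m" "(SOME d. d \<in> charts_at (H_atlas D J) x) = hchart e"
    using some_chart_H[OF x] by blast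
  have eA: "e \<in> A" using charts_atD[OF manifold e(1)] by simp
  have Jx: "J x = (m, snd (J x))" using fst_J[OF x] by (metis prod.collapse)
  define \<tau>' where "\<tau>' = snd (tangent_map (H_atlas D J) B J (x, \<tau>))"
  have \<tau>': "\<tau>' d = (if d \<in> charts_at B (J x)
      then frechet_derivative (snd d \<circ> J \<circ> chart_inv (hchart e)) (at (snd (hchart e) x)) (\<tau> (hchart e)) else 0)" for d
    unfolding \<tau>'_def tangent_map_def by (simp add: Let_def e(2))
  have \<tau>e: "\<tau> (hchart e) = (t e, v)" using \<tau> e(1) unfolding split_tangent_def by blast
  have "frechet_derivative (snd (pchart d) \<circ> J \<circ> chart_inv (hchart e)) (at (snd (hchart e) x)) (t e, v) = (t d, v)"
    if d: "d \<in> charts_at A m" for d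
  proof -
    have "frechet_derivative (snd (pchart d) \<circ> J \<circ> chart_inv (hchart e)) (at (snd e m, snd (J x))) (t e, v) =
        (chart_change e d m (fst (t e, v)), snd (t e, v))"
      by (rule frechet_derivative_chart_product[OF e(1) d])
        (simp add: chart_inv_hchart[OF eA] J_Jinv pchart_apply)
    then show ?thesis by (simp add: hchart_apply[OF x] tspace_change[OF manifold t e(1) d])
  qed
  then have "split_tangent pchart m t v \<tau>'"
    using charts_at_prod[of _ m "snd (J x)"] unfolding Jx[symmetric]
    by (intro split_tangentI) (auto simp: \<tau>' \<tau>e)
  moreover have "tangent_map (H_atlas D J) B J (x, \<tau>) = (J x, \<tau>')"
    unfolding \<tau>'_def by (simp add: tangent_map_def)
  ultimately show ?thesis by blast
qed

text \<open>The splitting of the tangent space of a product. It guarantees that the vector described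
  in \<open>trivial_connection\<close> is unique.\<close>

lemma tspace_prod_iff:
  "\<tau> \<in> tspace B (m, h) \<longleftrightarrow> (\<exists>t\<in>tspace A m. \<exists>v. split_tangent pchart m t v \<tau>)"
proof
  assume \<tau>: "\<tau> \<in> tspace B (m, h)"
  have out: "\<tau> d = 0" if "\<forall>c\<in>charts_at A m. d \<noteq> pchart c" for d
    using \<tau> that charts_at_prod unfolding tspace_def by blast
  have ch: "\<tau> (pchart d) = (chart_change c d m (fst (\<tau> (pchart c))), snd (\<tau> (pchart c)))"
    if "c \<in> charts_at A m" "d \<in> charts_at A m" for c d
  proof -
    have "pchart c \<in> charts_at B (m, h)" "pchart d \<in> charts_at B (m, h)"
      using that charts_at_prod by blast+
    then have "\<tau> (pchart d) = chart_change (pchart c) (pchart d) (m, h) (\<tau> (pchart c))"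
      using \<tau> unfolding tspace_def by blast
    then show ?thesis by (simp add: chart_change_pchart[OF that])
  qed
  define t where "t c = (if c \<in> charts_at A m then fst (\<tau> (pchart c)) else 0)" for c
  define e where "e = (SOME c. c \<in> charts_at A m)"
  have e: "e \<in> charts_at A m" unfolding e_def by (rule some_chart_at[OF manifold])
  have "t \<in> tspace A m"
  proof (rule tspaceI[OF manifold])
    show "t c = 0" if "c \<notin> charts_at A m" for c using that by (simp add: t_def)
    show "chart_change c d m (t c) = t d" if "c \<in> charts_at A m" "d \<in> charts_at A m" for c d
    proof -
      have "fst (\<tau> (pchart d)) = chart_change c d m (fst (\<tau> (pchart c)))" by (subst ch[OF that]) simp
      then show ?thesis using that by (simp add: t_def)
    qed
  qed
  moreover have "split_tangent pchart m t (snd (\<tau> (pchart e))) \<tau>"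
  proof (rule split_tangentI)
    fix c assume c: "c \<in> charts_at A m"
    have "snd (\<tau> (pchart c)) = snd (\<tau> (pchart e))" by (subst ch[OF e c]) simp
    then show "\<tau> (pchart c) = (t c, snd (\<tau> (pchart e)))" using c by (simp add: t_def prod_eq_iff)
  qed (use out in blast)
  ultimately show "\<exists>t\<in>tspace A m. \<exists>v. split_tangent pchart m t v \<tau>" by blast
next
  assume "\<exists>t\<in>tspace A m. \<exists>v. split_tangent pchart m t v \<tau>"
  then obtain t v where t: "t \<in> tspace A m" and \<tau>: "split_tangent pchart m t v \<tau>" by blast
  have p: "\<tau> (pchart c) = (t c, v)" if "c \<in> charts_at A m" for c using \<tau> that unfolding split_tangent_def by blast
  have "\<tau> d = chart_change c d (m, h) (\<tau> c)" if cd: "c \<in> charts_at B (m, h)" "d \<in> charts_at B (m, h)" for c d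
  proof -
    obtain c' d' where "c' \<in> charts_at A m" "c = pchart c'" "d' \<in> charts_at A m" "d = pchart d'"
      using cd charts_at_prod by blast
    then show ?thesis using tspace_change[OF manifold t] by (simp add: p chart_change_pchart)
  qed
  moreover have "\<tau> d = 0" if "d \<notin> charts_at B (m, h)" for d
    using \<tau> that charts_at_prod unfolding split_tangent_def by blast
  ultimately show "\<tau> \<in> tspace B (m, h)" unfolding tspace_def by blast
qed

lemma tangent_map_projections:
  assumes t: "t \<in> tspace A m" and \<tau>: "split_tangent pchart m t v \<tau>"
  shows "tangent_map B A fst ((m, h), \<tau>) = (m, t)"
    and "tangent_map B (space_atlas :: ('l L2_dual, 'l L2_dual) atlas) snd ((m, h), \<tau>) =
      (h, \<lambda>d. if d = (UNIV, id) then v else 0)"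
proof -
  obtain e where e: "e \<in> charts_at A m" "(SOME d. d \<in> charts_at B (m, h)) = pchart e"
    using some_chart_prod by blast
  have eA: "e \<in> A" "m \<in> fst e" using charts_atD[OF manifold e(1)] by auto
  have \<tau>e: "\<tau> (pchart e) = (t e, v)" using \<tau> e(1) unfolding split_tangent_def by blast
  have op: "open ((snd e ` fst e) \<times> (UNIV :: 'l L2_dual set))"
    by (intro open_Times open_chart_image[OF manifold eA(1)] open_UNIV)
  have mem: "(snd e m, h) \<in> (snd e ` fst e) \<times> UNIV" using eA by auto
  have d1: "frechet_derivative (snd d \<circ> fst \<circ> chart_inv (pchart e)) (at (snd e m, h)) (t e, v) = t d"
    if d: "d \<in> charts_at A m" for d
  proof -
    have "frechet_derivative (snd d \<circ> fst \<circ> chart_inv (pchart e)) (at (snd e m, h)) =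
        frechet_derivative (\<lambda>z. snd d (chart_inv e (fst z))) (at (snd e m, h))"
      by (rule frechet_derivative_cong_open[OF op mem]) (auto simp: chart_inv_pchart[OF eA(1)])
    moreover have "((\<lambda>z. snd d (chart_inv e (fst z))) has_derivative (\<lambda>z. chart_change e d m (fst z))) (at (snd e m, h))"
      using diff_chain_at[OF has_derivative_fst[OF has_derivative_ident], of "\<lambda>y. snd d (chart_inv e y)"
          "chart_change e d m" "(snd e m, h)"] chart_change_has_derivative[OF manifold e(1) d]
      by (simp add: o_def)
    ultimately show ?thesis
      using tspace_change[OF manifold t e(1) d] by (simp add: frechet_derivative_eq)
  qed
  show "tangent_map B A fst ((m, h), \<tau>) = (m, t)"
    using d1 tspace_outside[OF manifold t]
    by (auto simp: tangent_map_def Let_def e(2) pchart_apply \<tau>e fun_eq_iff)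
  have "frechet_derivative (id \<circ> snd \<circ> chart_inv (pchart e)) (at (snd e m, h)) =
      frechet_derivative (\<lambda>z. snd z) (at (snd e m, h))"
    by (rule frechet_derivative_cong_open[OF op mem]) (auto simp: chart_inv_pchart[OF eA(1)])
  then have d2: "frechet_derivative (id \<circ> snd \<circ> chart_inv (pchart e)) (at (snd e m, h)) (t e, v) = v"
    using frechet_derivative_eq[OF has_derivative_snd[OF has_derivative_ident], of "(snd e m, h)" "(t e, v)"] by simp
  show "tangent_map B (space_atlas :: ('l L2_dual, 'l L2_dual) atlas) snd ((m, h), \<tau>) =
      (h, \<lambda>d. if d = (UNIV, id) then v else 0)"
    using d2 by (auto simp: tangent_map_def Let_def e(2) pchart_apply \<tau>e charts_at_space intro!: ext)
qed

text \<open>Components are prescribed on the charts \<open>pchart c\<close>, so it must be checked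
  that \<open>pchart c\<close> determines \<open>c\<close>.\<close>

lemma split_tangent_exists: "\<exists>\<tau>. split_tangent pchart m t v \<tau>" if "t \<in> tspace A m"
proof -
  have eq: "t c = t c'" if cc: "c \<in> charts_at A m" "c' \<in> charts_at A m" "pchart c = pchart c'" for c c'
  proof -
    have "fst c = fst c'" "snd c = snd c'" using cc(3)
      by (auto simp: pchart_def fun_eq_iff times_eq_iff map_prod_def)
    then have "c = c'" by (rule prod_eqI)
    then show ?thesis by simp
  qed
  define \<tau> where "\<tau> d = (if \<exists>c\<in>charts_at A m. d = pchart c
      then (t (SOME c. c \<in> charts_at A m \<and> d = pchart c), v) else 0)" for d
  have "\<tau> (pchart c) = (t c, v)" if c: "c \<in> charts_at A m" for c
  proof -
    let ?c = "SOME c'. c' \<in> charts_at A m \<and> pchart c = pchart c'"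
    have "?c \<in> charts_at A m \<and> pchart c = pchart ?c" by (rule someI[of _ c]) (simp add: c)
    then show ?thesis using c eq[of ?c c] unfolding \<tau>_def by auto
  qed
  moreover have "\<tau> d = 0" if "\<not> (\<exists>c\<in>charts_at A m. d = pchart c)" for d
    unfolding \<tau>_def using that by (rule if_not_P)
  ultimately have "split_tangent pchart m t v \<tau>" by (rule split_tangentI)
  then show ?thesis by blast
qed

lemma trivial_connection_split:
  assumes t: "t \<in> tspace A m" and \<tau>: "split_tangent pchart m t v \<tau>"
  shows "\<exists>\<tau>'. trivial_connection A ((m, h), \<tau>) = ((m, h), \<tau>') \<and> split_tangent pchart m 0 v \<tau>'"
proof -
  have z: "0 \<in> tspace A m" by (rule subspace_0[OF subspace_tspace[OF manifold]])
  obtain \<tau>' where \<tau>': "split_tangent pchart m 0 v \<tau>'" using split_tangent_exists[OF z] by blast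
  have "trivial_connection A ((m, h), \<tau>) = ((m, h), \<tau>')"
    unfolding trivial_connection_def Let_def
  proof (rule the_equality)
    show "fst ((m, h), \<tau>') = fst ((m, h), \<tau>) \<and> snd ((m, h), \<tau>') \<in> tspace B (fst ((m, h), \<tau>)) \<and>
        tangent_map B A fst ((m, h), \<tau>') = (fst (fst ((m, h), \<tau>)), 0) \<and>
        tangent_map B space_atlas snd ((m, h), \<tau>') = tangent_map B space_atlas snd ((m, h), \<tau>)"
      using z \<tau>' by (auto simp: tspace_prod_iff tangent_map_projections[OF z \<tau>'] tangent_map_projections[OF t \<tau>])
    fix \<sigma> assume \<sigma>: "fst \<sigma> = fst ((m, h), \<tau>) \<and> snd \<sigma> \<in> tspace B (fst ((m, h), \<tau>)) \<and>
        tangent_map B A fst \<sigma> = (fst (fst ((m, h), \<tau>)), 0) \<and>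
        tangent_map B space_atlas snd \<sigma> = tangent_map B space_atlas snd ((m, h), \<tau>)"
    then obtain \<sigma>' where \<sigma>': "\<sigma> = ((m, h), \<sigma>')" by (cases \<sigma>) auto
    then obtain u w where u: "u \<in> tspace A m" "split_tangent pchart m u w \<sigma>'" using \<sigma> by (auto simp: tspace_prod_iff)
    have "u = 0" using \<sigma> by (simp add: \<sigma>' tangent_map_projections[OF u])
    moreover have "(\<lambda>d. if d = (UNIV, id) then w else 0) = (\<lambda>d :: ('l L2_dual, 'l L2_dual) chart. if d = (UNIV, id) then v else 0)"
      using \<sigma> by (simp add: \<sigma>' tangent_map_projections[OF u] tangent_map_projections[OF t \<tau>])
    then have "w = v" by (metis (mono_tags))
    ultimately show "\<sigma> = ((m, h), \<tau>')" using split_tangent_unique[OF _ \<tau>'] u(2) by (simp add: \<sigma>')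
  qed
  then show ?thesis using \<tau>' by blast
qed

lemma tangent_map_inv_J:
  assumes x: "x \<in> H_fibre D m" and t: "t \<in> tspace A m" and \<tau>: "split_tangent pchart m t v \<tau>"
  shows "\<exists>\<tau>'. tangent_map B (H_atlas D J) (inv_into (H_bundle D) J) (J x, \<tau>) = (x, \<tau>') \<and> split_tangent hchart m t v \<tau>'"
proof -
  have Jx: "J x = (m, snd (J x))" using fst_J[OF x] by (metis prod.collapse)
  obtain e where e: "e \<in> charts_at A m" "(SOME d. d \<in> charts_at B (m, snd (J x))) = pchart e"
    using some_chart_prod by blast
  have eA: "e \<in> A" using charts_atD[OF manifold e(1)] by simp
  have inv: "inv_into (H_bundle D) J (J x) = x"
    by (rule inv_into_f_f[OF inj_on_J H_fibre_in_bundle[OF x]])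
  define \<tau>' where "\<tau>' = snd (tangent_map B (H_atlas D J) (inv_into (H_bundle D) J) (J x, \<tau>))"
  have \<tau>': "\<tau>' d = (if d \<in> charts_at (H_atlas D J) x
      then frechet_derivative (snd d \<circ> inv_into (H_bundle D) J \<circ> chart_inv (pchart e)) (at (snd (pchart e) (J x))) (\<tau> (pchart e)) else 0)" for d
    unfolding \<tau>'_def tangent_map_def using e(2) Jx by (simp add: Let_def inv)
  have \<tau>e: "\<tau> (pchart e) = (t e, v)" using \<tau> e(1) unfolding split_tangent_def by blast
  have "frechet_derivative (snd (hchart d) \<circ> inv_into (H_bundle D) J \<circ> chart_inv (pchart e)) (at (snd (pchart e) (J x))) (t e, v) = (t d, v)"
    if d: "d \<in> charts_at A m" for d
  proof -
    have "frechet_derivative (snd (hchart d) \<circ> inv_into (H_bundle D) J \<circ> chart_inv (pchart e)) (at (snd e m, snd (J x))) (t e, v) =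
        (chart_change e d m (fst (t e, v)), snd (t e, v))"
      by (rule frechet_derivative_chart_product[OF e(1) d])
        (simp add: chart_inv_pchart[OF eA] Jinv_def[symmetric] hchart_apply[OF Jinv_in_fibre] J_Jinv)
    moreover have "snd (pchart e) (J x) = (snd e m, snd (J x))" using pchart_apply[of e m "snd (J x)"] Jx by simp
    ultimately show ?thesis by (simp add: tspace_change[OF manifold t e(1) d])
  qed
  then have "split_tangent hchart m t v \<tau>'"
    using charts_at_H[OF x] by (intro split_tangentI) (auto simp: \<tau>' \<tau>e)
  moreover have "tangent_map B (H_atlas D J) (inv_into (H_bundle D) J) (J x, \<tau>) = (x, \<tau>')"
    unfolding \<tau>'_def by (simp add: tangent_map_def inv)
  ultimately show ?thesis by blast
qed

text \<open>In one frame the curve that is differentiated is affine, and its base point does not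
  move, so its derivative is \<open>(0, v)\<close> in every chart.\<close>

lemma vertical_lift_split:
  assumes x: "x \<in> H_fibre D m"
  shows "\<exists>\<tau>. vertical_lift D J (x, Jinv m v) = (x, \<tau>) \<and> split_tangent hchart m 0 v \<tau>"
proof -
  obtain r where r: "projP D r = m" using projP_surj by blast
  obtain f g where f: "x = clsH D r f" and g: "Jinv m v = clsH D r g"
    using H_fibre_clsH[OF x r] H_fibre_clsH[OF Jinv_in_fibre r] by metis
  have Ug: "U r g = v" using J_Jinv[of m v] by (simp add: g J_clsH)
  have sum: "fibre_add (clsH D) x (fibre_scale (clsH D) a (Jinv m v)) = clsH D r (f + a *\<^sub>R g)" for a
    by (simp add: f g fibre_scale_clsH fibre_add_clsH)
  define \<tau> where "\<tau> = snd (vertical_lift D J (x, Jinv m v))"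
  have \<tau>: "\<tau> d = (if d \<in> charts_at (H_atlas D J) x
      then vector_derivative (\<lambda>a. snd d (clsH D r (f + a *\<^sub>R g))) (at 0) else 0)" for d
    unfolding \<tau>_def vertical_lift_def by (simp add: sum)
  have "vector_derivative (\<lambda>a. snd (hchart c) (clsH D r (f + a *\<^sub>R g))) (at 0) = (0, v)" for c
  proof -
    have eq: "(\<lambda>a. snd (hchart c) (clsH D r (f + a *\<^sub>R g))) = (\<lambda>a. (snd c m, U r f + a *\<^sub>R v))"
      by (simp add: fun_eq_iff hchart_apply[OF clsH_in_H_fibre[OF r]] J_clsH linear_add[OF linear_U]
          linear_scale[OF linear_U] Ug)
    have "((\<lambda>a. (snd c m, U r f + a *\<^sub>R v)) has_vector_derivative (0, v)) (at 0)"
      by (auto intro!: derivative_eq_intros has_vector_derivative_Pair)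
    then show ?thesis unfolding eq by (rule vector_derivative_at)
  qed
  then have "split_tangent hchart m 0 v \<tau>"
    using charts_at_H[OF x] by (intro split_tangentI) (auto simp: \<tau>)
  moreover have "vertical_lift D J (x, Jinv m v) = (x, \<tau>)"
    unfolding \<tau>_def by (simp add: vertical_lift_def)
  ultimately show ?thesis by blast
qed

text \<open>\<open>connector\<close> inverts the lift by \<open>inv_into\<close>. The lift shows the
  base point \<open>x\<close>, and its vertical component determines \<open>y\<close> through
  \<open>J\<close>.\<close>

lemma inj_on_vertical_lift:
  "inj_on (vertical_lift D J) {(x, y). \<exists>m. x \<in> H_fibre D m \<and> y \<in> H_fibre D m}"
proof (rule inj_onI)
  fix p q assume p: "p \<in> {(x, y). \<exists>m. x \<in> H_fibre D m \<and> y \<in> H_fibre D m}"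
    and q: "q \<in> {(x, y). \<exists>m. x \<in> H_fibre D m \<and> y \<in> H_fibre D m}" and eq: "vertical_lift D J p = vertical_lift D J q"
  obtain x y m where p': "p = (x, y)" "x \<in> H_fibre D m" "y \<in> H_fibre D m" using p by blast
  obtain x' y' m' where q': "q = (x', y')" "x' \<in> H_fibre D m'" "y' \<in> H_fibre D m'" using q by blast
  have "x = x'" using eq p' q' by (simp add: vertical_lift_def)
  then have m: "m' = m" using fst_J p'(2) q'(2) by metis
  obtain \<tau> where \<tau>: "vertical_lift D J p = (x, \<tau>)" "split_tangent hchart m 0 (snd (J y)) \<tau>"
    using vertical_lift_split[OF p'(2), of "snd (J y)"] Jinv_J[OF p'(3)] p'(1) by auto
  obtain \<tau>' where \<tau>': "vertical_lift D J q = (x, \<tau>')" "split_tangent hchart m 0 (snd (J y')) \<tau>'"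
    using vertical_lift_split[OF q'(2), of "snd (J y')"] Jinv_J[OF q'(3)] q'(1) m \<open>x = x'\<close> by auto
  have "\<tau> = \<tau>'" using eq \<tau>(1) \<tau>'(1) by simp
  define c where "c = (SOME c. c \<in> charts_at A m)"
  have "c \<in> charts_at A m" unfolding c_def by (rule some_chart_at[OF manifold])
  then have "\<tau> (hchart c) = ((0 :: ('m, 'v) tangent) c, snd (J y))" "\<tau>' (hchart c) = ((0 :: ('m, 'v) tangent) c, snd (J y'))"
    using \<tau>(2) \<tau>'(2) unfolding split_tangent_def by blast+
  then have "snd (J y) = snd (J y')" using \<open>\<tau> = \<tau>'\<close> by simp
  then have "y = y'" using Jinv_J[OF p'(3)] Jinv_J[OF q'(3)] m by metis
  then show "p = q" using p' q' \<open>x = x'\<close> by simp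
qed

text \<open>In the trivialisation J the Kuiper connection is the flat one.\<close>

lemma nabla_eq:
  assumes s: "H_section_on D J W s" and m: "m \<in> W" and X: "X m \<in> tspace A m"
  defines "c \<equiv> SOME c. c \<in> charts_at A m"
  shows "nabla D J X s m = Jinv m (frechet_derivative (\<lambda>y. snd (J (s (chart_inv c y)))) (at (snd c m)) (X m c))"
proof -
  define v where "v = frechet_derivative (\<lambda>y. snd (J (s (chart_inv c y)))) (at (snd c m)) (X m c)"
  have fib: "s m \<in> H_fibre D m" using s m by (simp add: H_section_on_def)
  have z: "0 \<in> tspace A m" by (rule subspace_0[OF subspace_tspace[OF manifold]])
  have Js: "J (s m) = (m, snd (J (s m)))" using fst_J[OF fib] by (metis prod.collapse)
  \<comment> \<open>The pair of horizontal and vertical parts is followed through the factors of the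
    connection: \<open>(X m, v)\<close> is carried over by \<open>J\<close>, loses its horizontal
    part, and returns as \<open>(0, v)\<close>, the vertical lift of
    \<open>Jinv m v\<close>.\<close>
  obtain \<tau>1 where 1: "tangent_map A (H_atlas D J) s (m, X m) = (s m, \<tau>1)" "split_tangent hchart m (X m) v \<tau>1"
    using tangent_map_section[OF s m X] unfolding v_def c_def by blast
  obtain \<tau>2 where 2: "tangent_map (H_atlas D J) B J (s m, \<tau>1) = (J (s m), \<tau>2)" "split_tangent pchart m (X m) v \<tau>2"
    using tangent_map_J[OF fib X 1(2)] by blast
  obtain \<tau>3 where 3: "trivial_connection A (J (s m), \<tau>2) = (J (s m), \<tau>3)" "split_tangent pchart m 0 v \<tau>3"
    using trivial_connection_split[OF X 2(2), of "snd (J (s m))"] Js by auto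
  obtain \<tau>4 where 4: "tangent_map B (H_atlas D J) (inv_into (H_bundle D) J) (J (s m), \<tau>3) = (s m, \<tau>4)"
      "split_tangent hchart m 0 v \<tau>4"
    using tangent_map_inv_J[OF fib z 3(2)] by blast
  obtain \<tau> where \<tau>: "vertical_lift D J (s m, Jinv m v) = (s m, \<tau>)" "split_tangent hchart m 0 v \<tau>"
    using vertical_lift_split[OF fib] by blast
  have "kuiper_connection D J (s m, \<tau>1) = vertical_lift D J (s m, Jinv m v)"
    unfolding kuiper_connection_def by (simp add: 2(1) 3(1) 4(1) \<tau>(1) split_tangent_unique[OF 4(2) \<tau>(2)])
  moreover have "(s m, Jinv m v) \<in> {(x, y). \<exists>m. x \<in> H_fibre D m \<and> y \<in> H_fibre D m}"
    using fib Jinv_in_fibre by blast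
  ultimately have "connector D J (s m, \<tau>1) = Jinv m v"
    unfolding connector_def by (simp add: inv_into_f_f[OF inj_on_vertical_lift])
  then show ?thesis unfolding nabla_def 1(1) v_def .
qed

end

section \<open>The exterior covariant derivative\<close>

context kuiper
begin

definition local_form :: "('m \<Rightarrow> ('p \<times> ('v list \<Rightarrow> 'l L2_dual)) set) \<Rightarrow> ('m, 'v) chart \<Rightarrow> 'v \<Rightarrow> 'v list \<Rightarrow> 'l L2_dual"
  where "local_form S c y vs = Form (S (chart_inv c y)) (map (coord_vec A c (chart_inv c y)) vs)"

lemma chart_inv_charts_at: "c \<in> A \<Longrightarrow> y \<in> snd c ` fst c \<Longrightarrow> c \<in> charts_at A (chart_inv c y)"
  using chart_inv_in[OF manifold, of c y] by (simp add: charts_at_def)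

lemma HkR_sections_fibre: "S \<in> HkR_sections D J k \<Longrightarrow> S m \<in> HkR_fibre D k m"
  by (simp add: HkR_sections_def)

lemma local_form_alternating:
  assumes S: "S \<in> HkR_sections D J k" and c: "c \<in> A" and y: "y \<in> snd c ` fst c"
  shows "alternating_form UNIV k (local_form S c y)"
  using alternating_form_Form[OF HkR_sections_fibre[OF S] chart_inv_charts_at[OF c y]]
  by (simp add: local_form_def[abs_def])

lemma local_form_smooth:
  assumes S: "S \<in> HkR_sections D J k" and c: "c \<in> A"
  shows "smooth_on (snd c ` fst c) (\<lambda>y. local_form S c y vs)"
proof (cases "length vs = k")
  case True
  then show ?thesis using S c unfolding HkR_sections_def local_form_def Form_def by blast
next
  case False
  \<comment> \<open>\<open>HkR_sections\<close> asks for smoothness on lists of length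
    \<open>k\<close> only; on all others the form is identically zero.\<close>
  show ?thesis
    by (rule smooth_on_cong[OF open_chart_image[OF manifold c] _ smooth_on_const[of _ 0]])
      (simp add: alternating_form_length[OF local_form_alternating[OF S c] False])
qed

lemma HkR_sectionsI:
  assumes "\<And>m. S m \<in> HkR_fibre D k m" "\<And>c vs. c \<in> A \<Longrightarrow> smooth_on (snd c ` fst c) (\<lambda>y. local_form S c y vs)"
  shows "S \<in> HkR_sections D J k"
  using assms unfolding HkR_sections_def local_form_def Form_def by blast

lemma local_form_at:
  assumes c: "c \<in> charts_at A m" and ts: "set ts \<subseteq> tspace A m"
  shows "local_form S c (snd c m) (map (\<lambda>t. t c) ts) = Form (S m) ts"
  using map_coord_vec_components[OF manifold c ts] chart_inv_chart[OF manifold charts_atD[OF manifold c]]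
  by (simp add: local_form_def)

section \<open>Presentations by elementary tensors\<close>

lemma tensor_sum_eqI:
  assumes h: "h \<in> HkR_fibre D k m" and x: "\<And>i. i \<in> I \<Longrightarrow> x i \<in> H_fibre D m"
    and eq: "\<And>ts. set ts \<subseteq> tspace A m \<Longrightarrow> Form h ts = (\<Sum>i\<in>I. \<alpha> i ts *\<^sub>R snd (J (x i)))"
  shows "h = tensor_sum D m I \<alpha> x"
proof -
  obtain F where F: "h = clsHkR D (unitary_frame m) F" using HkR_fibre_clsHkR[OF h unitary_frame] by blast
  have "F vs = (\<Sum>i\<in>I. \<alpha> i (map (frame (unitary_frame m)) vs) *\<^sub>R H_coord D (unitary_frame m) (x i))" for vs
  proof -
    have "set (map (frame (unitary_frame m)) vs) \<subseteq> tspace A m"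
      using frame_in_tspace[of "unitary_frame m"] PR_projP[OF unitary_frame, of m] by auto
    from eq[OF this] have "U (unitary_frame m) (F vs) =
        (\<Sum>i\<in>I. \<alpha> i (map (frame (unitary_frame m)) vs) *\<^sub>R snd (J (x i)))"
      unfolding F Form_frame[OF unitary_frame] .
    also have "\<dots> = U (unitary_frame m)
        (\<Sum>i\<in>I. \<alpha> i (map (frame (unitary_frame m)) vs) *\<^sub>R H_coord D (unitary_frame m) (x i))"
      by (rule U_tensor_sum[OF x, symmetric])
    finally show ?thesis by (simp only: U_inject)
  qed
  then show ?thesis unfolding F tensor_sum_eq by (intro arg_cong2[where f = "clsHkR D"] ext) auto
qed

lemma H_section_on_Jinv:
  assumes c: "c \<in> A" and g: "smooth_on (snd c ` fst c) g"
  shows "H_section_on D J (fst c) (\<lambda>x. Jinv x (g (snd c x)))"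
  unfolding H_section_on_def smooth_map_on_def
proof (intro conjI ballI)
  let ?s = "\<lambda>x. Jinv x (g (snd c x))"
  show "?s m \<in> H_fibre D m" for m by (rule Jinv_in_fibre)
  show "?s ` fst c \<subseteq> \<Union> (fst ` H_atlas D J)"
  proof (rule image_subsetI)
    fix x assume "x \<in> fst c"
    then have "?s x \<in> fst (hchart c)" by (simp add: in_hchart[OF Jinv_in_fibre])
    then show "?s x \<in> \<Union> (fst ` H_atlas D J)" using c unfolding H_atlas_eq by blast
  qed
  fix b d assume b: "b \<in> A" and "d \<in> H_atlas D J"
  then obtain d' where d': "d' \<in> A" "d = hchart d'" unfolding H_atlas_eq by blast
  have eq: "fst b \<inter> fst c \<inter> ?s -` fst d = fst b \<inter> (fst c \<inter> fst d')"
  proof -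
    have "?s x \<in> fst d \<longleftrightarrow> x \<in> fst d'" for x
      unfolding d'(2) by (rule in_hchart[OF Jinv_in_fibre])
    then show ?thesis by blast
  qed
  let ?V = "snd b ` (fst b \<inter> (fst c \<inter> fst d'))"
  have V: "open ?V"
    by (intro open_chart_image_Int[OF manifold b] open_Int open_chart[OF manifold] c d')
  then show "open (snd b ` (fst b \<inter> fst c \<inter> ?s -` fst d))" unfolding eq .
  have "smooth_on ?V (\<lambda>y. (snd d' (chart_inv b y), g (snd c (chart_inv b y))))"
  proof (rule smooth_on_Pair[OF V])
    show "smooth_on ?V (\<lambda>y. snd d' (chart_inv b y))"
      by (rule smooth_on_subset[OF smooth_transition[OF manifold b d'(1)]]) auto
    show "smooth_on ?V (\<lambda>y. g (snd c (chart_inv b y)))"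
    proof (rule smooth_on_compose[OF V open_chart_image[OF manifold c] _ g])
      show "smooth_on ?V (\<lambda>y. snd c (chart_inv b y))"
        by (rule smooth_on_subset[OF smooth_transition[OF manifold b c]]) auto
      show "(\<lambda>y. snd c (chart_inv b y)) ` ?V \<subseteq> snd c ` fst c"
        using chart_inv_chart[OF manifold b] by auto
    qed
  qed
  then have "smooth_on ?V (snd d \<circ> ?s \<circ> chart_inv b)"
    unfolding d' by (simp add: o_def hchart_apply[OF Jinv_in_fibre] J_Jinv)
  then show "smooth_on (snd b ` (fst b \<inter> fst c \<inter> ?s -` fst d)) (snd d \<circ> ?s \<circ> chart_inv b)" unfolding eq .
qed

text \<open>Separates the condition in \<open>ext_cov_deriv\<close> from the value, so that
  existence and uniqueness of the described element can be treated apart.\<close>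

definition presentation :: "nat \<Rightarrow> ('m \<Rightarrow> ('p \<times> ('v list \<Rightarrow> 'l L2_dual)) set) \<Rightarrow> 'm \<Rightarrow> 'm set \<Rightarrow> nat \<Rightarrow>
    (nat \<Rightarrow> ('m, 'v) form) \<Rightarrow> (nat \<Rightarrow> 'm \<Rightarrow> ('p \<times> 'l L2_dual) set) \<Rightarrow>
    ('v \<Rightarrow> 'm \<Rightarrow> ('m, 'v) tangent) \<Rightarrow> ('v \<Rightarrow> ('m, 'v) form) \<Rightarrow> bool"
  where "presentation k S m W N \<alpha> s e \<epsilon> \<longleftrightarrow> open W \<and> m \<in> W \<and>
    (\<forall>j<N. smooth_form_on A W k (\<alpha> j) \<and> H_section_on D J W (s j)) \<and>
    dual_frames_on A W e \<epsilon> \<and>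
    (\<forall>x\<in>W. S x = tensor_sum D x {..<N} (\<lambda>j. \<alpha> j x) (\<lambda>j. s j x))"

definition presentation_value :: "'m \<Rightarrow> nat \<Rightarrow>
    (nat \<Rightarrow> ('m, 'v) form) \<Rightarrow> (nat \<Rightarrow> 'm \<Rightarrow> ('p \<times> 'l L2_dual) set) \<Rightarrow>
    ('v \<Rightarrow> 'm \<Rightarrow> ('m, 'v) tangent) \<Rightarrow> ('v \<Rightarrow> ('m, 'v) form) \<Rightarrow> ('p \<times> ('v list \<Rightarrow> 'l L2_dual)) set"
  where "presentation_value m N \<alpha> s e \<epsilon> = fibre_add (clsHkR D)
      (tensor_sum D m {..<N} (\<lambda>j. ext_deriv A (\<alpha> j) m) (\<lambda>j. s j m))
      (tensor_sum D m ({..<N} \<times> Basis)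
        (\<lambda>(j, i). wedge1 (\<epsilon> i m) (\<alpha> j m)) (\<lambda>(j, i). nabla D J (e i) (s j) m))"

lemma ext_cov_deriv_eq:
  "ext_cov_deriv D J k S m =
    (THE h. \<exists>W N \<alpha> s e \<epsilon>. presentation k S m W N \<alpha> s e \<epsilon> \<and> h = presentation_value m N \<alpha> s e \<epsilon>)"
  unfolding ext_cov_deriv_def presentation_def presentation_value_def by (simp add: conj_assoc)

text \<open>Near \<open>m\<close> a chart supplies everything: coordinate forms, coordinate frames,
  and sections that are constant multiples of the coefficients of the section in that chart.\<close>

lemma presentation_exists:
  assumes S: "S \<in> HkR_sections D J k"
  shows "\<exists>W N \<alpha> s e \<epsilon>. presentation k S m W N \<alpha> s e \<epsilon>"
proof -
  define c where "c = (SOME c. c \<in> charts_at A m)"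
  have "c \<in> charts_at A m" unfolding c_def by (rule some_chart_at[OF manifold])
  then have c: "c \<in> A" "m \<in> fst c" using charts_atD[OF manifold] by auto
  let ?\<I> = "{I :: 'v list. set I \<subseteq> Basis \<and> length I = k}"
  have fin: "finite ?\<I>" by (rule finite_lists_length_eq) simp
  obtain f where f: "bij_betw f {..<card ?\<I>} ?\<I>"
    using ex_bij_betw_nat_finite[OF fin] by (auto simp: atLeast0LessThan)
  \<comment> \<open>All orderings of each index are summed, so the coefficients carry the factor
    1/k!.\<close>
  define r :: real where "r = 1 / fact k"
  define s where "s = (\<lambda>j x. Jinv x (r *\<^sub>R local_form S c (snd c x) (f j)))"
  have len: "length (f j) = k" if "j < card ?\<I>" for j
    using f that by (auto simp: bij_betw_def)
  have "smooth_form_on A (fst c) k (chart_form A c (f j))" if "j < card ?\<I>" for j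
    using smooth_form_on_chart_form[OF manifold c(1), of "f j"] by (simp add: len[OF that])
  moreover have "H_section_on D J (fst c) (s j)" for j
    unfolding s_def
    by (intro H_section_on_Jinv[OF c(1)] smooth_on_bounded_linear[OF bounded_linear_scaleR_right]
        open_chart_image[OF manifold c(1)] local_form_smooth[OF S c(1)])
  moreover have "S x = tensor_sum D x {..<card ?\<I>} (\<lambda>j. chart_form A c (f j) x) (\<lambda>j. s j x)" if x: "x \<in> fst c" for x
  proof (rule tensor_sum_eqI[OF HkR_sections_fibre[OF S]])
    show "s j x \<in> H_fibre D x" for j unfolding s_def by (rule Jinv_in_fibre)
    fix ts assume ts: "set ts \<subseteq> tspace A x"
    have cx: "c \<in> charts_at A x" using c x by (simp add: charts_at_def)
    let ?ws = "map (\<lambda>t. t c) ts" and ?F = "local_form S c (snd c x)"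
    have "Form (S x) ts = ?F ?ws" using local_form_at[OF cx ts] by simp
    also have "\<dots> = r *\<^sub>R (fact k *\<^sub>R ?F ?ws)" by (simp add: r_def)
    also have "fact k *\<^sub>R ?F ?ws = (\<Sum>I\<in>?\<I>. basis_form I ?ws *\<^sub>R ?F I)"
      by (rule alternating_form_expand[symmetric, OF local_form_alternating[OF S c(1)]]) (use x in simp)
    also have "\<dots> = (\<Sum>j<card ?\<I>. basis_form (f j) ?ws *\<^sub>R ?F (f j))"
      by (rule sum.reindex_bij_betw[OF f, symmetric])
    also have "r *\<^sub>R \<dots> = (\<Sum>j<card ?\<I>. chart_form A c (f j) x ts *\<^sub>R snd (J (s j x)))"
      using ts by (simp add: scaleR_sum_right chart_form_def[OF manifold] s_def J_Jinv mult.commute)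
    finally show "Form (S x) ts = (\<Sum>j<card ?\<I>. chart_form A c (f j) x ts *\<^sub>R snd (J (s j x)))" .
  qed
  ultimately have "presentation k S m (fst c) (card ?\<I>) (\<lambda>j. chart_form A c (f j)) s
      (\<lambda>i x. coord_vec A c x i) (\<lambda>i. chart_form A c [i])"
    unfolding presentation_def using c dual_frames_on_chart[OF manifold c(1)] open_chart[OF manifold c(1)] by blast
  then show ?thesis by blast
qed

text \<open>By the product rule for the products of \<open>a\<close> and \<open>h\<close>, the
  derivatives of the form coefficients give the first tensor sum and those of the section
  coefficients the second. The right-hand side no longer mentions presentation or frames, which is
  the source of uniqueness.\<close>

lemma presentation_value_Form:
  assumes S: "S \<in> HkR_sections D J k" and p: "presentation k S m W N \<alpha> s e \<epsilon>"
  defines "c \<equiv> SOME c. c \<in> charts_at A m"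
  shows "presentation_value m N \<alpha> s e \<epsilon> \<in> HkR_fibre D (Suc k) m"
    and "set ts \<subseteq> tspace A m \<Longrightarrow>
      Form (presentation_value m N \<alpha> s e \<epsilon>) ts = extd (local_form S c) (snd c m) (map (\<lambda>t. t c) ts)"
proof -
  have W: "open W" "m \<in> W" and \<alpha>: "\<And>j. j < N \<Longrightarrow> smooth_form_on A W k (\<alpha> j)"
    and s: "\<And>j. j < N \<Longrightarrow> H_section_on D J W (s j)" and fr: "dual_frames_on A W e \<epsilon>"
    and Sx: "\<And>x. x \<in> W \<Longrightarrow> S x = tensor_sum D x {..<N} (\<lambda>j. \<alpha> j x) (\<lambda>j. s j x)"
    using p unfolding presentation_def by blast+
  have c: "c \<in> charts_at A m" unfolding c_def by (rule some_chart_at[OF manifold])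
  have cA: "c \<in> A" "m \<in> fst c" using charts_atD[OF manifold c] by auto
  have fib: "s j x \<in> H_fibre D x" if "j < N" "x \<in> W" for j x
    using s[OF that(1)] that(2) by (simp add: H_section_on_def)
  have e: "e i m \<in> tspace A m" if "i \<in> Basis" for i
    using fr W(2) that by (auto simp: dual_frames_on_def smooth_field_on_def)
  let ?q = "unitary_frame m" and ?y = "snd c m"
  define h where "h = (\<lambda>j y. snd (J (s j (chart_inv c y))))"
  define a where "a = (\<lambda>j us y. \<alpha> j (chart_inv c y) (map (coord_vec A c (chart_inv c y)) us))"
  define V where "V = snd c ` (fst c \<inter> W)"
  have V: "open V" "?y \<in> V"
    unfolding V_def using cA W by (auto intro: open_chart_image_Int[OF manifold])
  have dh: "h j differentiable (at ?y)" if "j < N" for j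
    unfolding h_def by (rule H_section_derivative(1)[OF s[OF that] W(2) c])
  have da: "a j us differentiable (at ?y)" if "j < N" for j us
  proof (rule smooth_on_differentiable[OF _ V(2)])
    show "smooth_on V (a j us)"
      using \<alpha>[OF that] cA(1) unfolding smooth_form_on_def V_def a_def by blast
  qed
  have inv: "chart_inv c ?y = m" by (rule chart_inv_chart[OF manifold cA])
  have loc: "local_form S c y us = (\<Sum>j<N. a j us y *\<^sub>R h j y)" if "y \<in> V" for y us
  proof -
    have y: "chart_inv c y \<in> W" "y \<in> snd c ` fst c"
      using that chart_inv_chart[OF manifold cA(1)] unfolding V_def by auto
    have "Form (tensor_sum D (chart_inv c y) {..<N} (\<lambda>j. \<alpha> j (chart_inv c y)) (\<lambda>j. s j (chart_inv c y)))
        (map (coord_vec A c (chart_inv c y)) us) = (\<Sum>j<N. a j us y *\<^sub>R h j y)"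
      unfolding a_def h_def
      by (rule Form_tensor_sum) (use y fib set_map_coord_vec[OF manifold chart_inv_charts_at[OF cA(1) y(2)]] in auto)
    then show ?thesis by (simp add: local_form_def Sx[OF y(1)])
  qed
  have dloc: "frechet_derivative (\<lambda>y. local_form S c y us) (at ?y) u =
      (\<Sum>j<N. a j us ?y *\<^sub>R frechet_derivative (h j) (at ?y) u + frechet_derivative (a j us) (at ?y) u *\<^sub>R h j ?y)" for us u
  proof -
    have "frechet_derivative (\<lambda>y. local_form S c y us) (at ?y) u =
        frechet_derivative (\<lambda>y. \<Sum>j<N. 1 *\<^sub>R (a j us y *\<^sub>R h j y)) (at ?y) u"
      by (rule fun_cong[OF frechet_derivative_cong_open[OF V]]) (simp add: loc)
    also have "\<dots> = (\<Sum>j<N. 1 *\<^sub>R frechet_derivative (\<lambda>y. a j us y *\<^sub>R h j y) (at ?y) u)"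
      by (rule frechet_derivative_sum_scaleR) (simp add: differentiable_scaleR da dh)
    also have "\<dots> = (\<Sum>j<N. a j us ?y *\<^sub>R frechet_derivative (h j) (at ?y) u +
        frechet_derivative (a j us) (at ?y) u *\<^sub>R h j ?y)"
      by (intro sum.cong refl) (simp add: frechet_derivative_scaleR[OF da dh])
    finally show ?thesis .
  qed
  define G1 where "G1 = (\<lambda>vs. \<Sum>j<N. ext_deriv A (\<alpha> j) m (map (frame ?q) vs) *\<^sub>R H_coord D ?q (s j m))"
  define G2 where "G2 = (\<lambda>vs. \<Sum>p\<in>{..<N} \<times> Basis. (case p of (j, i) \<Rightarrow> wedge1 (\<epsilon> i m) (\<alpha> j m)) (map (frame ?q) vs)
    *\<^sub>R H_coord D ?q (case p of (j, i) \<Rightarrow> nabla D J (e i) (s j) m))"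
  have val: "presentation_value m N \<alpha> s e \<epsilon> = clsHkR D ?q (G1 + G2)"
    unfolding presentation_value_def tensor_sum_eq fibre_add_clsHkR G1_def G2_def ..
  have nab: "nabla D J (e i) (s j) m = Jinv m (frechet_derivative (h j) (at ?y) (e i m c))"
    if "j < N" "i \<in> Basis" for i j
    unfolding h_def c_def by (rule nabla_eq[where X = "e i", OF s[OF that(1)] W(2) e[OF that(2)]])
  have main: "U ?q ((G1 + G2) vs) = extd (local_form S c) ?y (map (\<lambda>t. t c) (map (frame ?q) vs))" for vs
  proof -
    define ts where "ts = map (frame ?q) vs"
    have ts: "set ts \<subseteq> tspace A m"
      unfolding ts_def using frame_in_tspace[of ?q] PR_projP[OF unitary_frame, of m] by auto
    let ?ws = "map (\<lambda>t. t c) ts"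
    have tl: "ts ! l \<in> tspace A m" if "l < length ts" for l using ts that by (meson nth_mem subsetD)
    have dl: "set (delete_nth l ts) \<subseteq> tspace A m" for l by (rule subset_trans[OF set_delete_nth ts])
    have a_at: "a j (delete_nth l ?ws) ?y = \<alpha> j m (delete_nth l ts)" for j l
      unfolding a_def inv map_delete_nth[symmetric] map_coord_vec_components[OF manifold c dl] ..
    have ext: "ext_deriv A (\<alpha> j) m ts = (\<Sum>l<length ts. (- 1) ^ l *
        frechet_derivative (a j (delete_nth l ?ws)) (at ?y) ((ts ! l) c))" for j
      using ts unfolding ext_deriv_def Let_def c_def[symmetric] a_def
      by (simp add: map_delete_nth[symmetric] o_def)
    have "U ?q (G1 vs) = (\<Sum>j<N. ext_deriv A (\<alpha> j) m ts *\<^sub>R snd (J (s j m)))"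
      unfolding G1_def ts_def by (rule U_tensor_sum) (use fib W in auto)
    also have "\<dots> = (\<Sum>j<N. \<Sum>l<length ts. (- 1) ^ l *\<^sub>R
        (frechet_derivative (a j (delete_nth l ?ws)) (at ?y) ((ts ! l) c) *\<^sub>R h j ?y))"
      by (simp add: ext scaleR_sum_left h_def inv)
    finally have 1: "U ?q (G1 vs) = \<dots>" .
    \<comment> \<open>Contracting with the dual frames replaces the covariant derivatives along
      \<open>e i\<close> by the derivative in direction \<open>t\<close>, so the frames
      disappear.\<close>
    have fr_sum: "(\<Sum>i\<in>Basis. \<epsilon> i m [t] *\<^sub>R frechet_derivative (h j) (at ?y) (e i m c)) =
        frechet_derivative (h j) (at ?y) (t c)" if t: "t \<in> tspace A m" and j: "j < N" for t j
    proof -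
      have lin: "linear (frechet_derivative (h j) (at ?y))" by (rule linear_frechet_derivative[OF dh[OF j]])
      have "(\<Sum>i\<in>Basis. \<epsilon> i m [t] *\<^sub>R e i m) c = (\<Sum>i\<in>Basis. \<epsilon> i m [t] *\<^sub>R e i m c)"
        by (induction rule: infinite_finite_induct) (auto simp: scaleR_fun_def)
      then have "t c = (\<Sum>i\<in>Basis. \<epsilon> i m [t] *\<^sub>R e i m c)"
        unfolding dual_frames_expand[OF manifold fr W(2) t] .
      then show ?thesis by (simp add: linear_sum[OF lin] linear_scale[OF lin])
    qed
    have "U ?q (G2 vs) = (\<Sum>p\<in>{..<N} \<times> Basis. (case p of (j, i) \<Rightarrow> wedge1 (\<epsilon> i m) (\<alpha> j m)) ts
        *\<^sub>R snd (J (case p of (j, i) \<Rightarrow> nabla D J (e i) (s j) m)))"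
      unfolding G2_def ts_def by (rule U_tensor_sum) (auto simp: nab Jinv_in_fibre)
    also have "\<dots> = (\<Sum>j<N. \<Sum>i\<in>Basis. wedge1 (\<epsilon> i m) (\<alpha> j m) ts *\<^sub>R frechet_derivative (h j) (at ?y) (e i m c))"
      unfolding sum.cartesian_product by (intro sum.cong refl) (auto simp: nab J_Jinv)
    also have "\<dots> = (\<Sum>j<N. \<Sum>l<length ts. (- 1) ^ l *\<^sub>R (\<alpha> j m (delete_nth l ts) *\<^sub>R
        (\<Sum>i\<in>Basis. \<epsilon> i m [ts ! l] *\<^sub>R frechet_derivative (h j) (at ?y) (e i m c))))"
    proof (rule sum.cong[OF refl])
      fix j
      have "(\<Sum>i\<in>Basis. wedge1 (\<epsilon> i m) (\<alpha> j m) ts *\<^sub>R frechet_derivative (h j) (at ?y) (e i m c)) =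
          (\<Sum>i\<in>Basis. \<Sum>l<length ts. ((- 1) ^ l * \<epsilon> i m [ts ! l] * \<alpha> j m (delete_nth l ts)) *\<^sub>R
            frechet_derivative (h j) (at ?y) (e i m c))"
        by (simp add: wedge1_def scaleR_sum_left)
      also have "\<dots> = (\<Sum>l<length ts. \<Sum>i\<in>Basis. ((- 1) ^ l * \<epsilon> i m [ts ! l] * \<alpha> j m (delete_nth l ts)) *\<^sub>R
            frechet_derivative (h j) (at ?y) (e i m c))"
        by (rule sum.swap)
      also have "\<dots> = (\<Sum>l<length ts. (- 1) ^ l *\<^sub>R (\<alpha> j m (delete_nth l ts) *\<^sub>R
        (\<Sum>i\<in>Basis. \<epsilon> i m [ts ! l] *\<^sub>R frechet_derivative (h j) (at ?y) (e i m c))))"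
        by (simp add: scaleR_sum_right mult.assoc mult.commute mult.left_commute)
      finally show "(\<Sum>i\<in>Basis. wedge1 (\<epsilon> i m) (\<alpha> j m) ts *\<^sub>R frechet_derivative (h j) (at ?y) (e i m c)) = \<dots>" .
    qed
    also have "\<dots> = (\<Sum>j<N. \<Sum>l<length ts. (- 1) ^ l *\<^sub>R (a j (delete_nth l ?ws) ?y *\<^sub>R
        frechet_derivative (h j) (at ?y) ((ts ! l) c)))"
      by (intro sum.cong refl) (simp add: fr_sum tl a_at)
    finally have 2: "U ?q (G2 vs) = \<dots>" .
    have "extd (local_form S c) ?y ?ws = (\<Sum>l<length ts. \<Sum>j<N. (- 1) ^ l *\<^sub>R
        (a j (delete_nth l ?ws) ?y *\<^sub>R frechet_derivative (h j) (at ?y) ((ts ! l) c)) + (- 1) ^ l *\<^sub>R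
        (frechet_derivative (a j (delete_nth l ?ws)) (at ?y) ((ts ! l) c) *\<^sub>R h j ?y))"
      unfolding extd_def dloc by (simp add: scaleR_sum_right scaleR_add_right)
    also have "\<dots> = U ?q (G2 vs) + U ?q (G1 vs)"
      unfolding 1 2 by (subst sum.swap) (simp add: sum.distrib)
    also have "\<dots> = U ?q ((G1 + G2) vs)"
      by (simp add: linear_add[OF linear_U] add.commute)
    finally show ?thesis unfolding ts_def by simp
  qed
  \<comment> \<open>Membership in the fibre requires alternation of \<open>G1 + G2\<close>;
    \<open>main\<close> transfers it from \<open>extd\<close>, without a separate argument for the
    two summands.\<close>
  have "linear (\<lambda>v. frame ?q v c)"
    using frame_props(1)[of ?q] by (intro linearI) (simp_all add: linear_add linear_scale scaleR_fun_def)
  then have "alternating_form UNIV (Suc k) (\<lambda>vs. extd (local_form S c) ?y (map (\<lambda>v. frame ?q v c) vs))"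
    using cA by (intro alternating_form_compose alternating_form_extd[OF open_chart_image[OF manifold cA(1)]]
        local_form_alternating[OF S] local_form_smooth[OF S]) auto
  then have "alternating_form UNIV (Suc k) (\<lambda>vs. U ?q ((G1 + G2) vs))"
    unfolding main by (simp add: o_def)
  from clsHkR_in_fibre[OF unitary_frame Hk_if_U[OF this]]
  show "presentation_value m N \<alpha> s e \<epsilon> \<in> HkR_fibre D (Suc k) m" unfolding val .
  show "Form (presentation_value m N \<alpha> s e \<epsilon>) ts = extd (local_form S c) ?y (map (\<lambda>t. t c) ts)"
    if ts: "set ts \<subseteq> tspace A m"
    unfolding val Form_clsHkR[OF unitary_frame ts] main map_frame_inv_frame[OF unitary_frame ts] ..
qed

section \<open>The exterior covariant derivative in an arbitrary chart\<close>

lemma ext_cov_deriv_some_chart: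
  fixes m :: 'm
  assumes S: "S \<in> HkR_sections D J k"
  defines "c \<equiv> SOME c. c \<in> charts_at A m"
  shows "ext_cov_deriv D J k S m \<in> HkR_fibre D (Suc k) m"
    and "set ts \<subseteq> tspace A m \<Longrightarrow>
      Form (ext_cov_deriv D J k S m) ts = extd (local_form S c) (snd c m) (map (\<lambda>t. t c) ts)"
proof -
  obtain W N \<alpha> s e \<epsilon> where p: "presentation k S m W N \<alpha> s e \<epsilon>"
    using presentation_exists[OF S] by blast
  have "ext_cov_deriv D J k S m = presentation_value m N \<alpha> s e \<epsilon>"
    unfolding ext_cov_deriv_eq
  proof (rule the_equality)
    fix h assume "\<exists>W N \<alpha> s e \<epsilon>. presentation k S m W N \<alpha> s e \<epsilon> \<and> h = presentation_value m N \<alpha> s e \<epsilon>"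
    then obtain W' N' \<alpha>' s' e' \<epsilon>' where p': "presentation k S m W' N' \<alpha>' s' e' \<epsilon>'"
      and h: "h = presentation_value m N' \<alpha>' s' e' \<epsilon>'" by blast
    show "h = presentation_value m N \<alpha> s e \<epsilon>"
      unfolding h
      by (rule Form_eqI[OF presentation_value_Form(1)[OF S p'] presentation_value_Form(1)[OF S p]])
        (simp add: presentation_value_Form(2)[OF S p'] presentation_value_Form(2)[OF S p])
  qed (use p in blast)
  then show "ext_cov_deriv D J k S m \<in> HkR_fibre D (Suc k) m"
    and "set ts \<subseteq> tspace A m \<Longrightarrow>
      Form (ext_cov_deriv D J k S m) ts = extd (local_form S c) (snd c m) (map (\<lambda>t. t c) ts)"
    unfolding c_def using presentation_value_Form[OF S p] by simp_all
qed

text \<open>The two local forms are related by pullback along the transition map, so naturality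
  applies. This frees the formula from the chart that the choice operator selects at
  \<open>m\<close>.\<close>

lemma extd_local_form_chart:
  assumes S: "S \<in> HkR_sections D J k" and c: "c \<in> charts_at A m" and d: "d \<in> charts_at A m"
    and ts: "set ts \<subseteq> tspace A m"
  shows "extd (local_form S c) (snd c m) (map (\<lambda>t. t c) ts) = extd (local_form S d) (snd d m) (map (\<lambda>t. t d) ts)"
proof -
  have cA: "c \<in> A" "m \<in> fst c" and dA: "d \<in> A" "m \<in> fst d"
    using charts_atD[OF manifold c] charts_atD[OF manifold d] by auto
  let ?V = "snd c ` (fst c \<inter> fst d)" and ?\<phi> = "\<lambda>y. snd d (chart_inv c y)"
  have V: "open ?V" "snd c m \<in> ?V" using open_transition[OF manifold cA(1) dA(1)] cA dA by auto
  have \<phi>: "smooth_on ?V ?\<phi>" by (rule smooth_transition[OF manifold cA(1) dA(1)])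
  have im: "?\<phi> ` ?V \<subseteq> snd d ` fst d" using chart_inv_chart[OF manifold cA(1)] by auto
  have ws: "map (frechet_derivative ?\<phi> (at (snd c m))) (map (\<lambda>t. t c) ts) = map (\<lambda>t. t d) ts"
    using ts tspace_change[OF manifold _ c d] by (auto simp: chart_change_def o_def)
  have "extd (local_form S c) (snd c m) (map (\<lambda>t. t c) ts) =
      extd (\<lambda>z us. local_form S d (?\<phi> z) (map (frechet_derivative ?\<phi> (at z)) us)) (snd c m) (map (\<lambda>t. t c) ts)"
  proof (rule extd_cong[OF V])
    fix z us assume z: "z \<in> ?V"
    note ch = charts_at_chart_inv[OF manifold cA(1) dA(1) z]
    have "chart_inv d (?\<phi> z) = chart_inv c z"
      by (rule chart_inv_chart[OF manifold charts_atD[OF manifold ch(2)]])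
    moreover have "map (coord_vec A c (chart_inv c z)) us =
        map (coord_vec A d (chart_inv c z)) (map (frechet_derivative ?\<phi> (at z)) us)"
      by (simp add: coord_vec_change[OF manifold ch] chart_change_chart_inv[OF manifold cA(1) dA(1) z])
    ultimately show "local_form S c z us = local_form S d (?\<phi> z) (map (frechet_derivative ?\<phi> (at z)) us)"
      by (simp only: local_form_def)
  qed
  also have "\<dots> = extd (local_form S d) (?\<phi> (snd c m)) (map (frechet_derivative ?\<phi> (at (snd c m))) (map (\<lambda>t. t c) ts))"
    by (rule extd_pullback[OF V open_chart_image[OF manifold dA(1)] im \<phi> local_form_alternating[OF S dA(1)]
        local_form_smooth[OF S dA(1)]])
  also have "\<dots> = extd (local_form S d) (snd d m) (map (\<lambda>t. t d) ts)"
    unfolding ws by (simp add: chart_inv_chart[OF manifold cA])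
  finally show ?thesis .
qed

lemma Form_ext_cov_deriv:
  assumes S: "S \<in> HkR_sections D J k" and c: "c \<in> charts_at A m" and ts: "set ts \<subseteq> tspace A m"
  shows "Form (ext_cov_deriv D J k S m) ts = extd (local_form S c) (snd c m) (map (\<lambda>t. t c) ts)"
  unfolding ext_cov_deriv_some_chart(2)[OF S ts]
  by (rule extd_local_form_chart[OF S some_chart_at[OF manifold] c ts])

text \<open>Valid at all points of one chart domain, hence it can be differentiated again.\<close>

lemma local_form_ext_cov_deriv:
  assumes S: "S \<in> HkR_sections D J k" and c: "c \<in> A" and y: "y \<in> snd c ` fst c"
  shows "local_form (ext_cov_deriv D J k S) c y vs = extd (local_form S c) y vs"
proof -
  have ch: "c \<in> charts_at A (chart_inv c y)" by (rule chart_inv_charts_at[OF c y])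
  show ?thesis
    unfolding local_form_def[of "ext_cov_deriv D J k S"]
      Form_ext_cov_deriv[OF S ch set_map_coord_vec[OF manifold ch]] chart_chart_inv[OF manifold c y]
    by (simp add: o_def coord_vec_same[OF manifold ch])
qed

lemma ext_cov_deriv_section:
  assumes S: "S \<in> HkR_sections D J k"
  shows "ext_cov_deriv D J k S \<in> HkR_sections D J (Suc k)"
proof (rule HkR_sectionsI)
  show "ext_cov_deriv D J k S m \<in> HkR_fibre D (Suc k) m" for m
    by (rule ext_cov_deriv_some_chart(1)[OF S])
  fix c vs assume c: "c \<in> A"
  show "smooth_on (snd c ` fst c) (\<lambda>y. local_form (ext_cov_deriv D J k S) c y vs)"
    by (rule smooth_on_cong[OF open_chart_image[OF manifold c] _
          smooth_on_extd[OF open_chart_image[OF manifold c] local_form_smooth[OF S c]]])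
      (simp add: local_form_ext_cov_deriv[OF S c])
qed

section \<open>Compatibility with the module structure and the vanishing square\<close>

lemma local_form_section_mult:
  assumes S: "S \<in> HkR_sections D J k" and a: "a \<in> compact_ops" and c: "c \<in> A" and y: "y \<in> snd c ` fst c"
  shows "local_form (section_mult D J S a) c y vs = dual_comp (local_form S c y vs) a"
  unfolding local_form_def
  by (rule section_mult_fibre(2)[where s = S and m = "chart_inv c y", OF a HkR_sections_fibre[OF S] set_map_coord_vec[OF manifold chart_inv_charts_at[OF c y]]])

lemma section_mult_section:
  assumes S: "S \<in> HkR_sections D J k" and a: "a \<in> compact_ops"
  shows "section_mult D J S a \<in> HkR_sections D J k"
proof (rule HkR_sectionsI)
  show "section_mult D J S a m \<in> HkR_fibre D k m" for m
    by (rule section_mult_fibre(1)[where s = S, OF a HkR_sections_fibre[OF S]])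
  fix c vs assume c: "c \<in> A"
  show "smooth_on (snd c ` fst c) (\<lambda>y. local_form (section_mult D J S a) c y vs)"
    by (rule smooth_on_cong[OF open_chart_image[OF manifold c] _
          smooth_on_bounded_linear[OF bounded_linear_dual_comp[OF complex_linear_compact_ops[OF a]]
            open_chart_image[OF manifold c] local_form_smooth[OF S c]]])
      (simp add: local_form_section_mult[OF S a c])
qed

lemma ext_cov_deriv_section_mult:
  assumes S: "S \<in> HkR_sections D J k" and a: "a \<in> compact_ops"
  shows "ext_cov_deriv D J k (section_mult D J S a) = section_mult D J (ext_cov_deriv D J k S) a"
proof
  fix m
  note Sa = section_mult_section[OF S a] and dS = ext_cov_deriv_section[OF S]
  show "ext_cov_deriv D J k (section_mult D J S a) m = section_mult D J (ext_cov_deriv D J k S) a m"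
  proof (rule Form_eqI)
    show "ext_cov_deriv D J k (section_mult D J S a) m \<in> HkR_fibre D (Suc k) m"
      by (rule ext_cov_deriv_some_chart(1)[OF Sa])
    show "section_mult D J (ext_cov_deriv D J k S) a m \<in> HkR_fibre D (Suc k) m"
      by (rule section_mult_fibre(1)[where s = "ext_cov_deriv D J k S", OF a HkR_sections_fibre[OF dS]])
    fix ts assume ts: "set ts \<subseteq> tspace A m"
    define c where "c = (SOME c. c \<in> charts_at A m)"
    have c: "c \<in> charts_at A m" unfolding c_def by (rule some_chart_at[OF manifold])
    have cA: "c \<in> A" "m \<in> fst c" using charts_atD[OF manifold c] by auto
    have y: "snd c m \<in> snd c ` fst c" using cA by auto
    let ?ws = "map (\<lambda>t. t c) ts"
    have "Form (ext_cov_deriv D J k (section_mult D J S a) m) ts = extd (local_form (section_mult D J S a) c) (snd c m) ?ws"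
      by (rule Form_ext_cov_deriv[OF Sa c ts])
    also have "\<dots> = extd (\<lambda>z us. dual_comp (local_form S c z us) a) (snd c m) ?ws"
      by (rule extd_cong[OF open_chart_image[OF manifold cA(1)] y local_form_section_mult[OF S a cA(1)]])
    also have "\<dots> = dual_comp (extd (local_form S c) (snd c m) ?ws) a"
      by (rule extd_bounded_linear[OF bounded_linear_dual_comp[OF complex_linear_compact_ops[OF a]]
          smooth_on_differentiable[OF local_form_smooth[OF S cA(1)] y]])
    also have "\<dots> = Form (section_mult D J (ext_cov_deriv D J k S) a m) ts"
      unfolding section_mult_fibre(2)[where s = "ext_cov_deriv D J k S" and m = m, OF a HkR_sections_fibre[OF dS] ts] Form_ext_cov_deriv[OF S c ts] ..
    finally show "Form (ext_cov_deriv D J k (section_mult D J S a) m) ts =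
        Form (section_mult D J (ext_cov_deriv D J k S) a m) ts" .
  qed
qed

lemma ext_cov_deriv_ext_cov_deriv:
  assumes S: "S \<in> HkR_sections D J k"
  shows "ext_cov_deriv D J (Suc k) (ext_cov_deriv D J k S) = zero_section D"
proof
  fix m
  note dS = ext_cov_deriv_section[OF S]
  show "ext_cov_deriv D J (Suc k) (ext_cov_deriv D J k S) m = zero_section D m"
  proof (rule Form_eqI[OF ext_cov_deriv_some_chart(1)[OF dS] zero_section_in_fibre])
    fix ts assume ts: "set ts \<subseteq> tspace A m"
    define c where "c = (SOME c. c \<in> charts_at A m)"
    have c: "c \<in> charts_at A m" unfolding c_def by (rule some_chart_at[OF manifold])
    have cA: "c \<in> A" "m \<in> fst c" using charts_atD[OF manifold c] by auto
    have y: "snd c m \<in> snd c ` fst c" using cA by auto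
    let ?ws = "map (\<lambda>t. t c) ts"
    have "Form (ext_cov_deriv D J (Suc k) (ext_cov_deriv D J k S) m) ts =
        extd (local_form (ext_cov_deriv D J k S) c) (snd c m) ?ws"
      by (rule Form_ext_cov_deriv[OF dS c ts])
    also have "\<dots> = extd (extd (local_form S c)) (snd c m) ?ws"
      by (rule extd_cong[OF open_chart_image[OF manifold cA(1)] y local_form_ext_cov_deriv[OF S cA(1)]])
    also have "\<dots> = 0"
      by (rule extd_extd[OF open_chart_image[OF manifold cA(1)] y local_form_smooth[OF S cA(1)]])
    finally show "Form (ext_cov_deriv D J (Suc k) (ext_cov_deriv D J k S) m) ts = Form (zero_section D m) ts"
      by (simp add: Form_zero_section[OF ts])
  qed
qed

end

text \<open>The first two conjuncts keep both operations inside the smooth sections, so that the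
  composites in the other two are again operations on sections. Degrees above the dimension of
  \<open>'v\<close> are covered as well: alternating forms of such a degree vanish, so the fibres
  are zero.\<close>

theorem theorem16:
  fixes D :: "('v::euclidean_space, 'l::euclidean_space, 'm::{t2_space, second_countable_topology},
      'g::{topological_group_add, t2_space, second_countable_topology}, 'k::euclidean_space,
      'p::{t2_space, second_countable_topology}) metaplectic_data"
    and J :: "('p \<times> 'l L2_dual) set \<Rightarrow> 'm \<times> 'l L2_dual"
    and k :: nat
    and a :: "'l L2 \<Rightarrow>\<^sub>L 'l L2"
    and s :: "'m \<Rightarrow> ('p \<times> ('v list \<Rightarrow> 'l L2_dual)) set"
  assumes "symplectic_vector_space (om0 D)"
    and "compatible_complex_structure (om0 D) (J0 D)"
    and "lagrangian_embedding (om0 D) (iota D)"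
    and "connected_double_cover (om0 D) (atlasG D) (lam D)"
    and "segal_shale_weil (om0 D) (J0 D) (iota D) (lam D) (ssw D)"
    and "symplectic_manifold (atlasM D) (om D)"
    and "compatible_positive_acs (atlasM D) (om D) (JM D)"
    and "metaplectic_structure D"
    and "kuiper_map D J"
    and "a \<in> compact_ops"
    and "s \<in> HkR_sections D J k"
  shows "section_mult D J s a \<in> HkR_sections D J k \<and>
    ext_cov_deriv D J k s \<in> HkR_sections D J (k + 1) \<and>
    ext_cov_deriv D J k (section_mult D J s a) = section_mult D J (ext_cov_deriv D J k s) a \<and>
    ext_cov_deriv D J (k + 1) (ext_cov_deriv D J k s) = zero_section D"
proof -
  interpret kuiper D J
    using assms by unfold_locales
  show ?thesis
    using section_mult_section ext_cov_deriv_section ext_cov_deriv_section_mult ext_cov_deriv_ext_cov_deriv assms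
    by simp
qed

end
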